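(* Let $\omega\in\mathcal W^*$ and let $\phi$ be holomorphic on $\mathbb D$. Then the Hankel operator $H_{\bar\phi}$ extends to a bounded operator on $A^2_\omega$ if and only if $\phi\in\mathcal B^\omega$. In this case $$\|H_{\bar\phi}\|\asymp\sup_{z\in\mathbb D}\tau_\omega(z)|\phi'(z)|,$$ where the implied constants depend only on $\omega$.
   Context: $\mathbb D$ is the unit disc, $dA$ Lebesgue area measure. A weight is a Lebesgue-integrable function $\omega:\mathbb D\to(0,\infty)$ bounded below by a positive constant on compact subsets; $A^2_\omega$ the holomorphic functions with $\|f\|_\omega^2=\int_{\mathbb D}|f|^2\omega\,dA<\infty$; $L^2_\omega=L^2(\mathbb D,\omega dA)$; $P_\omega$ the orthogonal projection onto $A^2_\omega$; $K$ the reproducing kernel, $K_z=K(\cdot,z)$; $\tau_\omega(z)=1/(\omega(z)^{1/2}\|K_z\|_\omega)$. The class $\mathcal W$: (i) $\|K_z\|_\omega\to\infty$ as $|z|\to1^-$ and, for fixed $\zeta$, $|K(\zeta,z)|=o(\|K_z\|_\omega)$ as $|z|\to1^-$; (ii) $\tau_\omega(z)=O(1-|z|)$; (iii) there is $\eta>0$ such that $|z-\zeta|\le\eta\tau_\omega(z)$ implies $\tau_\omega(z)\asymp\tau_\omega(\zeta)$ and $\|K_z\|_\omega\|K_\zeta\|_\omega\lesssim|K(\zeta,z)|$. With $\Delta=\partial\bar\partial$, $\mathcal W^*$ consists of $\omega=e^{-\varphi}\in\mathcal W$, $\varphi\in C^2(\mathbb D)$ real, such that either $\tau_\omega^2\Delta\varphi\gtrsim1$,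 or there exist a subharmonic $\psi\ge0$ and $\delta>0$, $t\in(-1,0)$ with $\tau_\omega^2\Delta\psi\ge\delta$, $\Delta\varphi\ge t\Delta\psi$, $|\partial\psi|^2\le\Delta\psi$ on $\mathbb D$. The Hankel operator $H_{\bar\phi}f=\bar\phi f-P_\omega(\bar\phi f)$ is defined on finite linear combinations of the kernels $K_z$, with values in $L^2_\omega\ominus A^2_\omega$. $\mathcal B^\omega$ is the set of holomorphic $\phi$ on $\mathbb D$ with $\sup_{z\in\mathbb D}\tau_\omega(z)|\phi'(z)|<\infty$. *)

theory Defs
  imports "HOL-Analysis.Analysis"
begin

definition disc :: "complex set" where
  "disc = ball 0 1"

definition is_weight :: "(complex \<Rightarrow> real) \<Rightarrow> bool" where
  "is_weight \<omega> \<longleftrightarrow>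
     set_integrable lborel disc \<omega> \<and>
     (\<forall>z\<in>disc. \<omega> z > 0) \<and>
     (\<forall>C. compact C \<and> C \<subseteq> disc \<longrightarrow> (\<exists>c>0. \<forall>z\<in>C. c \<le> \<omega> z))"

definition L2w :: "(complex \<Rightarrow> real) \<Rightarrow> (complex \<Rightarrow> complex) set" where
  "L2w \<omega> = {f. set_borel_measurable lborel disc f \<and>
               set_integrable lborel disc (\<lambda>z. \<omega> z * (cmod (f z))\<^sup>2)}"

definition A2w :: "(complex \<Rightarrow> real) \<Rightarrow> (complex \<Rightarrow> complex) set" where
  "A2w \<omega> = {f. f holomorphic_on disc \<and> f \<in> L2w \<omega>}"

definition wip :: "(complex \<Rightarrow> real) \<Rightarrow> (complex \<Rightarrow> complex) \<Rightarrow> (complex \<Rightarrow> complex) \<Rightarrow> complex" where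
  "wip \<omega> f g = (LINT z:disc|lborel. f z * cnj (g z) * complex_of_real (\<omega> z))"

definition wnorm :: "(complex \<Rightarrow> real) \<Rightarrow> (complex \<Rightarrow> complex) \<Rightarrow> real" where
  "wnorm \<omega> f = sqrt (LINT z:disc|lborel. \<omega> z * (cmod (f z))\<^sup>2)"

text \<open>Orthogonal projection of L2w onto A2w (values on the disc are uniquely
  determined for f in L2w).\<close>
definition Pw :: "(complex \<Rightarrow> real) \<Rightarrow> (complex \<Rightarrow> complex) \<Rightarrow> (complex \<Rightarrow> complex)" where
  "Pw \<omega> f = (SOME g. g \<in> A2w \<omega> \<and> (\<forall>h\<in>A2w \<omega>. wip \<omega> (\<lambda>z. f z - g z) h = 0))"

definition is_repr_kernel :: "(complex \<Rightarrow> real) \<Rightarrow> (complex \<Rightarrow> complex \<Rightarrow> complex) \<Rightarrow> bool" where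
  "is_repr_kernel \<omega> K \<longleftrightarrow>
     (\<forall>w\<in>disc. (\<lambda>z. K z w) \<in> A2w \<omega>) \<and>
     (\<forall>f\<in>A2w \<omega>. \<forall>w\<in>disc. f w = wip \<omega> f (\<lambda>z. K z w))"

definition knorm :: "(complex \<Rightarrow> real) \<Rightarrow> (complex \<Rightarrow> complex \<Rightarrow> complex) \<Rightarrow> complex \<Rightarrow> real" where
  "knorm \<omega> K w = wnorm \<omega> (\<lambda>z. K z w)"

definition tau :: "(complex \<Rightarrow> real) \<Rightarrow> (complex \<Rightarrow> complex \<Rightarrow> complex) \<Rightarrow> complex \<Rightarrow> real" where
  "tau \<omega> K z = 1 / (sqrt (\<omega> z) * knorm \<omega> K z)"

definition class_W :: "(complex \<Rightarrow> real) \<Rightarrow> (complex \<Rightarrow> complex \<Rightarrow> complex) \<Rightarrow> bool" where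
  "class_W \<omega> K \<longleftrightarrow>
     \<comment> \<open>(i)\<close>
     (\<forall>M. \<exists>r<1. \<forall>z\<in>disc. r < cmod z \<longrightarrow> M < knorm \<omega> K z) \<and>
     (\<forall>\<zeta>\<in>disc. \<forall>\<epsilon>>0. \<exists>r<1. \<forall>z\<in>disc. r < cmod z \<longrightarrow>
         cmod (K \<zeta> z) \<le> \<epsilon> * knorm \<omega> K z) \<and>
     \<comment> \<open>(ii)\<close>
     (\<exists>C. \<forall>z\<in>disc. tau \<omega> K z \<le> C * (1 - cmod z)) \<and>
     \<comment> \<open>(iii)\<close>
     (\<exists>\<eta>>0. \<exists>C>0. \<forall>z\<in>disc. \<forall>\<zeta>\<in>disc. cmod (z - \<zeta>) \<le> \<eta> * tau \<omega> K z \<longrightarrow>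
         tau \<omega> K z \<le> C * tau \<omega> K \<zeta> \<and> tau \<omega> K \<zeta> \<le> C * tau \<omega> K z \<and>
         knorm \<omega> K z * knorm \<omega> K \<zeta> \<le> C * cmod (K \<zeta> z))"

definition pd :: "complex \<Rightarrow> (complex \<Rightarrow> real) \<Rightarrow> complex \<Rightarrow> real" where
  "pd v f z = deriv (\<lambda>t::real. f (z + of_real t * v)) 0"

definition C1_on :: "complex set \<Rightarrow> (complex \<Rightarrow> real) \<Rightarrow> bool" where
  "C1_on S f \<longleftrightarrow> continuous_on S f \<and>
     (\<forall>v\<in>{1, \<i>}. (\<forall>z\<in>S. (\<lambda>t::real. f (z + of_real t * v)) differentiable (at 0))
                 \<and> continuous_on S (pd v f))"

definition C2_on :: "complex set \<Rightarrow> (complex \<Rightarrow> real) \<Rightarrow> bool" where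
  "C2_on S f \<longleftrightarrow> C1_on S f \<and> (\<forall>v\<in>{1, \<i>}. C1_on S (pd v f))"

text \<open>\<open>\<Delta> = \<partial>\<bar>\<partial>\<close> = one quarter of the Euclidean Laplacian.\<close>
definition dbar_lap :: "(complex \<Rightarrow> real) \<Rightarrow> complex \<Rightarrow> real" where
  "dbar_lap f z = (pd 1 (pd 1 f) z + pd \<i> (pd \<i> f) z) / 4"

text \<open>\<open>|\<partial>f|\<^sup>2\<close> where \<open>\<partial> = (\<partial>_x - i \<partial>_y)/2\<close>.\<close>
definition del_sq :: "(complex \<Rightarrow> real) \<Rightarrow> complex \<Rightarrow> real" where
  "del_sq f z = ((pd 1 f z)\<^sup>2 + (pd \<i> f z)\<^sup>2) / 4"

definition subharmonic_on :: "complex set \<Rightarrow> (complex \<Rightarrow> real) \<Rightarrow> bool" where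
  "subharmonic_on S f \<longleftrightarrow>
     (\<forall>z\<in>S. \<forall>e>0. \<forall>\<^sub>F w in at z within S. f w < f z + e) \<and>
     (\<forall>z r. 0 < r \<and> cball z r \<subseteq> S \<longrightarrow>
        f z \<le> integral {0..2*pi} (\<lambda>t. f (z + of_real r * cis t)) / (2*pi))"

definition class_W_star :: "(complex \<Rightarrow> real) \<Rightarrow> (complex \<Rightarrow> complex \<Rightarrow> complex) \<Rightarrow> bool" where
  "class_W_star \<omega> K \<longleftrightarrow> class_W \<omega> K \<and>
     (\<exists>\<phi>. C2_on disc \<phi> \<and> (\<forall>z\<in>disc. \<omega> z = exp (- \<phi> z)) \<and>
        ((\<exists>c>0. \<forall>z\<in>disc. c \<le> (tau \<omega> K z)\<^sup>2 * dbar_lap \<phi> z) \<or>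
         (\<exists>\<psi> \<delta> t. C2_on disc \<psi> \<and> subharmonic_on disc \<psi> \<and> (\<forall>z\<in>disc. 0 \<le> \<psi> z) \<and>
            \<delta> > 0 \<and> -1 < t \<and> t < 0 \<and>
            (\<forall>z\<in>disc. \<delta> \<le> (tau \<omega> K z)\<^sup>2 * dbar_lap \<psi> z \<and>
                       t * dbar_lap \<psi> z \<le> dbar_lap \<phi> z \<and>
                       del_sq \<psi> z \<le> dbar_lap \<psi> z))))"

definition kspan :: "(complex \<Rightarrow> complex \<Rightarrow> complex) \<Rightarrow> (complex \<Rightarrow> complex) set" where
  "kspan K = {f. \<exists>(n::nat) c a. (\<forall>i<n. a i \<in> disc) \<and> f = (\<lambda>z. \<Sum>i<n. c i * K z (a i))}"

definition hankel :: "(complex \<Rightarrow> real) \<Rightarrow> (complex \<Rightarrow> complex) \<Rightarrow> (complex \<Rightarrow> complex) \<Rightarrow> (complex \<Rightarrow> complex)" where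
  "hankel \<omega> \<phi> f = (\<lambda>z. cnj (\<phi> z) * f z - Pw \<omega> (\<lambda>w. cnj (\<phi> w) * f w) z)"

text \<open>H extends to a bounded operator on A2w: it is defined on kspan
  (i.e. \<open>\<bar>\<phi>\<close> f lies in L2w) and is bounded there (kspan is dense in A2w).\<close>
definition hankel_bounded :: "(complex \<Rightarrow> real) \<Rightarrow> (complex \<Rightarrow> complex \<Rightarrow> complex) \<Rightarrow> (complex \<Rightarrow> complex) \<Rightarrow> bool" where
  "hankel_bounded \<omega> K \<phi> \<longleftrightarrow>
     (\<forall>f\<in>kspan K. (\<lambda>z. cnj (\<phi> z) * f z) \<in> L2w \<omega>) \<and>
     (\<exists>C. \<forall>f\<in>kspan K. wnorm \<omega> (hankel \<omega> \<phi> f) \<le> C * wnorm \<omega> f)"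

definition hankel_norm :: "(complex \<Rightarrow> real) \<Rightarrow> (complex \<Rightarrow> complex \<Rightarrow> complex) \<Rightarrow> (complex \<Rightarrow> complex) \<Rightarrow> real" where
  "hankel_norm \<omega> K \<phi> = Sup {wnorm \<omega> (hankel \<omega> \<phi> f) | f. f \<in> kspan K \<and> wnorm \<omega> f \<le> 1}"

definition bloch_w :: "(complex \<Rightarrow> real) \<Rightarrow> (complex \<Rightarrow> complex \<Rightarrow> complex) \<Rightarrow> (complex \<Rightarrow> complex) set" where
  "bloch_w \<omega> K = {\<phi>. \<phi> holomorphic_on disc \<and>
                     bdd_above ((\<lambda>z. tau \<omega> K z * cmod (deriv \<phi> z)) ` disc)}"

definition bloch_seminorm :: "(complex \<Rightarrow> real) \<Rightarrow> (complex \<Rightarrow> complex \<Rightarrow> complex) \<Rightarrow> (complex \<Rightarrow> complex) \<Rightarrow> real" where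
  "bloch_seminorm \<omega> K \<phi> = (SUP z\<in>disc. tau \<omega> K z * cmod (deriv \<phi> z))"

end

theory Submission
  imports Defs "HOL-Complex_Analysis.Complex_Analysis"
begin

text \<open>Write \<open>\<omega> = exp (- p)\<close>. For \<open>f\<close> in \<open>A\<^sup>2\<close> the error \<open>u = b f - P(b f)\<close> is orthogonal to \<open>A\<^sup>2\<close>, hence
  by Weyl's lemma a limit of functions \<open>exp p * cnj (\<bar>\<partial> g)\<close> with \<open>g\<close> a test function on the disc.
  Integrating by parts against \<open>\<bar>\<partial> u = f \<bar>\<partial> b\<close> reduces the upper bound to the dual estimate
  \<open>\<integral> |g|\<^sup>2 \<rho> exp p \<le> C \<integral> |\<bar>\<partial> g|\<^sup>2 exp p\<close> with \<open>\<tau>\<^sup>2 \<rho>\<close> bounded below. As \<open>g\<close> has compact support, this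
  follows from a twisted Hoermander identity without boundary terms; the twist by \<open>\<psi>\<close> gives
  the Donnelly-Fefferman case.

  For the lower bound, the normalised kernel \<open>k\<close> at \<open>w\<close> has no zeros on a disc of radius comparable to
  \<open>\<tau>(w)\<close> about \<open>w\<close>, where \<open>|k|\<^sup>2 \<omega>\<close> is at least a multiple of \<open>1 / \<tau>(w)\<^sup>2\<close>. There the Hankel operator gives
  \<open>H k / k = cnj \<phi> - (a holomorphic function)\<close>, and pairing with \<open>\<bar>\<partial>\<close> of a bump isolates \<open>cnj (\<phi>' w)\<close>.\<close>

section \<open>Square integrable functions\<close>

text \<open>Nothing is known about \<open>\<omega>\<close> or \<open>p\<close> near the unit circle,
  so no approximation up to the boundary is attempted. The dual estimate is only needed for
  compactly supported test functions, because their images under the adjoint of \<open>dbar\<close>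
  are already dense in the orthogonal complement of the Bergman space; Weyl's lemma supplies exactly
  this density, and the existence of the projection along with it. The weight on the dual side is
  \<open>exp p\<close>, the reciprocal of \<open>\<omega>\<close>: when \<open>f * dbar b\<close> is
  paired with \<open>g\<close>, the factor \<open>f\<close> takes \<open>sqrt \<omega>\<close> and
  leaves \<open>g / sqrt \<omega>\<close>.

  A separate obstacle is that \<open>cnj \<phi> * K_a\<close> must be shown square integrable before
  any bound on the Hankel operator makes sense, since neither \<open>\<phi>\<close> nor the kernel
  need be bounded. The symbol is cut off in a way that keeps its \<open>dbar\<close> derivative
  below \<open>|\<phi>'|\<close>.

  The bumps are powers of \<open>1 - |z - w|^2 / r^2\<close>, cut off at zero. Their
  \<open>dbar\<close> derivatives stay in the same family up to the factor \<open>z - w\<close>, so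
  mean values, Weyl's lemma and the lower bound all rest on one recursion in the exponent.\<close>

definition sqi :: "'a measure \<Rightarrow> ('a \<Rightarrow> complex) \<Rightarrow> bool" where
  "sqi M f \<longleftrightarrow> f \<in> borel_measurable M \<and> integrable M (\<lambda>x. (cmod (f x))\<^sup>2)"

definition ip :: "'a measure \<Rightarrow> ('a \<Rightarrow> complex) \<Rightarrow> ('a \<Rightarrow> complex) \<Rightarrow> complex" where
  "ip M f g = (\<integral>x. f x * cnj (g x) \<partial>M)"

definition nrm :: "'a measure \<Rightarrow> ('a \<Rightarrow> complex) \<Rightarrow> real" where
  "nrm M f = sqrt (\<integral>x. (cmod (f x))\<^sup>2 \<partial>M)"

lemma cnj_borel_measurable [measurable (raw)]:
  assumes "f \<in> borel_measurable M" shows "(\<lambda>x. cnj (f x)) \<in> borel_measurable M"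
  using assms borel_measurable_continuous_onI[OF continuous_on_cnj[OF continuous_on_id]]
  by (rule measurable_compose)

lemma sqi_measurable: "sqi M f \<Longrightarrow> f \<in> borel_measurable M"
  and sqi_integrable: "sqi M f \<Longrightarrow> integrable M (\<lambda>x. (cmod (f x))\<^sup>2)"
  by (auto simp: sqi_def)

lemma nrm_nonneg [simp]: "0 \<le> nrm M f"
  by (simp add: nrm_def)

lemma nrm_power2: "(nrm M f)\<^sup>2 = (\<integral>x. (cmod (f x))\<^sup>2 \<partial>M)"
  by (simp add: nrm_def)

lemma nrm_cong_cmod:
  assumes "\<And>x. x \<in> space M \<Longrightarrow> cmod (f x) = cmod (g x)" shows "nrm M f = nrm M g"
  unfolding nrm_def by (rule arg_cong[where f=sqrt], rule Bochner_Integration.integral_cong) (auto simp: assms)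

lemma sqi_bound:
  assumes "f \<in> borel_measurable M" "integrable M g" "\<And>x. x \<in> space M \<Longrightarrow> (cmod (f x))\<^sup>2 \<le> g x"
  shows "sqi M f"
  unfolding sqi_def
proof
  show "integrable M (\<lambda>x. (cmod (f x))\<^sup>2)"
  proof (rule Bochner_Integration.integrable_bound[OF assms(2)])
    show "(\<lambda>x. (cmod (f x))\<^sup>2) \<in> borel_measurable M" using assms(1) by measurable
    show "AE x in M. norm ((cmod (f x))\<^sup>2) \<le> norm (g x)"
      using assms(3) by (intro AE_I2) (smt (verit) real_norm_def zero_le_power2)
  qed
qed (use assms in auto)

lemma sqi_0 [simp]: "sqi M (\<lambda>x. 0)"
  by (simp add: sqi_def)

lemma sqi_cmult:
  assumes "sqi M f" shows "sqi M (\<lambda>x. c * f x)"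
  using assms by (auto simp: sqi_def norm_mult power_mult_distrib)

lemma norm_add_sq_le: "(cmod (a + b))\<^sup>2 \<le> 2 * (cmod a)\<^sup>2 + 2 * (cmod b)\<^sup>2"
proof -
  have "(cmod (a + b))\<^sup>2 \<le> (cmod a + cmod b)\<^sup>2"
    by (intro power_mono norm_triangle_ineq) auto
  also have "\<dots> \<le> 2 * (cmod a)\<^sup>2 + 2 * (cmod b)\<^sup>2"
    using sum_squares_bound[of "cmod a" "cmod b"] by (simp add: power2_sum)
  finally show ?thesis .
qed

lemma sqi_add:
  assumes "sqi M f" "sqi M g" shows "sqi M (\<lambda>x. f x + g x)"
proof (rule sqi_bound)
  show "(\<lambda>x. f x + g x) \<in> borel_measurable M"
    using assms by (auto simp: sqi_def)
  show "integrable M (\<lambda>x. 2 * (cmod (f x))\<^sup>2 + 2 * (cmod (g x))\<^sup>2)"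
    using assms by (auto simp: sqi_def)
qed (rule norm_add_sq_le)

lemma sqi_diff:
  assumes "sqi M f" "sqi M g" shows "sqi M (\<lambda>x. f x - g x)"
  using sqi_add[OF assms(1) sqi_cmult[OF assms(2), of "-1"]] by simp

lemma sqi_cnj:
  assumes "sqi M f" shows "sqi M (\<lambda>x. cnj (f x))"
  using assms by (auto simp: sqi_def)

lemma sqi_abs_mult_integrable:
  assumes "sqi M f" "sqi M g" shows "integrable M (\<lambda>x. cmod (f x) * cmod (g x))"
proof (rule Bochner_Integration.integrable_bound)
  show "integrable M (\<lambda>x. (cmod (f x))\<^sup>2 + (cmod (g x))\<^sup>2)"
    using assms by (auto simp: sqi_def)
  show "(\<lambda>x. cmod (f x) * cmod (g x)) \<in> borel_measurable M"
    using assms by (auto simp: sqi_def)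
  have "cmod (f x) * cmod (g x) \<le> (cmod (f x))\<^sup>2 + (cmod (g x))\<^sup>2" for x
    using sum_squares_bound[of "cmod (f x)" "cmod (g x)"]
      mult_nonneg_nonneg[OF norm_ge_zero[of "f x"] norm_ge_zero[of "g x"]] by linarith
  then show "AE x in M. norm (cmod (f x) * cmod (g x)) \<le> norm ((cmod (f x))\<^sup>2 + (cmod (g x))\<^sup>2)"
    by (intro AE_I2) (auto simp: abs_mult)
qed

lemma sqi_mult_integrable:
  assumes "sqi M f" "sqi M g" shows "integrable M (\<lambda>x. f x * g x)"
proof (rule Bochner_Integration.integrable_bound[OF sqi_abs_mult_integrable[OF assms]])
  show "(\<lambda>x. f x * g x) \<in> borel_measurable M"
    using assms by (auto simp: sqi_def)
qed (auto simp: norm_mult)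

lemma ip_integrable:
  assumes "sqi M f" "sqi M g" shows "integrable M (\<lambda>x. f x * cnj (g x))"
  using sqi_mult_integrable[OF assms(1) sqi_cnj[OF assms(2)]] .

lemma nrm_eq_0_AE:
  assumes "sqi M f" "nrm M f = 0" shows "AE x in M. f x = 0"
proof -
  have "(\<integral>x. (cmod (f x))\<^sup>2 \<partial>M) = 0"
    using nrm_power2[of M f] assms(2) by simp
  then have "AE x in M. (cmod (f x))\<^sup>2 = 0"
    using integral_nonneg_eq_0_iff_AE[OF sqi_integrable[OF assms(1)]] by auto
  then show ?thesis by eventually_elim simp
qed

text \<open>The moduli stand inside the integral because the applications bound integrals of
  pointwise majorants rather than inner products. The inequality is the nonnegativity of the
  integral of \<open>(a |f| - b |g|)^2\<close> with \<open>a = nrm M g\<close> and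
  \<open>b = nrm M f\<close>.\<close>

lemma cauchy_schwarz_abs:
  assumes f: "sqi M f" and g: "sqi M g"
  shows "(\<integral>x. cmod (f x) * cmod (g x) \<partial>M) \<le> nrm M f * nrm M g"
proof -
  define a b where "a = nrm M g" and "b = nrm M f"
  have nn: "a \<ge> 0" "b \<ge> 0" by (auto simp: a_def b_def)
  show ?thesis
  proof (cases "a * b = 0")
    case True
    then have "nrm M g = 0 \<or> nrm M f = 0" by (auto simp: a_def b_def)
    then have "AE x in M. cmod (f x) * cmod (g x) = 0"
      using nrm_eq_0_AE[OF f] nrm_eq_0_AE[OF g] by auto
    then have "(\<integral>x. cmod (f x) * cmod (g x) \<partial>M) = 0"
      by (rule integral_eq_zero_AE)
    then show ?thesis by simp
  next
    case False
    then have pos: "a * b > 0" using nn by (metis less_eq_real_def mult_nonneg_nonneg)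
    have "0 \<le> (\<integral>x. (a * cmod (f x) - b * cmod (g x))\<^sup>2 \<partial>M)"
      by (rule integral_nonneg_AE) auto
    also have "\<dots> = (\<integral>x. a\<^sup>2 * (cmod (f x))\<^sup>2 + b\<^sup>2 * (cmod (g x))\<^sup>2 - (2 * a * b) * (cmod (f x) * cmod (g x)) \<partial>M)"
      by (rule Bochner_Integration.integral_cong) (auto simp: power2_eq_square algebra_simps)
    also have "\<dots> = a\<^sup>2 * b\<^sup>2 + b\<^sup>2 * a\<^sup>2 - (2 * a * b) * (\<integral>x. cmod (f x) * cmod (g x) \<partial>M)"
      unfolding a_def b_def nrm_power2 using sqi_integrable[OF f] sqi_integrable[OF g] sqi_abs_mult_integrable[OF f g]
      by (subst Bochner_Integration.integral_diff) auto
    finally have "(2 * (a * b)) * (\<integral>x. cmod (f x) * cmod (g x) \<partial>M) \<le> (2 * (a * b)) * (a * b)"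
      by (simp add: power2_eq_square algebra_simps)
    then have "(\<integral>x. cmod (f x) * cmod (g x) \<partial>M) \<le> a * b" using pos by (simp add: mult_le_cancel_left)
    then show ?thesis by (simp add: a_def b_def mult.commute)
  qed
qed

lemma cauchy_schwarz:
  assumes f: "sqi M f" and g: "sqi M g"
  shows "cmod (ip M f g) \<le> nrm M f * nrm M g"
proof -
  have "cmod (ip M f g) \<le> (\<integral>x. cmod (f x * cnj (g x)) \<partial>M)"
    unfolding ip_def by (rule integral_norm_bound)
  then show ?thesis using cauchy_schwarz_abs[OF f g] by (simp add: norm_mult)
qed

lemma ip_self: "ip M f f = of_real ((nrm M f)\<^sup>2)"
proof -
  have "ip M f f = (\<integral>x. complex_of_real ((cmod (f x))\<^sup>2) \<partial>M)"
    unfolding ip_def by (rule Bochner_Integration.integral_cong) (auto simp: complex_norm_square simp del: of_real_power)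
  then show ?thesis by (simp add: nrm_power2 del: of_real_power)
qed

lemma ip_cnj: "cnj (ip M f g) = ip M g f"
  unfolding ip_def Bochner_Integration.integral_cnj[symmetric] by (simp add: mult.commute)

lemma ip_diff_left:
  assumes "sqi M f" "sqi M g" "sqi M h"
  shows "ip M (\<lambda>x. f x - g x) h = ip M f h - ip M g h"
  unfolding ip_def by (simp add: left_diff_distrib ip_integrable assms)

lemma ip_diff_right:
  assumes "sqi M f" "sqi M g" "sqi M h"
  shows "ip M h (\<lambda>x. f x - g x) = ip M h f - ip M h g"
  unfolding ip_def by (simp add: right_diff_distrib ip_integrable assms)

lemma ip_cmult_right: "ip M f (\<lambda>x. c * g x) = cnj c * ip M f g"
  proof -
  have "ip M f (\<lambda>x. c * g x) = (\<integral>x. cnj c * (f x * cnj (g x)) \<partial>M)"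
    unfolding ip_def by (simp add: mult.left_commute)
  then show ?thesis unfolding ip_def by (simp only: integral_mult_right_zero)
qed

lemma nrm_cmult: "nrm M (\<lambda>x. c * f x) = cmod c * nrm M f"
  by (simp add: nrm_def norm_mult power_mult_distrib real_sqrt_mult)

lemma nrm_add_sq:
  assumes f: "sqi M f" and g: "sqi M g"
  shows "(nrm M (\<lambda>x. f x + g x))\<^sup>2 = (nrm M f)\<^sup>2 + 2 * Re (ip M f g) + (nrm M g)\<^sup>2"
proof -
  have "(nrm M (\<lambda>x. f x + g x))\<^sup>2 = (\<integral>x. (cmod (f x))\<^sup>2 + 2 * Re (f x * cnj (g x)) + (cmod (g x))\<^sup>2 \<partial>M)"
    unfolding nrm_power2
    by (rule Bochner_Integration.integral_cong) (auto simp: cmod_power2 power2_sum)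
  also have "\<dots> = (nrm M f)\<^sup>2 + 2 * Re (ip M f g) + (nrm M g)\<^sup>2"
    unfolding nrm_power2 ip_def integral_Re[OF ip_integrable[OF f g], symmetric]
    using integrable_Re[OF ip_integrable[OF f g]] sqi_integrable[OF f] sqi_integrable[OF g]
    by (simp del: times_complex.sel)
  finally show ?thesis .
qed

lemma nrm_triangle:
  assumes f: "sqi M f" and g: "sqi M g"
  shows "nrm M (\<lambda>x. f x + g x) \<le> nrm M f + nrm M g"
proof (rule power2_le_imp_le)
  have "Re (ip M f g) \<le> nrm M f * nrm M g"
    using cauchy_schwarz[OF f g] complex_Re_le_cmod[of "ip M f g"] by linarith
  then show "(nrm M (\<lambda>x. f x + g x))\<^sup>2 \<le> (nrm M f + nrm M g)\<^sup>2"
    unfolding nrm_add_sq[OF f g] by (simp add: power2_sum)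
qed simp

lemma nrm_triangle_diff:
  assumes "sqi M f" "sqi M g"
  shows "nrm M (\<lambda>x. f x - g x) \<le> nrm M f + nrm M g"
  using nrm_triangle[OF assms(1) sqi_cmult[OF assms(2), of "-1"]] nrm_cmult[of M "-1" g] by simp

text \<open>Serves to obtain square integrability of a limit from a uniform norm bound: once for the
  limit in the completeness proof, once when the cutoff of the symbol is removed.\<close>

lemma sqi_fatou:
  assumes meas: "\<And>n. sqi M (f n)" "g \<in> borel_measurable M"
    and conv: "AE x in M. (\<lambda>n. f n x) \<longlonglongrightarrow> g x"
    and bd: "\<forall>\<^sub>F n in sequentially. nrm M (f n) \<le> B"
  shows "sqi M g" "nrm M g \<le> B"
proof -
  have B: "B \<ge> 0"
    using eventually_happens[OF bd] nrm_nonneg order_trans by (metis trivial_limit_sequentially)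
  have "(\<integral>\<^sup>+x. ennreal ((cmod (g x))\<^sup>2) \<partial>M) \<le> (\<integral>\<^sup>+x. liminf (\<lambda>n. ennreal ((cmod (f n x))\<^sup>2)) \<partial>M)"
  proof (rule nn_integral_mono_AE)
    show "AE x in M. ennreal ((cmod (g x))\<^sup>2) \<le> liminf (\<lambda>n. ennreal ((cmod (f n x))\<^sup>2))"
      using conv
    proof eventually_elim
      case (elim x)
      then have "(\<lambda>n. ennreal ((cmod (f n x))\<^sup>2)) \<longlonglongrightarrow> ennreal ((cmod (g x))\<^sup>2)"
        by (intro tendsto_ennrealI tendsto_intros)
      from lim_imp_Liminf[OF _ this] show ?case by simp
    qed
  qed
  also have "\<dots> \<le> liminf (\<lambda>n. \<integral>\<^sup>+x. ennreal ((cmod (f n x))\<^sup>2) \<partial>M)"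
    using meas(1)[THEN sqi_measurable] by (intro nn_integral_liminf) auto
  also have "\<dots> \<le> liminf (\<lambda>n. ennreal (B\<^sup>2))"
  proof (rule Liminf_mono)
    show "\<forall>\<^sub>F n in sequentially. (\<integral>\<^sup>+x. ennreal ((cmod (f n x))\<^sup>2) \<partial>M) \<le> ennreal (B\<^sup>2)"
      using bd
    proof eventually_elim
      case (elim n)
      have "(\<integral>\<^sup>+x. ennreal ((cmod (f n x))\<^sup>2) \<partial>M) = ennreal ((nrm M (f n))\<^sup>2)"
        unfolding nrm_power2 using meas(1)[THEN sqi_integrable]
        by (intro nn_integral_eq_integral) auto
      also have "\<dots> \<le> ennreal (B\<^sup>2)"
        using elim by (intro ennreal_leI power_mono) auto
      finally show ?case .
    qed
  qed
  also have "\<dots> = ennreal (B\<^sup>2)" by (simp add: Liminf_const)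
  finally have le: "(\<integral>\<^sup>+x. ennreal ((cmod (g x))\<^sup>2) \<partial>M) \<le> ennreal (B\<^sup>2)" .
  have "integrable M (\<lambda>x. (cmod (g x))\<^sup>2)"
    using meas(2) le by (intro integrableI_bounded) (auto simp: order_le_less_trans[OF le])
  then show g: "sqi M g" using meas(2) by (simp add: sqi_def)
  have "ennreal ((nrm M g)\<^sup>2) \<le> ennreal (B\<^sup>2)"
    unfolding nrm_power2 using le nn_integral_eq_integral[OF sqi_integrable[OF g]] by simp
  then have "(nrm M g)\<^sup>2 \<le> B\<^sup>2" by (simp add: ennreal_le_iff)
  then show "nrm M g \<le> B" using B by (rule power2_le_imp_le)
qed

text \<open>The weights \<open>2 ^ n\<close> turn the \<open>L\<^sup>2\<close> bounds into almost everywhere summability of the increments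
  via \<open>2 t \<le> 1 / 2 ^ n + 2 ^ n * t\<^sup>2\<close>.\<close>

lemma L2_complete:
  fixes f :: "nat \<Rightarrow> 'a \<Rightarrow> complex"
  assumes f: "\<And>n. sqi M (f n)"
    and fast: "\<And>m n. m \<le> n \<Longrightarrow> nrm M (\<lambda>x. f n x - f m x) \<le> (1/2) ^ m"
  obtains g where "sqi M g" "(\<lambda>n. nrm M (\<lambda>x. g x - f n x)) \<longlonglongrightarrow> 0"
proof -
  note [measurable] = f[THEN sqi_measurable]
  define a where "a n x = cmod (f (Suc n) x - f n x)" for n x
  have am [measurable]: "a n \<in> borel_measurable M" for n unfolding a_def by measurable
  have int_a: "(\<integral>\<^sup>+x. ennreal (2 ^ n * (a n x)\<^sup>2) \<partial>M) \<le> ennreal ((1/2) ^ n)" for n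
  proof -
    have s: "sqi M (\<lambda>x. f (Suc n) x - f n x)" using f sqi_diff by blast
    have "(\<integral>\<^sup>+x. ennreal (2 ^ n * (a n x)\<^sup>2) \<partial>M) = ennreal (\<integral>x. 2 ^ n * (a n x)\<^sup>2 \<partial>M)"
      unfolding a_def using sqi_integrable[OF s] by (intro nn_integral_eq_integral) auto
    also have "(\<integral>x. 2 ^ n * (a n x)\<^sup>2 \<partial>M) = 2 ^ n * (nrm M (\<lambda>x. f (Suc n) x - f n x))\<^sup>2"
      unfolding nrm_power2 a_def by simp
    also have "\<dots> \<le> 2 ^ n * ((1/2) ^ n)\<^sup>2"
      by (intro mult_left_mono power_mono fast) auto
    also have "\<dots> = (1/2) ^ n" by (simp add: power2_eq_square power_divide)
    finally show ?thesis by (simp add: ennreal_leI)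
  qed
  have "(\<integral>\<^sup>+x. (\<Sum>n. ennreal (2 ^ n * (a n x)\<^sup>2)) \<partial>M) = (\<Sum>n. \<integral>\<^sup>+x. ennreal (2 ^ n * (a n x)\<^sup>2) \<partial>M)"
    by (rule nn_integral_suminf) auto
  also have "\<dots> \<le> (\<Sum>n. ennreal ((1/2) ^ n))"
    by (intro suminf_le int_a) auto
  also have "\<dots> = ennreal (\<Sum>n. (1/2) ^ n)"
    by (rule suminf_ennreal_eq) (auto intro!: summable_sums summable_geometric)
  finally have "(\<integral>\<^sup>+x. (\<Sum>n. ennreal (2 ^ n * (a n x)\<^sup>2)) \<partial>M) < \<infinity>"
    by (rule order_le_less_trans) simp
  then have "AE x in M. (\<Sum>n. ennreal (2 ^ n * (a n x)\<^sup>2)) \<noteq> \<infinity>"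
    by (intro nn_integral_PInf_AE) auto
  then have conv: "AE x in M. convergent (\<lambda>n. f n x)"
  proof eventually_elim
    case (elim x)
    then have s1: "summable (\<lambda>n. 2 ^ n * (a n x)\<^sup>2)"
      by (intro summable_suminf_not_top) auto
    have s2: "summable (\<lambda>n. ((1/2) ^ n + 2 ^ n * (a n x)\<^sup>2) :: real)"
      using s1 by (intro summable_add summable_geometric) auto
    have "summable (\<lambda>n. f (Suc n) x - f n x)"
    proof (rule summable_comparison_test'[OF s2])
      fix n
      have "0 \<le> (1 - 2 ^ n * a n x)\<^sup>2 / 2 ^ n" by simp
      also have "\<dots> = (1/2) ^ n + 2 ^ n * (a n x)\<^sup>2 - 2 * a n x"
        by (simp add: power2_eq_square field_simps)
      finally show "norm (f (Suc n) x - f n x) \<le> (1/2) ^ n + 2 ^ n * (a n x)\<^sup>2"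
        using norm_ge_zero[of "f (Suc n) x - f n x"] unfolding a_def by linarith
    qed
    then have "convergent (\<lambda>n. \<Sum>k<n. f (Suc k) x - f k x)"
      by (simp add: summable_iff_convergent)
    then have "convergent (\<lambda>n. f n x - f 0 x)" using sum_lessThan_telescope[of "\<lambda>k. f k x"] by simp
    then have "convergent (\<lambda>n. (f n x - f 0 x) + f 0 x)"
      by (intro convergent_add convergent_const)
    then show ?case by simp
  qed
  define g where "g x = lim (\<lambda>n. f n x)" for x
  have gm: "g \<in> borel_measurable M" unfolding g_def by measurable
  have lim: "AE x in M. (\<lambda>n. f n x) \<longlonglongrightarrow> g x"
    using conv by eventually_elim (simp add: g_def convergent_LIMSEQ_iff)
  have est: "sqi M (\<lambda>x. g x - f m x) \<and> nrm M (\<lambda>x. g x - f m x) \<le> (1/2) ^ m" for m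
  proof -
    have c: "AE x in M. (\<lambda>n. f n x - f m x) \<longlonglongrightarrow> g x - f m x"
      using lim by eventually_elim (intro tendsto_intros)
    have b: "\<forall>\<^sub>F n in sequentially. nrm M (\<lambda>x. f n x - f m x) \<le> (1/2) ^ m"
      using fast by (auto simp: eventually_sequentially)
    have m: "(\<lambda>x. g x - f m x) \<in> borel_measurable M" using gm by measurable
    show ?thesis using sqi_fatou[OF sqi_diff[OF f f] m c b] by blast
  qed
  have "sqi M (\<lambda>x. (g x - f 0 x) + f 0 x)"
    using est f by (intro sqi_add) auto
  then have "sqi M g" by simp
  moreover have "(\<lambda>n. nrm M (\<lambda>x. g x - f n x)) \<longlonglongrightarrow> 0"
  proof (rule tendsto_sandwich[where f="\<lambda>_. 0" and h="\<lambda>n. (1/2) ^ n"])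
    show "(\<lambda>n. (1/2) ^ n) \<longlonglongrightarrow> (0::real)" by (rule LIMSEQ_realpow_zero) auto
  qed (use est in \<open>auto intro!: always_eventually\<close>)
  ultimately show ?thesis using that by blast
qed

text \<open>The midpoint form is the one suited to minimising sequences: midpoints of admissible
  elements are admissible, so the last norm is bounded below by the distance.\<close>

lemma parallelogram_mid:
  assumes "sqi M f" "sqi M g"
  shows "(nrm M (\<lambda>x. f x - g x))\<^sup>2 = 2 * (nrm M f)\<^sup>2 + 2 * (nrm M g)\<^sup>2 - 4 * (nrm M (\<lambda>x. 1/2 * (f x + g x)))\<^sup>2"
proof -
  have h: "nrm M (\<lambda>x. f x + g x) = 2 * nrm M (\<lambda>x. 1/2 * (f x + g x))"
    by (subst nrm_cmult) simp
  show ?thesis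
    using nrm_add_sq[OF assms] nrm_add_sq[OF assms(1) sqi_cmult[OF assms(2), of "-1"]]
      nrm_cmult[of M "-1" g]
    unfolding h by (simp add: ip_def power_mult_distrib)
qed

text \<open>\<open>S\<close> need not be closed, so a nearest point may not lie in it. The result is
  therefore the orthogonal remainder \<open>v\<close> of \<open>u\<close>, together with elements of
  \<open>S\<close> that converge to \<open>u - v\<close>. Orthogonality is the vanishing first
  variation of the squared distance.\<close>

lemma L2_projection:
  assumes u: "sqi M u" and S: "\<And>s. s \<in> S \<Longrightarrow> sqi M s" and "S \<noteq> {}"
    and add: "\<And>s t. s \<in> S \<Longrightarrow> t \<in> S \<Longrightarrow> (\<lambda>x. s x + t x) \<in> S"
    and scale: "\<And>s c. s \<in> S \<Longrightarrow> (\<lambda>x. c * s x) \<in> S"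
  obtains v s where "sqi M v" "\<And>n. s n \<in> S" "(\<lambda>n::nat. nrm M (\<lambda>x. (u x - v x) - s n x)) \<longlonglongrightarrow> 0"
    "\<And>t. t \<in> S \<Longrightarrow> ip M v t = 0"
proof -
  define d where "d = (INF s\<in>S. (nrm M (\<lambda>x. u x - s x))\<^sup>2)"
  have bdd: "bdd_below ((\<lambda>s. (nrm M (\<lambda>x. u x - s x))\<^sup>2) ` S)" by (rule bdd_belowI2[where m=0]) auto
  have d_le: "d \<le> (nrm M (\<lambda>x. u x - s x))\<^sup>2" if "s \<in> S" for s
    unfolding d_def using bdd that by (rule cINF_lower)
  \<comment> \<open>An excess of \<open>(1/4) ^ (Suc n)\<close> over the infimum becomes, through
    the parallelogram law, an increment of norm at most \<open>(1/2) ^ m\<close>, which is the rate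
    that \<open>L2_complete\<close> asks for.\<close>
  have "\<exists>s\<in>S. (nrm M (\<lambda>x. u x - s x))\<^sup>2 < d + (1/4) ^ (Suc n)" for n
    unfolding d_def using \<open>S \<noteq> {}\<close> by (subst cINF_less_iff[symmetric]) (auto simp: bdd)
  then obtain s where sS: "\<And>n. s n \<in> S" and s: "\<And>n. (nrm M (\<lambda>x. u x - s n x))\<^sup>2 < d + (1/4) ^ (Suc n)"
    by metis
  have us: "sqi M (\<lambda>x. u x - s n x)" for n using u S[OF sS] by (rule sqi_diff)
  have mid: "d \<le> (nrm M (\<lambda>x. 1/2 * ((u x - s n x) + (u x - s m x))))\<^sup>2" for n m
  proof -
    have "(\<lambda>x. 1/2 * (s n x + s m x)) \<in> S" by (intro scale add sS)
    from d_le[OF this] show ?thesis by (simp add: algebra_simps)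
  qed
  have "nrm M (\<lambda>x. s n x - s m x) \<le> (1/2) ^ m" if "m \<le> n" for m n
  proof (rule power2_le_imp_le)
    have "(nrm M (\<lambda>x. s n x - s m x))\<^sup>2 = (nrm M (\<lambda>x. (u x - s n x) - (u x - s m x)))\<^sup>2"
      by (rule arg_cong[where f="\<lambda>y. y\<^sup>2"], rule nrm_cong_cmod) (simp add: norm_minus_commute)
    also have "\<dots> \<le> 2 * (1/4) ^ (Suc n) + 2 * (1/4) ^ (Suc m)"
      unfolding parallelogram_mid[OF us us] using s[of n] s[of m] mid[of n m] by linarith
    also have "\<dots> \<le> 2 * (1/4) ^ (Suc m) + 2 * (1/4) ^ (Suc m)"
      using that by (intro add_mono mult_left_mono power_decreasing) auto
    also have "\<dots> = ((1/2) ^ m)\<^sup>2" by (simp add: power2_eq_square flip: power_mult_distrib)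
    finally show "(nrm M (\<lambda>x. s n x - s m x))\<^sup>2 \<le> ((1/2) ^ m)\<^sup>2" .
  qed simp
  from L2_complete[of M s, OF S[OF sS] this] obtain U where U: "sqi M U"
    and lim: "(\<lambda>n. nrm M (\<lambda>x. U x - s n x)) \<longlonglongrightarrow> 0" by blast
  define v where "v x = u x - U x" for x
  have v: "sqi M v" unfolding v_def using u U by (rule sqi_diff)
  have v_le: "(nrm M v)\<^sup>2 \<le> d"
  proof (rule LIMSEQ_le_const)
    show "(\<lambda>n. (sqrt (d + (1/4) ^ (Suc n)) + nrm M (\<lambda>x. U x - s n x))\<^sup>2) \<longlonglongrightarrow> d"
    proof -
      have "d \<ge> 0" unfolding d_def by (rule cINF_greatest) (use \<open>S \<noteq> {}\<close> in auto)
      moreover have "(\<lambda>n. (sqrt (d + (1/4) ^ (Suc n)) + nrm M (\<lambda>x. U x - s n x))\<^sup>2) \<longlonglongrightarrow> (sqrt (d + 0) + 0)\<^sup>2"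
        by (intro tendsto_intros lim LIMSEQ_Suc[OF LIMSEQ_realpow_zero]) auto
      ultimately show ?thesis by simp
    qed
    show "\<exists>N. \<forall>n\<ge>N. (nrm M v)\<^sup>2 \<le> (sqrt (d + (1/4) ^ (Suc n)) + nrm M (\<lambda>x. U x - s n x))\<^sup>2"
    proof (intro exI allI impI power_mono)
      fix n
      have "nrm M v = nrm M (\<lambda>x. (u x - s n x) - (U x - s n x))"
        by (rule nrm_cong_cmod) (simp add: v_def algebra_simps)
      also have "\<dots> \<le> nrm M (\<lambda>x. u x - s n x) + nrm M (\<lambda>x. U x - s n x)"
        using U S[OF sS] by (intro nrm_triangle_diff us sqi_diff)
      also have "nrm M (\<lambda>x. u x - s n x) \<le> sqrt (d + (1/4) ^ (Suc n))"
        using s[of n] by (simp add: real_le_rsqrt)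
      finally show "nrm M v \<le> sqrt (d + (1/4) ^ (Suc n)) + nrm M (\<lambda>x. U x - s n x)" by simp
    qed simp
  qed
  have orth: "ip M v t = 0" if t: "t \<in> S" for t
  proof -
    have low: "d \<le> (nrm M (\<lambda>x. v x + c * t x))\<^sup>2" for c
    proof (rule LIMSEQ_le_const)
      show "(\<lambda>n. (nrm M (\<lambda>x. v x + c * t x) + nrm M (\<lambda>x. U x - s n x))\<^sup>2) \<longlonglongrightarrow> (nrm M (\<lambda>x. v x + c * t x))\<^sup>2"
        using tendsto_power[OF tendsto_add[OF tendsto_const lim]] by fastforce
      show "\<exists>N. \<forall>n\<ge>N. d \<le> (nrm M (\<lambda>x. v x + c * t x) + nrm M (\<lambda>x. U x - s n x))\<^sup>2"
      proof (intro exI allI impI)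
        fix n
        have "(\<lambda>x. s n x + (-c) * t x) \<in> S" by (intro add scale sS t)
        then have "d \<le> (nrm M (\<lambda>x. u x - (s n x + (-c) * t x)))\<^sup>2" by (rule d_le)
        moreover have "nrm M (\<lambda>x. u x - (s n x + (-c) * t x)) = nrm M (\<lambda>x. (v x + c * t x) + (U x - s n x))"
          by (rule nrm_cong_cmod) (simp add: v_def algebra_simps)
        moreover have "\<dots> \<le> nrm M (\<lambda>x. v x + c * t x) + nrm M (\<lambda>x. U x - s n x)"
          by (intro nrm_triangle sqi_add sqi_diff sqi_cmult v U S sS t)
        ultimately have "d \<le> (nrm M (\<lambda>x. u x - (s n x + (-c) * t x)))\<^sup>2"
          "nrm M (\<lambda>x. u x - (s n x + (-c) * t x)) \<le> nrm M (\<lambda>x. v x + c * t x) + nrm M (\<lambda>x. U x - s n x)"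
          by simp_all
        then show "d \<le> (nrm M (\<lambda>x. v x + c * t x) + nrm M (\<lambda>x. U x - s n x))\<^sup>2"
          using power_mono[OF _ nrm_nonneg] order.trans by blast
      qed
    qed
    define I where "I = ip M v t"
    \<comment> \<open>The perturbation has coefficient \<open>e * I\<close> with \<open>e\<close>
      real. This phase turns the mixed term into \<open>2 * e * |I|^2\<close>, so that a small
      negative \<open>e\<close> would push the norm below the minimum unless
      \<open>I = 0\<close>.\<close>
    have quad: "0 \<le> 2 * e * (cmod I)\<^sup>2 + e\<^sup>2 * ((cmod I)\<^sup>2 * (nrm M t)\<^sup>2)" for e :: real
    proof -
      let ?c = "of_real e * I"
      have "ip M v (\<lambda>x. ?c * t x) = cnj ?c * I"
        unfolding I_def by (rule ip_cmult_right)
      also have "\<dots> = of_real (e * (cmod I)\<^sup>2)"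
        using complex_norm_square[of I] by (simp add: mult.commute mult.left_commute)
      finally have "Re (ip M v (\<lambda>x. ?c * t x)) = e * (cmod I)\<^sup>2" by simp
      then show ?thesis
        using low[of ?c] v_le nrm_add_sq[OF v sqi_cmult[OF S[OF t], of ?c]] nrm_cmult[of M ?c t]
        by (simp add: norm_mult power_mult_distrib)
    qed
    have "I = 0"
    proof (rule ccontr)
      assume "I \<noteq> 0"
      then have p: "(cmod I)\<^sup>2 > 0" by simp
      \<comment> \<open>The summand 1 keeps the denominator positive even when
        \<open>nrm M t = 0\<close>.\<close>
      let ?e = "- 1 / (1 + (nrm M t)\<^sup>2)"
      have pp: "1 + (nrm M t)\<^sup>2 > 0" by (smt (verit) zero_le_power2)
      have "0 \<le> (cmod I)\<^sup>2 * (2 * ?e + ?e\<^sup>2 * (nrm M t)\<^sup>2)"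
        using quad[of ?e] by (simp add: algebra_simps)
      then have "0 \<le> 2 * ?e + ?e\<^sup>2 * (nrm M t)\<^sup>2" using p by (simp add: zero_le_mult_iff)
      also have "\<dots> \<le> 2 * ?e + ?e\<^sup>2 * (1 + (nrm M t)\<^sup>2)" by (intro add_left_mono mult_left_mono) auto
      also have "\<dots> = ?e" using pp by (simp add: power2_eq_square divide_simps)
      also have "\<dots> < 0" using pp by simp
      finally show False by simp
    qed
    then show ?thesis by (simp add: I_def)
  qed
  have "(\<lambda>n. nrm M (\<lambda>x. (u x - v x) - s n x)) \<longlonglongrightarrow> 0"
    using lim by (simp add: v_def)
  then show ?thesis using that v sS orth by blast
qed

section \<open>Directional derivatives and test functions\<close>

text \<open>Only a derivative along one line through each point is required, which is what
  \<open>pd\<close> and \<open>C1_on\<close> provide; no total derivative is involved. The general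
  codomain lets the same rules serve real weights and complex functions.\<close>

definition has_pd :: "complex \<Rightarrow> (complex \<Rightarrow> 'a::real_normed_vector) \<Rightarrow> (complex \<Rightarrow> 'a) \<Rightarrow> complex set \<Rightarrow> bool" where
  "has_pd v f f' S \<longleftrightarrow> (\<forall>z\<in>S. ((\<lambda>t::real. f (z + of_real t * v)) has_vector_derivative f' z) (at 0))"

lemma has_pdD:
  "has_pd v f f' S \<Longrightarrow> z \<in> S \<Longrightarrow> ((\<lambda>t::real. f (z + of_real t * v)) has_vector_derivative f' z) (at 0)"
  by (simp add: has_pd_def)

lemma has_pd_subset: "has_pd v f f' S \<Longrightarrow> T \<subseteq> S \<Longrightarrow> has_pd v f f' T"
  by (auto simp: has_pd_def)

lemma has_pd_cong:
  "has_pd v f f' S \<Longrightarrow> (\<And>z. z \<in> S \<Longrightarrow> f' z = g' z) \<Longrightarrow> has_pd v f g' S"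
  by (auto simp: has_pd_def)

lemma has_pd_const: "has_pd v (\<lambda>z. c) (\<lambda>z. 0) S"
  by (auto simp: has_pd_def)

lemma has_pd_add:
  "has_pd v f f' S \<Longrightarrow> has_pd v g g' S \<Longrightarrow> has_pd v (\<lambda>z. f z + g z) (\<lambda>z. f' z + g' z) S"
  unfolding has_pd_def by (intro ballI has_vector_derivative_add) auto

lemma has_pd_diff:
  "has_pd v f f' S \<Longrightarrow> has_pd v g g' S \<Longrightarrow> has_pd v (\<lambda>z. f z - g z) (\<lambda>z. f' z - g' z) S"
  unfolding has_pd_def by (intro ballI has_vector_derivative_diff) auto

lemma has_pd_mult:
  fixes f g :: "complex \<Rightarrow> 'a::real_normed_algebra"
  assumes "has_pd v f f' S" "has_pd v g g' S"
  shows "has_pd v (\<lambda>z. f z * g z) (\<lambda>z. f z * g' z + f' z * g z) S"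
  unfolding has_pd_def
proof
  fix z assume "z \<in> S"
  from has_vector_derivative_mult[OF has_pdD[OF assms(1) this] has_pdD[OF assms(2) this]]
  show "((\<lambda>t. f (z + of_real t * v) * g (z + of_real t * v)) has_vector_derivative f z * g' z + f' z * g z) (at 0)"
    by simp
qed

lemma has_pd_cmult:
  fixes f :: "complex \<Rightarrow> 'a::real_normed_algebra"
  shows "has_pd v f f' S \<Longrightarrow> has_pd v (\<lambda>z. c * f z) (\<lambda>z. c * f' z) S"
  using has_pd_mult[OF has_pd_const[of v c S]] by (auto simp: has_pd_def)

lemma has_pd_bounded_linear:
  assumes "bounded_linear L" "has_pd v f f' S"
  shows "has_pd v (\<lambda>z. L (f z)) (\<lambda>z. L (f' z)) S"
  unfolding has_pd_def
  using bounded_linear.has_vector_derivative[OF assms(1) has_pdD[OF assms(2)]] by blast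

lemmas has_pd_Re = has_pd_bounded_linear[OF bounded_linear_Re]
  and has_pd_Im = has_pd_bounded_linear[OF bounded_linear_Im]
  and has_pd_cnj = has_pd_bounded_linear[OF bounded_linear_cnj]
  and has_pd_of_real = has_pd_bounded_linear[OF bounded_linear_of_real]

lemma has_pd_real_chain:
  fixes f :: "complex \<Rightarrow> real"
  assumes "has_pd v f f' S" "\<And>x. x \<in> f ` S \<Longrightarrow> (m has_real_derivative m' x) (at x)"
  shows "has_pd v (\<lambda>z. m (f z)) (\<lambda>z. m' (f z) * f' z) S"
  unfolding has_pd_def
proof
  fix z assume z: "z \<in> S"
  from has_pdD[OF assms(1) z]
  have d: "((\<lambda>t. f (z + of_real t * v)) has_real_derivative f' z) (at 0)"
    by (simp add: has_real_derivative_iff_has_vector_derivative)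
  have "(m has_real_derivative m' (f (z + of_real 0 * v))) (at (f (z + of_real 0 * v)))"
    using assms(2) z by auto
  from DERIV_chain2[OF this d]
  show "((\<lambda>t. m (f (z + of_real t * v))) has_vector_derivative m' (f z) * f' z) (at 0)"
    by (simp add: has_real_derivative_iff_has_vector_derivative)
qed

lemma has_pd_holomorphic:
  assumes "f holomorphic_on S" "open S"
  shows "has_pd v f (\<lambda>z. deriv f z * v) S"
  unfolding has_pd_def
proof
  fix z assume z: "z \<in> S"
  have "(f has_field_derivative deriv f (z + of_real 0 * v)) (at (z + of_real 0 * v))"
    using holomorphic_derivI[OF assms z] by simp
  note 1 = this
  have "((\<lambda>t::real. z + of_real t * v) has_vector_derivative v) (at 0)"
    by (auto intro!: derivative_eq_intros simp: has_vector_derivative_def scaleR_conv_of_real)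
  from field_vector_diff_chain_at[OF this 1]
  show "((\<lambda>t. f (z + of_real t * v)) has_vector_derivative deriv f z * v) (at 0)"
    by (simp add: o_def mult.commute)
qed

lemma has_pd_line:
  assumes "has_pd v f f' S" "z + of_real t0 * v \<in> S"
  shows "((\<lambda>t. f (z + of_real t * v)) has_vector_derivative f' (z + of_real t0 * v)) (at t0)"
proof -
  have "((\<lambda>t. f ((z + of_real t0 * v) + of_real t * v)) has_vector_derivative f' (z + of_real t0 * v)) (at (t0 - t0))"
    using has_pdD[OF assms] by simp
  moreover have "((\<lambda>t. t - t0) has_real_derivative 1) (at t0)"
    by (auto intro!: derivative_eq_intros)
  ultimately have "((\<lambda>t. f ((z + of_real t0 * v) + of_real t * v)) \<circ> (\<lambda>t. t - t0) has_vector_derivative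
      1 *\<^sub>R f' (z + of_real t0 * v)) (at t0)"
    by (intro vector_diff_chain_at) (auto simp: has_real_derivative_iff_has_vector_derivative)
  then show ?thesis by (simp add: o_def algebra_simps)
qed

lemma has_pd_unique:
  assumes "has_pd v f f' S" "has_pd v f g' S" "z \<in> S" shows "f' z = g' z"
  using vector_derivative_unique_at has_pdD assms by blast

lemma has_pd_transform:
  assumes "has_pd v f f' S" "open S" "\<And>z. z \<in> S \<Longrightarrow> f z = g z"
  shows "has_pd v g f' S"
  unfolding has_pd_def
proof
  fix z assume z: "z \<in> S"
  have "open ((\<lambda>t::real. z + of_real t * v) -` S)"
    using assms(2) by (intro open_vimage) (auto intro!: continuous_intros)
  then show "((\<lambda>t. g (z + of_real t * v)) has_vector_derivative f' z) (at 0)"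
    using z assms(3) has_pdD[OF assms(1) z]
    by (intro has_vector_derivative_transform_within_open[OF has_pdD[OF assms(1) z], of "(\<lambda>t::real. z + of_real t * v) -` S"]) auto
qed

section \<open>Integrating directional derivatives over the disc\<close>

lemma open_disc [simp]: "open disc" by (simp add: disc_def)

lemma disc_iff: "z \<in> disc \<longleftrightarrow> cmod z < 1" by (simp add: disc_def)

text \<open>Functions are controlled on the disc alone and may be arbitrary outside, so all
  integrals carry the indicator of \<open>disc\<close>. The support condition trades it for the
  indicator of a compact disc, where continuity gives integrability.\<close>

lemma integrable_disc_compact_support:
  fixes f :: "complex \<Rightarrow> 'a::{banach, second_countable_topology}"
  assumes "continuous_on disc f" "r < 1" "\<And>z. z \<in> disc \<Longrightarrow> r < cmod z \<Longrightarrow> f z = 0"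
  shows "integrable lborel (\<lambda>z. indicator disc z *\<^sub>R f z)"
proof -
  have "integrable lborel (\<lambda>z. indicator (cball 0 r) z *\<^sub>R f z)"
    using assms(2) by (intro borel_integrable_compact continuous_on_subset[OF assms(1)]) (auto simp: disc_def)
  moreover have "indicator (cball 0 r) z *\<^sub>R f z = indicator disc z *\<^sub>R f z" for z
    using assms(2) assms(3)[of z] by (cases "cmod z \<le> r"; cases "z \<in> disc") (auto simp: disc_iff)
  ultimately show ?thesis by simp
qed

lemma integral_lborel_translate:
  fixes f :: "complex \<Rightarrow> 'a::{banach, second_countable_topology}"
  assumes "f \<in> borel_measurable borel"
  shows "(\<integral>z. f (a + z) \<partial>lborel) = (\<integral>z. f z \<partial>lborel)"
  using integral_distr[of "(+) a" lborel borel f] assms lborel_distr_plus[of a]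
  by simp

lemma integrable_lborel_translate:
  fixes f :: "complex \<Rightarrow> 'a::{banach, second_countable_topology}"
  assumes "integrable lborel f"
  shows "integrable lborel (\<lambda>z. f (a + z))"
  using integrable_distr[of "(+) a" lborel borel f] assms lborel_distr_plus[of a]
  by simp

text \<open>By translation invariance the difference quotients of \<open>V\<close> have integral zero.\<close>

lemma integral_pd_eq_0:
  fixes V :: "complex \<Rightarrow> 'a::{banach, second_countable_topology}"
  assumes V: "has_pd v V V' disc" "continuous_on disc V" "continuous_on disc V'" and v: "cmod v \<le> 1"
    and r: "r < 1" "\<And>z. z \<in> disc \<Longrightarrow> r < cmod z \<Longrightarrow> V z = 0"
  shows "integrable lborel (\<lambda>z. indicator disc z *\<^sub>R V' z)" "(\<integral>z. indicator disc z *\<^sub>R V' z \<partial>lborel) = 0"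
proof -
  have V'0: "V' z = 0" if "z \<in> disc" "r < cmod z" for z
  proof -
    let ?U = "disc \<inter> {z. r < cmod z}"
    have "open ?U" by (intro open_Int open_disc open_Collect_less continuous_intros)
    then have "has_pd v V (\<lambda>z. 0) ?U"
      by (rule has_pd_transform[OF has_pd_const]) (use r(2) in auto)
    from has_pd_unique[OF this has_pd_subset[OF V(1)]] that show ?thesis by auto
  qed
  define h where "h z = indicator disc z *\<^sub>R V z" for z
  define h' where "h' z = indicator disc z *\<^sub>R V' z" for z
  have int_h: "integrable lborel h" unfolding h_def
    using integrable_disc_compact_support[OF V(2) r] .
  have int_h': "integrable lborel h'" unfolding h'_def
    using integrable_disc_compact_support[OF V(3) r(1) V'0] .
  \<comment> \<open>The extension by zero is differentiable along \<open>v\<close> everywhere: the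
    disc and the exterior of radius \<open>r\<close> are open and cover the plane, and on each of
    them \<open>h\<close> has the derivative \<open>h'\<close>.\<close>
  have pd_h: "has_pd v h h' UNIV"
  proof -
    have "has_pd v h h' disc"
      by (rule has_pd_cong[OF has_pd_transform[OF V(1) open_disc]]) (auto simp: h_def h'_def)
    moreover have "has_pd v h h' {z. r < cmod z}"
    proof (rule has_pd_cong[OF has_pd_transform[OF has_pd_const[of _ 0]]])
      show "open {z::complex. r < cmod z}" by (intro open_Collect_less continuous_intros)
    qed (use r(2) V'0 in \<open>auto simp: h_def h'_def indicator_def\<close>)
    moreover have "disc \<union> {z. r < cmod z} = UNIV" using r(1) by (auto simp: disc_iff)
    ultimately show ?thesis unfolding has_pd_def by blast
  qed
  obtain B where B: "\<And>z. norm (h' z) \<le> B" "B \<ge> 0"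
  proof -
    have "compact (V' ` cball 0 r)"
      using r(1) by (intro compact_continuous_image continuous_on_subset[OF V(3)]) (auto simp: disc_def)
    then obtain B where "\<And>z. z \<in> cball 0 r \<Longrightarrow> norm (V' z) \<le> B"
      by (meson compact_imp_bounded bounded_iff image_eqI)
    then have "norm (h' z) \<le> max B 0" for z
      using V'0[of z] by (cases "z \<in> disc"; cases "r < cmod z") (auto simp: h'_def intro: max.coboundedI1)
    then show ?thesis using that[of "max B 0"] by auto
  qed
  have lip: "norm (h (z + of_real t * v) - h z) \<le> B * \<bar>t\<bar>" for z t
  proof -
    have "norm (h (z + of_real t * v) - h (z + of_real 0 * v)) \<le> B * norm (t - 0)"
    proof (rule differentiable_bound[of UNIV "\<lambda>t. h (z + of_real t * v)" "\<lambda>t s. s *\<^sub>R h' (z + of_real t * v)"])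
      fix x :: real
      show "((\<lambda>t. h (z + of_real t * v)) has_derivative (\<lambda>s. s *\<^sub>R h' (z + of_real x * v))) (at x)"
        using has_pd_line[OF pd_h, of z x] by (simp add: has_vector_derivative_def)
      show "onorm (\<lambda>s. s *\<^sub>R h' (z + of_real x * v)) \<le> B"
        by (rule onorm_le) (simp, metis B(1) abs_ge_zero mult.commute mult_left_mono)
    qed auto
    then show ?thesis by simp
  qed
  define F where "F n z = real (Suc n) *\<^sub>R (h (of_real (inverse (Suc n)) * v + z) - h z)" for n z
  have F_int: "integrable lborel (F n)" and F0: "integral\<^sup>L lborel (F n) = 0" for n
  proof -
    have i: "integrable lborel (\<lambda>z. h (of_real (inverse (Suc n)) * v + z))"
      using int_h by (rule integrable_lborel_translate)
    show "integrable lborel (F n)" unfolding F_def using i int_h by simp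
    have "(\<integral>z. h (of_real (inverse (Suc n)) * v + z) \<partial>lborel) = integral\<^sup>L lborel h"
      using int_h by (intro integral_lborel_translate) auto
    then show "integral\<^sup>L lborel (F n) = 0" unfolding F_def using i int_h by simp
  qed
  \<comment> \<open>The difference quotients are bounded by the Lipschitz constant \<open>B\<close>.
    They vanish off \<open>cball 0 2\<close>, since \<open>h\<close> lives on the unit disc and the
    shifts have length at most 1.\<close>
  have "(\<lambda>n. integral\<^sup>L lborel (F n)) \<longlonglongrightarrow> integral\<^sup>L lborel h'"
  proof (rule integral_dominated_convergence[where w="\<lambda>z. indicator (cball 0 2) z * B"])
    show "integrable lborel (\<lambda>z::complex. indicator (cball 0 2) z * B)"
      using borel_integrable_compact[of "cball 0 2 :: complex set" "\<lambda>_. B"] by simp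
    show "AE z in lborel. (\<lambda>n. F n z) \<longlonglongrightarrow> h' z"
    proof (rule AE_I2)
      fix z
      let ?f = "\<lambda>t::real. h (z + of_real t * v)"
      have "((\<lambda>t. norm (?f t - ?f 0 - (t - 0) *\<^sub>R h' z) / norm (t - 0)) \<longlongrightarrow> 0) (at 0)"
        using has_pdD[OF pd_h UNIV_I, of z] by (simp add: has_vector_derivative_def has_derivative_iff_norm)
      then have "((\<lambda>t. norm ((?f t - h z) /\<^sub>R t - h' z)) \<longlongrightarrow> 0) (at 0)"
      proof (rule Lim_transform_eventually)
        show "\<forall>\<^sub>F t in at 0. norm (?f t - ?f 0 - (t - 0) *\<^sub>R h' z) / norm (t - 0) = norm ((?f t - h z) /\<^sub>R t - h' z)"
          unfolding eventually_at_topological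
        proof (intro exI[of _ UNIV] conjI ballI impI)
          fix t :: real assume "t \<noteq> 0"
          then have "(?f t - h z) /\<^sub>R t - h' z = (?f t - h z - t *\<^sub>R h' z) /\<^sub>R t"
            by (simp add: scaleR_diff_right)
          then show "norm (?f t - ?f 0 - (t - 0) *\<^sub>R h' z) / norm (t - 0) = norm ((?f t - h z) /\<^sub>R t - h' z)"
            by (simp add: divide_inverse mult.commute)
        qed auto
      qed
      then have "((\<lambda>t. (?f t - h z) /\<^sub>R t) \<longlongrightarrow> h' z) (at 0)"
        by (rule LIM_zero_cancel[OF tendsto_norm_zero_cancel])
      moreover have "filterlim (\<lambda>n. inverse (real (Suc n))) (at 0) sequentially"
        using LIMSEQ_inverse_real_of_nat by (intro filterlim_atI) auto
      ultimately have "(\<lambda>n. (?f (inverse (Suc n)) - h z) /\<^sub>R inverse (real (Suc n))) \<longlonglongrightarrow> h' z"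
        by (rule filterlim_compose)
      then show "(\<lambda>n. F n z) \<longlonglongrightarrow> h' z" by (simp add: F_def add.commute)
    qed
    show "AE z in lborel. norm (F n z) \<le> indicator (cball 0 2) z * B" for n
    proof (rule AE_I2)
      fix z
      show "norm (F n z) \<le> indicator (cball 0 2) z * B"
      proof (cases "z \<in> cball 0 2")
        case True
        have "norm (F n z) = real (Suc n) * norm (h (z + of_real (inverse (Suc n)) * v) - h z)"
          by (simp add: F_def add.commute)
        also have "\<dots> \<le> real (Suc n) * (B * \<bar>inverse (Suc n)\<bar>)"
          by (intro mult_left_mono lip) auto
        also have "\<dots> = B" by (simp add: field_simps)
        finally show ?thesis using True by simp
      next
        case False
        have "cmod (of_real (inverse (Suc n)) * v) \<le> 1 * 1"
          unfolding norm_mult norm_of_real using v by (intro mult_mono) (auto simp: inverse_le_1_iff)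
        moreover have "cmod z \<le> cmod (of_real (inverse (Suc n)) * v + z) + cmod (of_real (inverse (Suc n)) * v)"
          using norm_triangle_ineq4[of "of_real (inverse (Suc n)) * v + z" "of_real (inverse (Suc n)) * v"] by simp
        ultimately have "of_real (inverse (Suc n)) * v + z \<notin> disc" "z \<notin> disc"
          using False by (auto simp: disc_iff)
        then show ?thesis using False by (simp add: F_def h_def)
      qed
    qed
  qed (use int_h' F_int in auto)
  then have "integral\<^sup>L lborel h' = 0" unfolding F0 using LIMSEQ_unique[OF _ tendsto_const] by metis
  then show "(\<integral>z. indicator disc z *\<^sub>R V' z \<partial>lborel) = 0" by (simp add: h'_def[abs_def])
  show "integrable lborel (\<lambda>z. indicator disc z *\<^sub>R V' z)"
    using int_h' by (simp add: h'_def[abs_def])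
qed

text \<open>Twice continuously differentiable functions supported in a compact part of the disc. The
  single function \<open>gxy\<close> serves as both mixed derivatives, so their symmetry is built
  in; the divergence identity for the weighted estimate relies on it.\<close>

definition test_fun :: "(complex \<Rightarrow> complex) \<Rightarrow> (complex \<Rightarrow> complex) \<Rightarrow> (complex \<Rightarrow> complex) \<Rightarrow> bool" where
  "test_fun g gx gy \<longleftrightarrow> (\<exists>gxx gxy gyy r. r < 1 \<and> (\<forall>z. r < cmod z \<longrightarrow> g z = 0) \<and>
     (\<forall>f\<in>{g, gx, gy, gxx, gxy, gyy}. continuous_on UNIV f) \<and>
     has_pd 1 g gx UNIV \<and> has_pd \<i> g gy UNIV \<and> has_pd 1 gx gxx UNIV \<and> has_pd \<i> gx gxy UNIV \<and>
     has_pd 1 gy gxy UNIV \<and> has_pd \<i> gy gyy UNIV)"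

lemma test_funE:
  assumes "test_fun g gx gy"
  obtains gxx gxy gyy r where "r < 1" "\<And>z. r < cmod z \<Longrightarrow> g z = 0" "\<And>z. r < cmod z \<Longrightarrow> gx z = 0"
    "\<And>z. r < cmod z \<Longrightarrow> gy z = 0"
    "continuous_on UNIV g" "continuous_on UNIV gx" "continuous_on UNIV gy" "continuous_on UNIV gxx"
    "continuous_on UNIV gxy" "continuous_on UNIV gyy"
    "has_pd 1 g gx UNIV" "has_pd \<i> g gy UNIV" "has_pd 1 gx gxx UNIV" "has_pd \<i> gx gxy UNIV"
    "has_pd 1 gy gxy UNIV" "has_pd \<i> gy gyy UNIV"
proof -
  obtain gxx gxy gyy r where *: "r < 1" "\<And>z. r < cmod z \<Longrightarrow> g z = 0"
    "\<forall>f\<in>{g, gx, gy, gxx, gxy, gyy}. continuous_on UNIV f"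
    "has_pd 1 g gx UNIV" "has_pd \<i> g gy UNIV" "has_pd 1 gx gxx UNIV" "has_pd \<i> gx gxy UNIV"
    "has_pd 1 gy gxy UNIV" "has_pd \<i> gy gyy UNIV"
    using assms unfolding test_fun_def by blast
  have 0: "f' z = 0" if "has_pd v g f' UNIV" "r < cmod z" for v f' z
  proof -
    let ?U = "{z. r < cmod z}"
    have "open ?U" by (intro open_Collect_less continuous_intros)
    then have "has_pd v g (\<lambda>z. 0) ?U"
      by (rule has_pd_transform[OF has_pd_const]) (use *(2) in auto)
    from has_pd_unique[OF this has_pd_subset[OF that(1)]] that(2) show ?thesis by auto
  qed
  show ?thesis by (rule that[of r gxx gxy gyy]) (use * 0 in auto)
qed

lemma test_fun_0: "test_fun (\<lambda>_. 0) (\<lambda>_. 0) (\<lambda>_. 0)"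
  unfolding test_fun_def
  by (intro exI[of _ "\<lambda>_. 0"] exI[of _ 0]) (auto intro: has_pd_const)

lemma test_fun_add:
  assumes "test_fun g gx gy" "test_fun h hx hy"
  shows "test_fun (\<lambda>z. g z + h z) (\<lambda>z. gx z + hx z) (\<lambda>z. gy z + hy z)"
proof -
  obtain gxx gxy gyy r where g: "r < 1" "\<And>z. r < cmod z \<Longrightarrow> g z = 0"
    "\<forall>f\<in>{g, gx, gy, gxx, gxy, gyy}. continuous_on UNIV f"
    "has_pd 1 g gx UNIV" "has_pd \<i> g gy UNIV" "has_pd 1 gx gxx UNIV" "has_pd \<i> gx gxy UNIV"
    "has_pd 1 gy gxy UNIV" "has_pd \<i> gy gyy UNIV"
    using assms unfolding test_fun_def by blast
  obtain hxx hxy hyy r' where h: "r' < 1" "\<And>z. r' < cmod z \<Longrightarrow> h z = 0"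
    "\<forall>f\<in>{h, hx, hy, hxx, hxy, hyy}. continuous_on UNIV f"
    "has_pd 1 h hx UNIV" "has_pd \<i> h hy UNIV" "has_pd 1 hx hxx UNIV" "has_pd \<i> hx hxy UNIV"
    "has_pd 1 hy hxy UNIV" "has_pd \<i> hy hyy UNIV"
    using assms unfolding test_fun_def by blast
  show ?thesis unfolding test_fun_def
    by (rule exI[of _ "\<lambda>z. gxx z + hxx z"], rule exI[of _ "\<lambda>z. gxy z + hxy z"],
        rule exI[of _ "\<lambda>z. gyy z + hyy z"], rule exI[of _ "max r r'"])
      (use g h in \<open>auto intro!: has_pd_add continuous_on_add\<close>)
qed

lemma test_fun_cmult:
  assumes "test_fun g gx gy"
  shows "test_fun (\<lambda>z. c * g z) (\<lambda>z. c * gx z) (\<lambda>z. c * gy z)"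
proof -
  obtain gxx gxy gyy r where g: "r < 1" "\<And>z. r < cmod z \<Longrightarrow> g z = 0"
    "\<forall>f\<in>{g, gx, gy, gxx, gxy, gyy}. continuous_on UNIV f"
    "has_pd 1 g gx UNIV" "has_pd \<i> g gy UNIV" "has_pd 1 gx gxx UNIV" "has_pd \<i> gx gxy UNIV"
    "has_pd 1 gy gxy UNIV" "has_pd \<i> gy gyy UNIV"
    using assms unfolding test_fun_def by blast
  show ?thesis unfolding test_fun_def
    by (rule exI[of _ "\<lambda>z. c * gxx z"], rule exI[of _ "\<lambda>z. c * gxy z"],
        rule exI[of _ "\<lambda>z. c * gyy z"], rule exI[of _ r])
      (use g in \<open>auto intro!: has_pd_cmult continuous_on_mult\<close>)
qed

text \<open>Intended for the factor \<open>cnj (z - w)\<close>: with constant first derivatives of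
  \<open>p\<close>, the second derivatives of the product can be written down explicitly.\<close>

lemma test_fun_mult_affine:
  assumes "test_fun g gx gy" and p: "continuous_on UNIV p" "has_pd 1 p (\<lambda>_. a) UNIV" "has_pd \<i> p (\<lambda>_. b) UNIV"
  shows "test_fun (\<lambda>z. p z * g z) (\<lambda>z. p z * gx z + a * g z) (\<lambda>z. p z * gy z + b * g z)"
proof -
  obtain gxx gxy gyy r where g: "r < 1" "\<And>z. r < cmod z \<Longrightarrow> g z = 0"
    "\<forall>f\<in>{g, gx, gy, gxx, gxy, gyy}. continuous_on UNIV f"
    "has_pd 1 g gx UNIV" "has_pd \<i> g gy UNIV" "has_pd 1 gx gxx UNIV" "has_pd \<i> gx gxy UNIV"
    "has_pd 1 gy gxy UNIV" "has_pd \<i> gy gyy UNIV"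
    using assms unfolding test_fun_def by blast
  show ?thesis unfolding test_fun_def
  proof (rule exI[of _ "\<lambda>z. (p z * gxx z + a * gx z) + a * gx z"], rule exI[of _ "\<lambda>z. (p z * gxy z + b * gx z) + a * gy z"],
        rule exI[of _ "\<lambda>z. (p z * gyy z + b * gy z) + b * gy z"], rule exI[of _ r], intro conjI)
    show "has_pd 1 (\<lambda>z. p z * gy z + b * g z) (\<lambda>z. p z * gxy z + b * gx z + a * gy z) UNIV"
      by (rule has_pd_cong, rule has_pd_add, rule has_pd_mult, rule p, rule g, rule has_pd_cmult, rule g) simp
    show "has_pd 1 (\<lambda>z. p z * gx z + a * g z) (\<lambda>z. p z * gxx z + a * gx z + a * gx z) UNIV"
      by (rule has_pd_add, rule has_pd_mult, rule p, rule g, rule has_pd_cmult, rule g)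
    show "has_pd \<i> (\<lambda>z. p z * gx z + a * g z) (\<lambda>z. p z * gxy z + b * gx z + a * gy z) UNIV"
      by (rule has_pd_add, rule has_pd_mult, rule p, rule g, rule has_pd_cmult, rule g)
    show "has_pd \<i> (\<lambda>z. p z * gy z + b * g z) (\<lambda>z. p z * gyy z + b * gy z + b * gy z) UNIV"
      by (rule has_pd_add, rule has_pd_mult, rule p, rule g, rule has_pd_cmult, rule g)
    show "has_pd 1 (\<lambda>z. p z * g z) (\<lambda>z. p z * gx z + a * g z) UNIV"
      by (rule has_pd_mult, rule p, rule g)
    show "has_pd \<i> (\<lambda>z. p z * g z) (\<lambda>z. p z * gy z + b * g z) UNIV"
      by (rule has_pd_mult, rule p, rule g)
  qed (use g p in \<open>auto intro!: continuous_on_add continuous_on_mult\<close>)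
qed

section \<open>The weighted estimate\<close>

lemma C1_on_has_pd:
  assumes "C1_on S f" "v \<in> {1, \<i>}"
  shows "has_pd v f (pd v f) S" "continuous_on S (pd v f)" "continuous_on S f"
proof -
  show "has_pd v f (pd v f) S"
    unfolding has_pd_def
  proof
    fix z assume "z \<in> S"
    then have "(\<lambda>t::real. f (z + of_real t * v)) differentiable (at 0)"
      using assms unfolding C1_on_def by blast
    then have "((\<lambda>t::real. f (z + of_real t * v)) has_real_derivative pd v f z) (at 0)"
      unfolding pd_def by (simp add: DERIV_deriv_iff_real_differentiable)
    then show "((\<lambda>t. f (z + of_real t * v)) has_vector_derivative pd v f z) (at 0)"
      by (simp add: has_real_derivative_iff_has_vector_derivative)
  qed
qed (use assms in \<open>auto simp: C1_on_def\<close>)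

lemma C2_on_zero: "C2_on S (\<lambda>_. 0)"
proof -
  have "pd v (\<lambda>_. 0) = (\<lambda>_. 0)" for v by (simp add: pd_def fun_eq_iff)
  then show ?thesis by (auto simp: C2_on_def C1_on_def)
qed

lemma has_pd_exp:
  fixes f :: "complex \<Rightarrow> real"
  shows "has_pd v f f' S \<Longrightarrow> has_pd v (\<lambda>z. exp (f z)) (\<lambda>z. exp (f z) * f' z) S"
  by (rule has_pd_real_chain) (auto intro!: derivative_eq_intros)

text \<open>For \<open>A = 2 (\<bar>\<partial> g - g \<bar>\<partial> q)\<close> and \<open>B = 2 (\<partial> g + g \<partial> (p + q))\<close> the density
  \<open>e\<^sup>p (|A|\<^sup>2 - |B|\<^sup>2 - 4 |g|\<^sup>2 \<Delta>(p + 2 q))\<close> is a divergence.\<close>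

lemma twisted_dbar_estimate:
  assumes p: "C2_on disc p" and q: "C2_on disc q" and g: "test_fun g gx gy"
  shows "(\<integral>z. indicator disc z *\<^sub>R (exp (p z) * (cmod (g z))\<^sup>2 * (4 * dbar_lap p z + 8 * dbar_lap q z)) \<partial>lborel)
    \<le> (\<integral>z. indicator disc z *\<^sub>R (exp (p z) * (cmod (gx z + \<i> * gy z - g z * Complex (pd 1 q z) (pd \<i> q z)))\<^sup>2) \<partial>lborel)"
proof -
  obtain gxx gxy gyy r where r: "r < 1" and g0: "\<And>z. r < cmod z \<Longrightarrow> g z = 0" "\<And>z. r < cmod z \<Longrightarrow> gx z = 0"
    "\<And>z. r < cmod z \<Longrightarrow> gy z = 0"
    and gc: "continuous_on UNIV g" "continuous_on UNIV gx" "continuous_on UNIV gy" "continuous_on UNIV gxx"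
    "continuous_on UNIV gxy" "continuous_on UNIV gyy"
    and gd: "has_pd 1 g gx UNIV" "has_pd \<i> g gy UNIV" "has_pd 1 gx gxx UNIV" "has_pd \<i> gx gxy UNIV"
    "has_pd 1 gy gxy UNIV" "has_pd \<i> gy gyy UNIV"
    using g by (rule test_funE) blast
  have gc': "continuous_on disc g" "continuous_on disc gx" "continuous_on disc gy" "continuous_on disc gxx"
    "continuous_on disc gxy" "continuous_on disc gyy"
    using gc by (auto intro: continuous_on_subset)
  have gd': "has_pd 1 g gx disc" "has_pd \<i> g gy disc" "has_pd 1 gx gxx disc" "has_pd \<i> gx gxy disc"
    "has_pd 1 gy gxy disc" "has_pd \<i> gy gyy disc"
    using gd by (auto intro: has_pd_subset)
  define px py pxx pyy where "px = pd 1 p" "py = pd \<i> p" "pxx = pd 1 px" "pyy = pd \<i> py"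
  define qx qy qxx qyy where "qx = pd 1 q" "qy = pd \<i> q" "qxx = pd 1 qx" "qyy = pd \<i> qy"
  note defs = px_py_pxx_pyy_def qx_qy_qxx_qyy_def
  have pdp: "has_pd 1 p px disc" "has_pd \<i> p py disc" "has_pd 1 px pxx disc" "has_pd \<i> py pyy disc"
    and pc: "continuous_on disc p" "continuous_on disc px" "continuous_on disc py" "continuous_on disc pxx" "continuous_on disc pyy"
    using p unfolding C2_on_def defs by (auto intro: C1_on_has_pd)
  have pdq: "has_pd 1 q qx disc" "has_pd \<i> q qy disc" "has_pd 1 qx qxx disc" "has_pd \<i> qy qyy disc"
    and qc: "continuous_on disc q" "continuous_on disc qx" "continuous_on disc qy" "continuous_on disc qxx" "continuous_on disc qyy"
    using q unfolding C2_on_def defs by (auto intro: C1_on_has_pd)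
  define a b where "a z = Re (g z)" and "b z = Im (g z)" for z
  define ax bx where "ax z = Re (gx z)" and "bx z = Im (gx z)" for z
  define ay b_y where "ay z = Re (gy z)" and "b_y z = Im (gy z)" for z
  define axx bxx where "axx z = Re (gxx z)" and "bxx z = Im (gxx z)" for z
  define axy bxy where "axy z = Re (gxy z)" and "bxy z = Im (gxy z)" for z
  define ayy byy where "ayy z = Re (gyy z)" and "byy z = Im (gyy z)" for z
  note abd = a_def b_def ax_def bx_def ay_def b_y_def axx_def bxx_def axy_def bxy_def ayy_def byy_def
  have d: "has_pd 1 a ax disc" "has_pd 1 b bx disc" "has_pd \<i> a ay disc" "has_pd \<i> b b_y disc"
    "has_pd 1 ay axy disc" "has_pd 1 b_y bxy disc" "has_pd \<i> ax axy disc" "has_pd \<i> bx bxy disc"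
    using gd'[THEN has_pd_Re] gd'[THEN has_pd_Im] by (auto simp: abd[abs_def])
  have ac: "continuous_on disc a" "continuous_on disc b" "continuous_on disc ax" "continuous_on disc bx"
    "continuous_on disc ay" "continuous_on disc b_y" "continuous_on disc axy" "continuous_on disc bxy"
    unfolding abd[abs_def] by (intro continuous_intros gc')+
  \<comment> \<open>\<open>(V1, V2)\<close> is the vector field
    \<open>exp p * (|g|^2 * grad (p + 2 q))\<close> plus a rotated term whose components are
    \<open>2 exp p * Im (cnj g * gy)\<close> and \<open>- 2 exp p * Im (cnj g * gx)\<close>. The
    second derivatives of \<open>g\<close> cancel in its divergence because both components involve
    the same \<open>gxy\<close>.\<close>
  define V1 where "V1 z = exp (p z) * ((a z * a z + b z * b z) * (px z + 2 * qx z) + 2 * (a z * b_y z - b z * ay z))" for z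
  define V2 where "V2 z = exp (p z) * ((a z * a z + b z * b z) * (py z + 2 * qy z) + 2 * (b z * ax z - a z * bx z))" for z
  define V1' where "V1' z = exp (p z) * ((a z * a z + b z * b z) * (pxx z + 2 * qxx z) + (a z * ax z + ax z * a z + (b z * bx z + bx z * b z)) * (px z + 2 * qx z)
     + 2 * (a z * bxy z + ax z * b_y z - (b z * axy z + bx z * ay z)))
     + exp (p z) * px z * ((a z * a z + b z * b z) * (px z + 2 * qx z) + 2 * (a z * b_y z - b z * ay z))" for z
  define V2' where "V2' z = exp (p z) * ((a z * a z + b z * b z) * (pyy z + 2 * qyy z) + (a z * ay z + ay z * a z + (b z * b_y z + b_y z * b z)) * (py z + 2 * qy z)
     + 2 * (b z * axy z + b_y z * ax z - (a z * bxy z + ay z * bx z)))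
     + exp (p z) * py z * ((a z * a z + b z * b z) * (py z + 2 * qy z) + 2 * (b z * ax z - a z * bx z))" for z
  have V1: "has_pd 1 V1 V1' disc"
    unfolding V1_def[abs_def] V1'_def[abs_def]
    by (intro has_pd_mult has_pd_add has_pd_diff has_pd_cmult has_pd_exp d pdp pdq)
  have V2: "has_pd \<i> V2 V2' disc"
    unfolding V2_def[abs_def] V2'_def[abs_def]
    by (intro has_pd_mult has_pd_add has_pd_diff has_pd_cmult has_pd_exp d pdp pdq)
  have c: "continuous_on disc V1" "continuous_on disc V1'" "continuous_on disc V2" "continuous_on disc V2'"
    unfolding V1_def[abs_def] V1'_def[abs_def] V2_def[abs_def] V2'_def[abs_def]
    by (intro continuous_intros ac pc qc)+
  have I1: "integrable lborel (\<lambda>z. indicator disc z *\<^sub>R V1' z)" "(\<integral>z. indicator disc z *\<^sub>R V1' z \<partial>lborel) = 0"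
    by (rule integral_pd_eq_0[OF V1 c(1,2) _ r], simp, simp add: V1_def a_def b_def g0)+
  have I2: "integrable lborel (\<lambda>z. indicator disc z *\<^sub>R V2' z)" "(\<integral>z. indicator disc z *\<^sub>R V2' z \<partial>lborel) = 0"
    by (rule integral_pd_eq_0[OF V2 c(3,4) _ r], simp, simp add: V2_def a_def b_def g0)+
  define L where "L z = exp (p z) * (cmod (g z))\<^sup>2 * (4 * dbar_lap p z + 8 * dbar_lap q z)" for z
  define A where "A z = exp (p z) * (cmod (gx z + \<i> * gy z - g z * Complex (pd 1 q z) (pd \<i> q z)))\<^sup>2" for z
  define B where "B z = exp (p z) * (cmod (gx z - \<i> * gy z + g z * Complex (px z + qx z) (- (py z + qy z))))\<^sup>2" for z
  have L_eq: "L z = exp (p z) * (a z * a z + b z * b z) * (pxx z + pyy z + 2 * (qxx z + qyy z))" for z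
  proof -
    have "4 * dbar_lap p z + 8 * dbar_lap q z = pxx z + pyy z + 2 * (qxx z + qyy z)"
      by (simp add: dbar_lap_def defs field_simps)
    moreover have "(cmod (g z))\<^sup>2 = a z * a z + b z * b z"
      by (simp only: a_def b_def cmod_power2) (simp add: power2_eq_square)
    ultimately show ?thesis by (simp add: L_def)
  qed
  have A_eq: "A z = exp (p z) * ((ax z - b_y z - (a z * qx z - b z * qy z))\<^sup>2 + (bx z + ay z - (a z * qy z + b z * qx z))\<^sup>2)" for z
    by (simp add: A_def defs abd cmod_power2)
  have B_eq: "B z = exp (p z) * ((ax z + b_y z + (a z * (px z + qx z) + b z * (py z + qy z)))\<^sup>2 + (bx z - ay z + (b z * (px z + qx z) - a z * (py z + qy z)))\<^sup>2)" for z
    by (simp add: B_def defs abd cmod_power2 algebra_simps)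
  have ident: "A z - L z + V1' z + V2' z = B z" for z
    unfolding A_eq L_eq V1'_def V2'_def B_eq by algebra
  have IA: "integrable lborel (\<lambda>z. indicator disc z *\<^sub>R A z)"
    using r unfolding A_eq
    by (rule integrable_disc_compact_support[rotated]) (simp add: abd g0, intro continuous_intros ac pc qc)
  have IL: "integrable lborel (\<lambda>z. indicator disc z *\<^sub>R L z)"
    using r unfolding L_eq
    by (rule integrable_disc_compact_support[rotated]) (simp add: abd g0, intro continuous_intros ac pc qc)
  have "0 \<le> (\<integral>z. indicator disc z *\<^sub>R B z \<partial>lborel)"
    by (rule integral_nonneg_AE) (auto simp: B_def indicator_def)
  also have "\<dots> = (\<integral>z. indicator disc z *\<^sub>R A z - indicator disc z *\<^sub>R L z + indicator disc z *\<^sub>R V1' z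
      + indicator disc z *\<^sub>R V2' z \<partial>lborel)"
    by (rule Bochner_Integration.integral_cong) (simp_all add: ident[symmetric] algebra_simps)
  also have "\<dots> = (\<integral>z. indicator disc z *\<^sub>R A z \<partial>lborel) - (\<integral>z. indicator disc z *\<^sub>R L z \<partial>lborel)"
    using IA IL I1 I2 by simp
  finally show ?thesis by (simp add: A_def L_def)
qed

text \<open>Young's inequality with a free parameter: the factor \<open>1 + s\<close> of the second
  term has to be kept close to 1 for the absorption argument, at the price of a large factor of the
  first.\<close>

lemma sq_norm_diff_le:
  fixes s :: real assumes "s > 0"
  shows "(cmod (x - y))\<^sup>2 \<le> (1 + 1 / s) * (cmod x)\<^sup>2 + (1 + s) * (cmod y)\<^sup>2"
proof -
  have "(cmod (x - y))\<^sup>2 \<le> (cmod x + cmod y)\<^sup>2"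
    by (intro power_mono norm_triangle_ineq4) auto
  also have "\<dots> = (1 + 1 / s) * (cmod x)\<^sup>2 + (1 + s) * (cmod y)\<^sup>2 - (cmod x - s * cmod y)\<^sup>2 / s"
    using assms by (simp add: power2_eq_square field_simps)
  also have "\<dots> \<le> (1 + 1 / s) * (cmod x)\<^sup>2 + (1 + s) * (cmod y)\<^sup>2"
    using assms by simp
  finally show ?thesis .
qed

lemma C2_on_dbar_lap_continuous:
  assumes "C2_on S f" shows "continuous_on S (dbar_lap f)"
  unfolding dbar_lap_def[abs_def]
  using assms unfolding C2_on_def by (intro continuous_intros) (auto intro: C1_on_has_pd)

text \<open>The first alternative of \<open>class_W_star\<close> uses \<open>q = 0\<close> and \<open>\<rho> = \<Delta> p\<close>. In the second, \<open>q = \<psi>\<close> and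
  \<open>\<rho> = \<Delta> \<psi>\<close>: the term \<open>|g \<bar>\<partial> \<psi>|\<^sup>2 \<le> |g|\<^sup>2 \<Delta> \<psi>\<close> is absorbed because \<open>\<Delta> (p + 2 \<psi>) \<ge> (2 + t) \<Delta> \<psi>\<close>
  and \<open>2 + t > 1\<close>.\<close>

lemma W_star_dbar_estimate:
  assumes "class_W_star \<omega> K"
  obtains p \<rho> \<delta> C where "C2_on disc p" "\<And>z. z \<in> disc \<Longrightarrow> \<omega> z = exp (- p z)" "\<delta> > 0" "C > 0"
    "continuous_on disc \<rho>" "\<And>z. z \<in> disc \<Longrightarrow> \<delta> \<le> (tau \<omega> K z)\<^sup>2 * \<rho> z"
    "\<And>g gx gy. test_fun g gx gy \<Longrightarrow>
       (\<integral>z. indicator disc z *\<^sub>R (exp (p z) * (cmod (g z))\<^sup>2 * \<rho> z) \<partial>lborel)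
       \<le> C * (\<integral>z. indicator disc z *\<^sub>R (exp (p z) * (cmod (gx z + \<i> * gy z))\<^sup>2) \<partial>lborel)"
proof -
  obtain p where p: "C2_on disc p" "\<And>z. z \<in> disc \<Longrightarrow> \<omega> z = exp (- p z)"
    and cases: "(\<exists>c>0. \<forall>z\<in>disc. c \<le> (tau \<omega> K z)\<^sup>2 * dbar_lap p z) \<or>
         (\<exists>\<psi> \<delta> t. C2_on disc \<psi> \<and> subharmonic_on disc \<psi> \<and> (\<forall>z\<in>disc. 0 \<le> \<psi> z) \<and>
            \<delta> > 0 \<and> -1 < t \<and> t < 0 \<and>
            (\<forall>z\<in>disc. \<delta> \<le> (tau \<omega> K z)\<^sup>2 * dbar_lap \<psi> z \<and>
                       t * dbar_lap \<psi> z \<le> dbar_lap p z \<and>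
                       del_sq \<psi> z \<le> dbar_lap \<psi> z))"
    using assms unfolding class_W_star_def by blast
  have pc: "continuous_on disc p" using p(1) by (simp add: C2_on_def C1_on_def)
  from cases show ?thesis
  proof
    assume "\<exists>c>0. \<forall>z\<in>disc. c \<le> (tau \<omega> K z)\<^sup>2 * dbar_lap p z"
    then obtain c where c: "c > 0" "\<And>z. z \<in> disc \<Longrightarrow> c \<le> (tau \<omega> K z)\<^sup>2 * dbar_lap p z" by blast
    show ?thesis
    proof (rule that[OF p c(1) zero_less_one C2_on_dbar_lap_continuous[OF p(1)] c(2)])
      fix g gx gy assume g: "test_fun g gx gy"
      have z: "pd v (\<lambda>_. 0) = (\<lambda>_. 0)" for v by (simp add: pd_def fun_eq_iff)
      have "(\<integral>z. indicator disc z *\<^sub>R (exp (p z) * (cmod (g z))\<^sup>2 * (4 * dbar_lap p z)) \<partial>lborel)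
         \<le> (\<integral>z. indicator disc z *\<^sub>R (exp (p z) * (cmod (gx z + \<i> * gy z))\<^sup>2) \<partial>lborel)"
        using twisted_dbar_estimate[OF p(1) C2_on_zero g] by (simp add: dbar_lap_def z Complex_eq)
      moreover have "(\<integral>z. indicator disc z *\<^sub>R (exp (p z) * (cmod (g z))\<^sup>2 * (4 * dbar_lap p z)) \<partial>lborel)
         = 4 * (\<integral>z. indicator disc z *\<^sub>R (exp (p z) * (cmod (g z))\<^sup>2 * dbar_lap p z) \<partial>lborel)"
        by (simp flip: integral_mult_right_zero add: mult_ac)
      moreover have "0 \<le> (\<integral>z. indicator disc z *\<^sub>R (exp (p z) * (cmod (gx z + \<i> * gy z))\<^sup>2) \<partial>lborel)"
        by (rule integral_nonneg_AE) (auto simp: indicator_def)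
      ultimately show "(\<integral>z. indicator disc z *\<^sub>R (exp (p z) * (cmod (g z))\<^sup>2 * dbar_lap p z) \<partial>lborel)
         \<le> 1 * (\<integral>z. indicator disc z *\<^sub>R (exp (p z) * (cmod (gx z + \<i> * gy z))\<^sup>2) \<partial>lborel)"
        by linarith
    qed
  next
    assume "\<exists>\<psi> \<delta> t. C2_on disc \<psi> \<and> subharmonic_on disc \<psi> \<and> (\<forall>z\<in>disc. 0 \<le> \<psi> z) \<and>
            \<delta> > 0 \<and> -1 < t \<and> t < 0 \<and>
            (\<forall>z\<in>disc. \<delta> \<le> (tau \<omega> K z)\<^sup>2 * dbar_lap \<psi> z \<and>
                       t * dbar_lap \<psi> z \<le> dbar_lap p z \<and>
                       del_sq \<psi> z \<le> dbar_lap \<psi> z)"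
    then obtain q \<delta> t where q: "C2_on disc q" and d: "\<delta> > 0" and t: "-1 < t"
      and dq: "\<And>z. z \<in> disc \<Longrightarrow> \<delta> \<le> (tau \<omega> K z)\<^sup>2 * dbar_lap q z"
      and tq: "\<And>z. z \<in> disc \<Longrightarrow> t * dbar_lap q z \<le> dbar_lap p z"
      and del: "\<And>z. z \<in> disc \<Longrightarrow> del_sq q z \<le> dbar_lap q z"
      by blast
    \<comment> \<open>With this choice \<open>2 + t = 1 + 2 * s\<close>. Absorbing the gradient term
      costs \<open>1 + s\<close>, so a positive multiple \<open>s\<close> of
      \<open>|g|^2 * dbar_lap q\<close> survives, up to the common factor 4.\<close>
    define s where "s = (1 + t) / 2"
    have s: "s > 0" using t by (simp add: s_def)
    let ?C = "(1 + 1 / s) / (4 * s)"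
    show ?thesis
    proof (rule that[OF p d _ C2_on_dbar_lap_continuous[OF q] dq])
      show "0 < ?C" using s by (simp add: add_pos_pos)
      fix g gx gy assume g: "test_fun g gx gy"
      obtain r where r: "r < 1" "\<And>z. r < cmod z \<Longrightarrow> g z = 0" "\<And>z. r < cmod z \<Longrightarrow> gx z = 0" "\<And>z. r < cmod z \<Longrightarrow> gy z = 0"
        and gc: "continuous_on UNIV g" "continuous_on UNIV gx" "continuous_on UNIV gy"
        using g by (rule test_funE) blast
      note gc' = gc[THEN continuous_on_subset, OF subset_UNIV, of disc]
      have lc: "continuous_on disc (dbar_lap p)" "continuous_on disc (dbar_lap q)"
        using p q by (auto intro: C2_on_dbar_lap_continuous)
      have qc: "continuous_on disc (pd 1 q)" "continuous_on disc (pd \<i> q)"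
        using q unfolding C2_on_def by (auto intro: C1_on_has_pd)
      let ?X = "\<lambda>z. exp (p z) * (cmod (g z))\<^sup>2 * dbar_lap q z"
      let ?Y = "\<lambda>z. exp (p z) * (cmod (gx z + \<i> * gy z))\<^sup>2"
      let ?L = "\<lambda>z. exp (p z) * (cmod (g z))\<^sup>2 * (4 * dbar_lap p z + 8 * dbar_lap q z)"
      let ?A = "\<lambda>z. exp (p z) * (cmod (gx z + \<i> * gy z - g z * Complex (pd 1 q z) (pd \<i> q z)))\<^sup>2"
      have IX: "integrable lborel (\<lambda>z. indicator disc z *\<^sub>R ?X z)"
        by (rule integrable_disc_compact_support[OF _ r(1)]) (intro continuous_intros pc gc' lc, simp add: r)
      have IY: "integrable lborel (\<lambda>z. indicator disc z *\<^sub>R ?Y z)"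
        by (rule integrable_disc_compact_support[OF _ r(1)]) (intro continuous_intros pc gc' lc, simp add: r)
      have IL: "integrable lborel (\<lambda>z. indicator disc z *\<^sub>R ?L z)"
        by (rule integrable_disc_compact_support[OF _ r(1)]) (intro continuous_intros pc gc' lc, simp add: r)
      have IA: "integrable lborel (\<lambda>z. indicator disc z *\<^sub>R ?A z)"
        unfolding Complex_eq
        by (rule integrable_disc_compact_support[OF _ r(1)]) (intro continuous_intros pc gc' lc qc, simp add: r)
      have A_le: "?A z \<le> (1 + 1 / s) * ?Y z + 4 * (1 + s) * ?X z" if z: "z \<in> disc" for z
      proof -
        have "(cmod (g z * Complex (pd 1 q z) (pd \<i> q z)))\<^sup>2 = 4 * (cmod (g z))\<^sup>2 * del_sq q z"
          by (simp add: norm_mult power_mult_distrib cmod_power2 del_sq_def)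
        also have "\<dots> \<le> 4 * (cmod (g z))\<^sup>2 * dbar_lap q z"
          using del[OF z] by (intro mult_left_mono) auto
        finally have D: "(cmod (g z * Complex (pd 1 q z) (pd \<i> q z)))\<^sup>2 \<le> 4 * (cmod (g z))\<^sup>2 * dbar_lap q z" .
        have "(cmod (gx z + \<i> * gy z - g z * Complex (pd 1 q z) (pd \<i> q z)))\<^sup>2
            \<le> (1 + 1 / s) * (cmod (gx z + \<i> * gy z))\<^sup>2 + (1 + s) * (cmod (g z * Complex (pd 1 q z) (pd \<i> q z)))\<^sup>2"
          by (rule sq_norm_diff_le[OF s])
        also have "\<dots> \<le> (1 + 1 / s) * (cmod (gx z + \<i> * gy z))\<^sup>2 + (1 + s) * (4 * (cmod (g z))\<^sup>2 * dbar_lap q z)"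
          using D s by (intro add_left_mono mult_left_mono) auto
        finally have "?A z \<le> exp (p z) * ((1 + 1 / s) * (cmod (gx z + \<i> * gy z))\<^sup>2 + (1 + s) * (4 * (cmod (g z))\<^sup>2 * dbar_lap q z))"
          by (rule mult_left_mono) simp
        also have "\<dots> = (1 + 1 / s) * ?Y z + 4 * (1 + s) * ?X z" by (simp only: distrib_left distrib_right mult_ac)
        finally show ?thesis .
      qed
      have L_ge: "(4 * t + 8) * ?X z \<le> ?L z" if z: "z \<in> disc" for z
      proof -
        have "(4 * t + 8) * ?X z = (exp (p z) * (cmod (g z))\<^sup>2) * (4 * (t * dbar_lap q z) + 8 * dbar_lap q z)"
          by (simp add: algebra_simps)
        also have "\<dots> \<le> ?L z" using tq[OF z] by (intro mult_left_mono add_right_mono) auto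
        finally show ?thesis .
      qed
      have "(4 * t + 8) * (\<integral>z. indicator disc z *\<^sub>R ?X z \<partial>lborel) = (\<integral>z. (4 * t + 8) * (indicator disc z *\<^sub>R ?X z) \<partial>lborel)"
        by simp
      also have "\<dots> \<le> (\<integral>z. indicator disc z *\<^sub>R ?L z \<partial>lborel)"
        by (intro integral_mono integrable_mult_right IX IL) (use L_ge in \<open>auto simp: indicator_def\<close>)
      also have "\<dots> \<le> (\<integral>z. indicator disc z *\<^sub>R ?A z \<partial>lborel)"
        by (rule twisted_dbar_estimate[OF p(1) q g])
      also have "\<dots> \<le> (\<integral>z. (1 + 1 / s) * (indicator disc z *\<^sub>R ?Y z) + 4 * (1 + s) * (indicator disc z *\<^sub>R ?X z) \<partial>lborel)"
        by (intro integral_mono Bochner_Integration.integrable_add integrable_mult_right IX IY IA) (use A_le in \<open>auto simp: indicator_def\<close>)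
      also have "\<dots> = (1 + 1 / s) * (\<integral>z. indicator disc z *\<^sub>R ?Y z \<partial>lborel) + 4 * (1 + s) * (\<integral>z. indicator disc z *\<^sub>R ?X z \<partial>lborel)"
        using IX IY by simp
      finally have "(4 * t + 4 - 4 * s) * (\<integral>z. indicator disc z *\<^sub>R ?X z \<partial>lborel) \<le> (1 + 1 / s) * (\<integral>z. indicator disc z *\<^sub>R ?Y z \<partial>lborel)"
        by (simp only: distrib_right left_diff_distrib distrib_left)
      moreover have "4 * t + 4 - 4 * s = 4 * s" by (simp add: s_def field_simps)
      ultimately show "(\<integral>z. indicator disc z *\<^sub>R ?X z \<partial>lborel) \<le> ?C * (\<integral>z. indicator disc z *\<^sub>R ?Y z \<partial>lborel)"
        using s by (simp add: pos_le_divide_eq mult.commute)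
    qed
  qed
qed

section \<open>Polynomial bumps\<close>

text \<open>Radial bumps that are polynomial inside the disc of radius \<open>r\<close> about
  \<open>w\<close> and C2 on the plane as soon as \<open>k\<close> is at least 3, which is the
  regularity of a test function. A derivative lowers the exponent by one and brings out a coordinate
  of \<open>z - w\<close>.\<close>

definition bmp :: "nat \<Rightarrow> real \<Rightarrow> complex \<Rightarrow> complex \<Rightarrow> real" where
  "bmp k r w z = (max 0 (1 - (cmod (z - w))\<^sup>2 / r\<^sup>2)) ^ k"

lemma bmp_nonneg [simp]: "0 \<le> bmp k r w z"
  by (simp add: bmp_def)

lemma bmp_le_1: "bmp k r w z \<le> 1"
  by (simp add: bmp_def power_le_one)

lemma bmp_commute: "bmp k r w z = bmp k r z w"
  by (simp add: bmp_def norm_minus_commute)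

lemma bmp_eq_0: "r > 0 \<Longrightarrow> r \<le> cmod (z - w) \<Longrightarrow> bmp (Suc k) r w z = 0"
  by (simp add: bmp_def max_def power_mono)

lemma continuous_bmp: "continuous_on S f \<Longrightarrow> continuous_on S g \<Longrightarrow> continuous_on S (\<lambda>x. bmp k r (f x) (g x))"
  unfolding bmp_def divide_inverse by (intro continuous_intros)

lemma bmp_measurable [measurable (raw)]:
  assumes "f \<in> borel_measurable M" "g \<in> borel_measurable M"
  shows "(\<lambda>x. bmp k r (f x) (g x)) \<in> borel_measurable M"
  using assms unfolding bmp_def by measurable

text \<open>Trades \<open>|z - w|^2\<close> for a difference of consecutive exponents. The exponent
  has to be at least 1: \<open>bmp 0\<close> equals 1 off the disc as well, and the relation fails
  there.\<close>

lemma bmp_Suc: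
  assumes "r > 0"
  shows "bmp (Suc k) r w z - bmp (Suc (Suc k)) r w z = (cmod (z - w))\<^sup>2 / r\<^sup>2 * bmp (Suc k) r w z"
  by (simp add: bmp_def max_def algebra_simps)

text \<open>From the second power on the corner at 0 is harmless: the difference quotient there is
  at most \<open>|h| ^ Suc k\<close>, so the derivative is 0.\<close>

lemma DERIV_max_power:
  "((\<lambda>x::real. max 0 x ^ Suc (Suc k)) has_real_derivative (real k + 2) * max 0 x ^ Suc k) (at x)"
proof (cases x "0::real" rule: linorder_cases)
  case less
  have "((\<lambda>x. 0) has_real_derivative (real k + 2) * max 0 x ^ Suc k) (at x)"
    using less by (auto intro!: derivative_eq_intros simp: max_def)
  then show ?thesis
    by (rule DERIV_cong_ev[OF refl _ refl, THEN iffD1, rotated])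
      (use less in \<open>auto simp: eventually_nhds max_def intro!: exI[of _ "{..<0}"]\<close>)
next
  case equal
  have "((\<lambda>h::real. (max 0 (0 + h) ^ Suc (Suc k) - max 0 0 ^ Suc (Suc k)) / h) \<longlongrightarrow> 0) (at 0)"
  proof (rule Lim_null_comparison)
    have "norm ((max 0 (0 + h) ^ Suc (Suc k) - max 0 0 ^ Suc (Suc k)) / h) \<le> \<bar>h\<bar> ^ Suc k" for h :: real
      by (auto simp: max_def abs_mult power_abs intro!: mult_nonpos_nonneg)
    then show "\<forall>\<^sub>F h::real in at 0. norm ((max 0 (0 + h) ^ Suc (Suc k) - max 0 0 ^ Suc (Suc k)) / h) \<le> \<bar>h\<bar> ^ Suc k"
      by (rule always_eventually[OF allI])
    have "((\<lambda>h::real. \<bar>h\<bar> ^ Suc k) \<longlongrightarrow> \<bar>0\<bar> ^ Suc k) (at 0)"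
      by (intro tendsto_intros)
    then show "((\<lambda>h::real. \<bar>h\<bar> ^ Suc k) \<longlongrightarrow> 0) (at 0)" by simp
  qed
  then show ?thesis using equal by (simp add: DERIV_def)
next
  case greater
  have "((\<lambda>x. x ^ Suc (Suc k)) has_real_derivative (real k + 2) * max 0 x ^ Suc k) (at x)"
    using greater DERIV_pow[of "Suc (Suc k)" x] by (simp add: max_def add.commute)
  then show ?thesis
    by (rule DERIV_cong_ev[OF refl _ refl, THEN iffD1, rotated])
      (use greater in \<open>auto simp: eventually_nhds max_def intro!: exI[of _ "{0<..}"]\<close>)
qed

lemma has_pd_bmp:
  shows "has_pd 1 (bmp (Suc (Suc k)) r w) (\<lambda>z. (real k + 2) * bmp (Suc k) r w z * (- 2 / r\<^sup>2 * (Re z - Re w))) UNIV"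
    and "has_pd \<i> (bmp (Suc (Suc k)) r w) (\<lambda>z. (real k + 2) * bmp (Suc k) r w z * (- 2 / r\<^sup>2 * (Im z - Im w))) UNIV"
proof -
  have "has_pd 1 (\<lambda>z. 1 - (cmod (z - w))\<^sup>2 / r\<^sup>2) (\<lambda>z. - 2 / r\<^sup>2 * (Re z - Re w)) UNIV"
    unfolding has_pd_def cmod_power2 has_real_derivative_iff_has_vector_derivative[symmetric]
    by (auto intro!: derivative_eq_intros simp: divide_inverse algebra_simps)
  from has_pd_real_chain[OF this DERIV_max_power[of k]]
  show "has_pd 1 (bmp (Suc (Suc k)) r w) (\<lambda>z. (real k + 2) * bmp (Suc k) r w z * (- 2 / r\<^sup>2 * (Re z - Re w))) UNIV"
    unfolding bmp_def[abs_def] .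
  have "has_pd \<i> (\<lambda>z. 1 - (cmod (z - w))\<^sup>2 / r\<^sup>2) (\<lambda>z. - 2 / r\<^sup>2 * (Im z - Im w)) UNIV"
    unfolding has_pd_def cmod_power2 has_real_derivative_iff_has_vector_derivative[symmetric]
    by (auto intro!: derivative_eq_intros simp: divide_inverse algebra_simps)
  from has_pd_real_chain[OF this DERIV_max_power[of k]]
  show "has_pd \<i> (bmp (Suc (Suc k)) r w) (\<lambda>z. (real k + 2) * bmp (Suc k) r w z * (- 2 / r\<^sup>2 * (Im z - Im w))) UNIV"
    unfolding bmp_def[abs_def] .
qed

lemma has_pd_affine:
  "has_pd 1 (\<lambda>z. c * (Re z - a)) (\<lambda>z. c) S" "has_pd \<i> (\<lambda>z. c * (Re z - a)) (\<lambda>z. 0) S"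
  "has_pd 1 (\<lambda>z. c * (Im z - a)) (\<lambda>z. 0) S" "has_pd \<i> (\<lambda>z. c * (Im z - a)) (\<lambda>z. c) S"
  unfolding has_pd_def has_real_derivative_iff_has_vector_derivative[symmetric]
  by (auto intro!: derivative_eq_intros)

text \<open>\<open>gx + \<i> * gy\<close> is twice the \<open>dbar\<close> derivative. For a
  function of \<open>|z - w|^2\<close> it is proportional to \<open>z - w\<close>, and the exponent
  \<open>k + 3\<close> leaves room for two continuous derivatives.\<close>

lemma test_fun_bmp:
  assumes r: "r > 0" "cmod w + r < 1"
  obtains gx gy where "test_fun (\<lambda>z. of_real (bmp (k + 3) r w z)) gx gy"
    "\<And>z. gx z + \<i> * gy z = - of_real (2 * (real k + 3) / r\<^sup>2 * bmp (k + 2) r w z) * (z - w)"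
proof -
  let ?c = "- 2 / r\<^sup>2"
  let ?B = "\<lambda>j. bmp (k + j) r w"
  define X Y where "X z = ?c * (Re z - Re w)" and "Y z = ?c * (Im z - Im w)" for z
  have d: "has_pd 1 X (\<lambda>z. ?c) UNIV" "has_pd \<i> X (\<lambda>z. 0) UNIV" "has_pd 1 Y (\<lambda>z. 0) UNIV" "has_pd \<i> Y (\<lambda>z. ?c) UNIV"
    unfolding X_def[abs_def] Y_def[abs_def] by (rule has_pd_affine)+
  have b3: "has_pd 1 (?B 3) (\<lambda>z. (real k + 3) * ?B 2 z * X z) UNIV" "has_pd \<i> (?B 3) (\<lambda>z. (real k + 3) * ?B 2 z * Y z) UNIV"
    using has_pd_bmp[of "Suc k" r w] unfolding X_def Y_def by (simp_all only: numeral_eq_Suc add_Suc_right add_0_right pred_numeral_simps BitM.simps of_nat_Suc) (simp_all add: add_ac)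
  have b2: "has_pd 1 (?B 2) (\<lambda>z. (real k + 2) * ?B 1 z * X z) UNIV" "has_pd \<i> (?B 2) (\<lambda>z. (real k + 2) * ?B 1 z * Y z) UNIV"
    using has_pd_bmp[of k r w] unfolding X_def Y_def by (simp_all only: numeral_eq_Suc add_Suc_right add_0_right pred_numeral_simps BitM.simps) (simp_all add: add_ac)
  define fx fy where "fx z = (real k + 3) * ?B 2 z * X z" and "fy z = (real k + 3) * ?B 2 z * Y z" for z
  define fxx fxy fyy where
    "fxx z = (real k + 3) * ?B 2 z * ?c + (real k + 3) * ((real k + 2) * ?B 1 z * X z) * X z" and
    "fxy z = (real k + 3) * ((real k + 2) * ?B 1 z * Y z) * X z" and
    "fyy z = (real k + 3) * ?B 2 z * ?c + (real k + 3) * ((real k + 2) * ?B 1 z * Y z) * Y z" for z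
  have pd: "has_pd 1 (?B 3) fx UNIV" "has_pd \<i> (?B 3) fy UNIV" "has_pd 1 fx fxx UNIV" "has_pd \<i> fx fxy UNIV"
    "has_pd 1 fy fxy UNIV" "has_pd \<i> fy fyy UNIV"
  proof -
    show "has_pd 1 (?B 3) fx UNIV" "has_pd \<i> (?B 3) fy UNIV"
      using b3 by (simp_all add: fx_def[abs_def] fy_def[abs_def])
    show "has_pd 1 fx fxx UNIV" unfolding fx_def[abs_def] fxx_def[abs_def]
      by (intro has_pd_mult has_pd_cmult b2 d)
    show "has_pd \<i> fx fxy UNIV" unfolding fx_def[abs_def] fxy_def[abs_def]
      by (rule has_pd_cong[OF has_pd_mult[OF has_pd_cmult[OF b2(2)] d(2)]]) simp
    show "has_pd 1 fy fxy UNIV" unfolding fy_def[abs_def] fxy_def[abs_def]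
      by (rule has_pd_cong[OF has_pd_mult[OF has_pd_cmult[OF b2(1)] d(3)]]) simp
    show "has_pd \<i> fy fyy UNIV" unfolding fy_def[abs_def] fyy_def[abs_def]
      by (intro has_pd_mult has_pd_cmult b2 d)
  qed
  have XY: "continuous_on UNIV X" "continuous_on UNIV Y"
    unfolding X_def[abs_def] Y_def[abs_def] by (intro continuous_intros)+
  have c: "continuous_on UNIV f" if "f \<in> {?B 3, fx, fy, fxx, fxy, fyy}" for f
    using that r unfolding fx_def[abs_def] fy_def[abs_def] fxx_def[abs_def] fxy_def[abs_def] fyy_def[abs_def]
    by (auto intro!: continuous_intros XY continuous_bmp)
  have supp: "?B 3 z = 0" if "cmod w + r < cmod z" for z
  proof -
    have "r \<le> cmod (z - w)" using that norm_triangle_ineq2[of z w] by linarith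
    then show ?thesis using bmp_eq_0[OF r(1), of z w "k + 2"] by (simp add: numeral_eq_Suc)
  qed
  show ?thesis
  proof (rule that)
    show "test_fun (\<lambda>z. of_real (?B 3 z)) (\<lambda>z. of_real (fx z)) (\<lambda>z. of_real (fy z))"
      unfolding test_fun_def
      by (rule exI[of _ "\<lambda>z. of_real (fxx z)"], rule exI[of _ "\<lambda>z. of_real (fxy z)"],
          rule exI[of _ "\<lambda>z. of_real (fyy z)"], rule exI[of _ "cmod w + r"])
        (use r c supp pd[THEN has_pd_of_real] in \<open>auto intro!: continuous_on_of_real\<close>)
    fix z
    have "of_real (fx z) + \<i> * of_real (fy z) = of_real ((real k + 3) * ?B 2 z * ?c) * Complex (Re z - Re w) (Im z - Im w)"
      by (simp only: fx_def fy_def X_def Y_def complex_eq_iff) (simp add: mult.assoc)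
    also have "Complex (Re z - Re w) (Im z - Im w) = z - w" by (simp add: complex_eq_iff)
    finally show "of_real (fx z) + \<i> * of_real (fy z) = - of_real (2 * (real k + 3) / r\<^sup>2 * ?B 2 z) * (z - w)"
      by simp
  qed
qed

text \<open>The test function is \<open>cnj (z - w) * bmp (k + 3) r w z\<close>. Its
  \<open>dbar\<close> derivative contains \<open>|z - w|^2 * bmp (k + 2)\<close>, which is a
  difference of consecutive bumps, so only the bumps of exponent \<open>k + 3\<close> and
  \<open>k + 2\<close> remain. This is the source of the recursion for averages.\<close>

lemma test_fun_cnj_bmp:
  assumes r: "r > 0" "cmod w + r < 1"
  obtains g gx gy where "test_fun g gx gy"
    "\<And>z. gx z + \<i> * gy z = 2 * of_real ((real k + 4) * bmp (k + 3) r w z - (real k + 3) * bmp (k + 2) r w z)"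
proof -
  obtain gx gy where g: "test_fun (\<lambda>z. of_real (bmp (k + 3) r w z)) gx gy"
    and eq: "\<And>z. gx z + \<i> * gy z = - of_real (2 * (real k + 3) / r\<^sup>2 * bmp (k + 2) r w z) * (z - w)"
    using test_fun_bmp[OF r] by blast
  have p: "continuous_on UNIV (\<lambda>z. cnj (z - w))" by (intro continuous_intros)
  have h: "has_pd v (\<lambda>z. cnj (z - w)) (\<lambda>_. cnj v) UNIV" for v
    unfolding has_pd_def has_vector_derivative_def
    by (auto intro!: derivative_eq_intros simp: scaleR_conv_of_real)
  have p1: "has_pd 1 (\<lambda>z. cnj (z - w)) (\<lambda>_. 1) UNIV" using h[of 1] by simp
  have p2: "has_pd \<i> (\<lambda>z. cnj (z - w)) (\<lambda>_. - \<i>) UNIV" using h[of \<i>] by simp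
  show ?thesis
  proof (rule that[OF test_fun_mult_affine[OF g p p1 p2]])
    fix z
    let ?b = "bmp (k + 3) r w z" and ?b' = "bmp (k + 2) r w z"
    have n: "cnj (z - w) * (z - w) = of_real ((cmod (z - w))\<^sup>2)"
      by (metis complex_norm_square mult.commute)
    have "cnj (z - w) * gx z + 1 * of_real ?b + \<i> * (cnj (z - w) * gy z + - \<i> * of_real ?b)
       = 2 * of_real ?b + cnj (z - w) * (gx z + \<i> * gy z)"
      by (simp add: algebra_simps)
    also have "\<dots> = 2 * of_real ?b - of_real (2 * (real k + 3) / r\<^sup>2 * ?b') * (cnj (z - w) * (z - w))"
      unfolding eq by (simp add: algebra_simps)
    also have "\<dots> = of_real (2 * ?b - 2 * (real k + 3) * ((cmod (z - w))\<^sup>2 / r\<^sup>2 * ?b'))"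
      unfolding n by (simp add: algebra_simps)
    also have "(cmod (z - w))\<^sup>2 / r\<^sup>2 * ?b' = ?b' - ?b"
      using bmp_Suc[OF r(1), of "k + 1" w z] by (simp add: numeral_eq_Suc)
    finally show "cnj (z - w) * gx z + 1 * of_real ?b + \<i> * (cnj (z - w) * gy z + - \<i> * of_real ?b)
       = 2 * of_real ((real k + 4) * ?b - (real k + 3) * ?b')"
      by (simp add: algebra_simps)
  qed
qed

text \<open>Integration by parts for \<open>dbar\<close>, with both sides doubled; the compact
  support of \<open>g\<close> removes the boundary term, so \<open>b\<close> needs no control near
  the circle.\<close>

lemma integral_test_fun_parts:
  assumes g: "test_fun g gx gy" and b: "has_pd 1 b bx disc" "has_pd \<i> b b_y disc"
    "continuous_on disc b" "continuous_on disc bx" "continuous_on disc b_y"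
  shows "integrable lborel (\<lambda>z. indicator disc z *\<^sub>R (b z * (gx z + \<i> * gy z)))"
    "integrable lborel (\<lambda>z. indicator disc z *\<^sub>R ((bx z + \<i> * b_y z) * g z))"
    "(\<integral>z. indicator disc z *\<^sub>R (b z * (gx z + \<i> * gy z)) \<partial>lborel) =
     - (\<integral>z. indicator disc z *\<^sub>R ((bx z + \<i> * b_y z) * g z) \<partial>lborel)"
proof -
  obtain r where r: "r < 1" "\<And>z. r < cmod z \<Longrightarrow> g z = 0" "\<And>z. r < cmod z \<Longrightarrow> gx z = 0" "\<And>z. r < cmod z \<Longrightarrow> gy z = 0"
    and gc: "continuous_on UNIV g" "continuous_on UNIV gx" "continuous_on UNIV gy"
    and gd: "has_pd 1 g gx UNIV" "has_pd \<i> g gy UNIV"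
    using g by (rule test_funE) blast
  note gc' = gc[THEN continuous_on_subset, OF subset_UNIV, of disc]
  note gd' = gd[THEN has_pd_subset, OF subset_UNIV, of disc]
  show i1: "integrable lborel (\<lambda>z. indicator disc z *\<^sub>R (b z * (gx z + \<i> * gy z)))"
    by (rule integrable_disc_compact_support[OF _ r(1)]) (intro continuous_intros b gc', simp add: r)
  show i2: "integrable lborel (\<lambda>z. indicator disc z *\<^sub>R ((bx z + \<i> * b_y z) * g z))"
    by (rule integrable_disc_compact_support[OF _ r(1)]) (intro continuous_intros b gc', simp add: r)
  have x: "integrable lborel (\<lambda>z. indicator disc z *\<^sub>R (b z * gx z + bx z * g z))"
    "(\<integral>z. indicator disc z *\<^sub>R (b z * gx z + bx z * g z) \<partial>lborel) = 0"
    by (rule integral_pd_eq_0[OF has_pd_mult[OF b(1) gd'(1)] _ _ _ r(1)];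
        (intro continuous_intros b gc')?; simp add: r)+
  have y: "integrable lborel (\<lambda>z. indicator disc z *\<^sub>R (b z * gy z + b_y z * g z))"
    "(\<integral>z. indicator disc z *\<^sub>R (b z * gy z + b_y z * g z) \<partial>lborel) = 0"
    by (rule integral_pd_eq_0[OF has_pd_mult[OF b(2) gd'(2)] _ _ _ r(1)];
        (intro continuous_intros b gc')?; simp add: r)+
  have "(\<integral>z. indicator disc z *\<^sub>R (b z * (gx z + \<i> * gy z)) \<partial>lborel) +
     (\<integral>z. indicator disc z *\<^sub>R ((bx z + \<i> * b_y z) * g z) \<partial>lborel)
     = (\<integral>z. indicator disc z *\<^sub>R (b z * gx z + bx z * g z) + \<i> * (indicator disc z *\<^sub>R (b z * gy z + b_y z * g z)) \<partial>lborel)"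
    unfolding Bochner_Integration.integral_add[OF i1 i2, symmetric]
    by (rule Bochner_Integration.integral_cong) (auto simp: algebra_simps indicator_def)
  also have "\<dots> = 0"
    using x(2) y(2) Bochner_Integration.integral_add[OF x(1) integrable_mult_right[OF y(1), of \<i>]]
    by (simp only: integral_mult_right_zero) simp
  finally show "(\<integral>z. indicator disc z *\<^sub>R (b z * (gx z + \<i> * gy z)) \<partial>lborel) =
     - (\<integral>z. indicator disc z *\<^sub>R ((bx z + \<i> * b_y z) * g z) \<partial>lborel)"
    by (simp add: eq_neg_iff_add_eq_0)
qed

section \<open>Weakly holomorphic functions\<close>

lemma bmp_integrable: "r > 0 \<Longrightarrow> integrable lborel (bmp (Suc k) r w)"
proof -
  assume r: "r > 0"
  have "integrable lborel (\<lambda>z. indicator (cball w r) z *\<^sub>R bmp (Suc k) r w z)"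
    by (intro borel_integrable_compact continuous_bmp continuous_intros) auto
  moreover have "indicator (cball w r) z *\<^sub>R bmp (Suc k) r w z = bmp (Suc k) r w z" for z
    using bmp_eq_0[OF r, of z w k] by (auto simp: indicator_def dist_norm norm_minus_commute)
  ultimately show ?thesis by (simp only:)
qed

lemma bmp_integral_center: "(\<integral>z. bmp k r w z \<partial>lborel) = (\<integral>z. bmp k r 0 z \<partial>lborel)"
proof -
  have "bmp k r w \<in> borel_measurable borel"
    unfolding bmp_def[abs_def] by measurable
  from integral_lborel_translate[OF this, of w] show ?thesis by (simp add: bmp_def)
qed

lemma bmp_mult_integrable:
  fixes u :: "complex \<Rightarrow> complex"
  assumes "integrable lborel u" shows "integrable lborel (\<lambda>z. u z * of_real (bmp k r w z))"
proof (rule Bochner_Integration.integrable_bound[OF assms])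
  have "norm (u z * of_real (bmp k r w z)) \<le> norm (u z)" for z
    using bmp_le_1[of k r w z] by (simp add: norm_mult mult_left_le)
  then show "AE z in lborel. norm (u z * of_real (bmp k r w z)) \<le> norm (u z)" by simp
  show "(\<lambda>z. u z * of_real (bmp k r w z)) \<in> borel_measurable lborel"
    using assms by measurable
qed

text \<open>The exact value \<open>pi * r\<^sup>2 / 3\<close> is left uncomputed: the arguments need
  the recursion, positivity and a lower bound of order \<open>r\<^sup>2\<close>.\<close>

definition bmp_mass :: "real \<Rightarrow> real" where
  "bmp_mass r = (\<integral>z. bmp 2 r 0 z \<partial>lborel)"

text \<open>On the disc of half the radius the bump is at least \<open>(3/4)\<^sup>2 = 9/16\<close>,
  and \<open>9/16 * pi\<close> exceeds 1.\<close>

lemma bmp_mass_ge: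
  assumes "r > 0" shows "bmp_mass r \<ge> r\<^sup>2 / 4"
proof -
  have "emeasure lborel (cball (0::complex) (r / 2)) = ennreal (pi * (r / 2)\<^sup>2)"
    using assms by (subst emeasure_cball) (auto simp: unit_ball_vol_2)
  then have m: "measure lborel (cball (0::complex) (r / 2)) = pi * (r / 2)\<^sup>2"
    by (simp add: measure_def)
  have "r\<^sup>2 / 4 \<le> (9/16) * (pi * (r / 2)\<^sup>2)"
  proof -
    have "(9/16) * (pi * (r / 2)\<^sup>2) = (9/16 * pi) * (r\<^sup>2 / 4)" by (simp add: power_divide)
    moreover have "1 * (r\<^sup>2 / 4) \<le> (9/16 * pi) * (r\<^sup>2 / 4)"
      using pi_gt3 by (intro mult_right_mono) auto
    ultimately show ?thesis by (simp only: mult_1)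
  qed
  also have "\<dots> = (\<integral>z. (9/16) * indicator (cball (0::complex) (r / 2)) z \<partial>lborel)"
    using m by simp
  also have "\<dots> \<le> bmp_mass r"
    unfolding bmp_mass_def
  proof (rule integral_mono)
    show "integrable lborel (\<lambda>z::complex. 9 / 16 * indicat_real (cball 0 (r / 2)) z)"
      using borel_integrable_compact[of "cball 0 (r / 2) :: complex set" "\<lambda>_. 1::real"] by simp
    show "integrable lborel (bmp 2 r 0)" using bmp_integrable[OF assms, of 1 0] by (simp add: numeral_2_eq_2)
    fix z :: complex
    show "9 / 16 * indicat_real (cball 0 (r / 2)) z \<le> bmp 2 r 0 z"
    proof (cases "cmod z \<le> r / 2")
      case True
      then have "(cmod z)\<^sup>2 \<le> (r / 2)\<^sup>2" by (intro power_mono) auto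
      then have "(cmod z)\<^sup>2 / r\<^sup>2 \<le> 1/4" using assms by (simp add: power_divide field_simps)
      then have "3/4 \<le> max 0 (1 - (cmod (z - 0))\<^sup>2 / r\<^sup>2)" by (simp add: le_max_iff_disj)
      then have "(3/4)\<^sup>2 \<le> bmp 2 r 0 z"
        unfolding bmp_def by (rule power_mono) simp
      then show ?thesis using True by (simp add: power2_eq_square)
    qed simp
  qed
  finally show ?thesis .
qed

lemma bmp_mass_pos: "r > 0 \<Longrightarrow> bmp_mass r > 0"
  using bmp_mass_ge[of r] zero_less_power[of r 2] by linarith

text \<open>The bump lives in \<open>cball 0 R\<close>, so a \<open>v\<close> that is integrable on
  compact discs only may be cut down to one of them.\<close>

lemma disc_integral_bmp:
  fixes v :: "complex \<Rightarrow> complex"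
  assumes "r > 0" "cmod w + r \<le> R" "R < 1"
  shows "indicator disc z *\<^sub>R (v z * of_real (bmp (Suc k) r w z)) = (indicator (cball 0 R) z *\<^sub>R v z) * of_real (bmp (Suc k) r w z)"
proof (cases "r \<le> cmod (z - w)")
  case True then show ?thesis by (simp add: bmp_eq_0[OF assms(1)])
next
  case False
  then have "cmod z \<le> R" using norm_triangle_ineq2[of z w] assms by linarith
  then show ?thesis using assms by (simp add: disc_iff)
qed

text \<open>The Cauchy-Riemann equation in the sense of distributions, for a locally integrable
  function on the disc; \<open>gx + \<i> * gy\<close> is twice the \<open>dbar\<close> derivative of
  the test function.\<close>

definition weak_hol :: "(complex \<Rightarrow> complex) \<Rightarrow> bool" where
  "weak_hol v \<longleftrightarrow> (\<forall>R<1. integrable lborel (\<lambda>z. indicator (cball 0 R) z *\<^sub>R v z)) \<and>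
     (\<forall>g gx gy. test_fun g gx gy \<longrightarrow> (\<integral>z. indicator disc z *\<^sub>R (v z * (gx z + \<i> * gy z)) \<partial>lborel) = 0)"

text \<open>Testing with \<open>cnj (z - w) * bmp (k + 3) r w z\<close> makes the normalised averages against \<open>bmp (k + 2)\<close>
  independent of \<open>k\<close>; as \<open>k \<rightarrow> \<infinity>\<close> the bumps form an approximate identity.\<close>

lemma weak_hol_bmp_step:
  fixes u v :: "complex \<Rightarrow> complex"
  assumes v: "weak_hol v" and r: "r > 0" "cmod w + r \<le> R" "R < 1"
  defines "u \<equiv> \<lambda>z. indicator (cball 0 R) z *\<^sub>R v z"
  shows "(real k + 3) * (\<integral>z. u z * of_real (bmp (k + 2) r w z) \<partial>lborel) = 3 * (\<integral>z. u z * of_real (bmp 2 r w z) \<partial>lborel)"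
proof (induction k)
  case (Suc k)
  have r': "cmod w + r < 1" using r by simp
  have u: "integrable lborel u" using v r by (simp add: weak_hol_def u_def)
  obtain g gx gy where g: "test_fun g gx gy"
    and eq: "\<And>z. gx z + \<i> * gy z = 2 * of_real ((real k + 4) * bmp (k + 3) r w z - (real k + 3) * bmp (k + 2) r w z)"
    using test_fun_cnj_bmp[OF r(1) r'] by blast
  have *: "indicator disc z *\<^sub>R (v z * (gx z + \<i> * gy z)) =
     2 * (real k + 4) * (u z * of_real (bmp (k + 3) r w z)) - 2 * (real k + 3) * (u z * of_real (bmp (k + 2) r w z))" for z
  proof -
    have "u z * of_real (bmp (k + 3) r w z) = indicator disc z *\<^sub>R (v z * of_real (bmp (k + 3) r w z))"
      "u z * of_real (bmp (k + 2) r w z) = indicator disc z *\<^sub>R (v z * of_real (bmp (k + 2) r w z))"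
      using disc_integral_bmp[OF r, of z v "k + 2"] disc_integral_bmp[OF r, of z v "k + 1"]
      by (simp_all add: u_def numeral_eq_Suc) auto
    then show ?thesis unfolding eq by (cases "z \<in> disc") (simp_all only: indicator_simps, simp_all add: algebra_simps)
  qed
  have "0 = (\<integral>z. indicator disc z *\<^sub>R (v z * (gx z + \<i> * gy z)) \<partial>lborel)"
    using v g by (simp add: weak_hol_def)
  also have "\<dots> = 2 * (real k + 4) * (\<integral>z. u z * of_real (bmp (k + 3) r w z) \<partial>lborel)
      - 2 * (real k + 3) * (\<integral>z. u z * of_real (bmp (k + 2) r w z) \<partial>lborel)"
    unfolding * using bmp_mult_integrable[OF u] by (subst Bochner_Integration.integral_diff) auto
  finally have z: "0 = 2 * (real k + 4) * (\<integral>z. u z * of_real (bmp (k + 3) r w z) \<partial>lborel)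
      - 2 * (real k + 3) * (\<integral>z. u z * of_real (bmp (k + 2) r w z) \<partial>lborel)" .
  have "2 * ((real k + 4) * (\<integral>z. u z * of_real (bmp (k + 3) r w z) \<partial>lborel))
     = 2 * ((real k + 3) * (\<integral>z. u z * of_real (bmp (k + 2) r w z) \<partial>lborel))"
    using z[symmetric] unfolding right_minus_eq of_real_mult of_real_numeral mult.assoc .
  then have "(real k + 4) * (\<integral>z. u z * of_real (bmp (k + 3) r w z) \<partial>lborel)
     = (real k + 3) * (\<integral>z. u z * of_real (bmp (k + 2) r w z) \<partial>lborel)"
    by (rule mult_left_cancel[THEN iffD1, rotated]) simp
  then show ?case using Suc by (simp add: numeral_eq_Suc add.commute)
qed (simp add: numeral_2_eq_2)

lemma weak_hol_holomorphic:
  assumes "b holomorphic_on disc" shows "weak_hol b"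
  unfolding weak_hol_def
proof (intro conjI allI impI)
  fix R :: real assume "R < 1"
  then show "integrable lborel (\<lambda>z. indicator (cball 0 R) z *\<^sub>R b z)"
    by (intro borel_integrable_compact continuous_on_subset[OF holomorphic_on_imp_continuous_on[OF assms]]) (auto simp: disc_def)
next
  fix g gx gy assume g: "test_fun g gx gy"
  have 0: "deriv b z * 1 + \<i> * (deriv b z * \<i>) = 0" for z by (simp add: algebra_simps)
  have c: "continuous_on disc (\<lambda>z. deriv b z * v)" for v
    using holomorphic_deriv[OF assms open_disc] by (intro continuous_intros holomorphic_on_imp_continuous_on)
  have "(\<integral>z. indicator disc z *\<^sub>R (b z * (gx z + \<i> * gy z)) \<partial>lborel)
     = - (\<integral>z. indicator disc z *\<^sub>R ((deriv b z * 1 + \<i> * (deriv b z * \<i>)) * g z) \<partial>lborel)"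
    by (rule integral_test_fun_parts(3)[OF g has_pd_holomorphic[OF assms open_disc] has_pd_holomorphic[OF assms open_disc]
         holomorphic_on_imp_continuous_on[OF assms] c c])
  then show "(\<integral>z. indicator disc z *\<^sub>R (b z * (gx z + \<i> * gy z)) \<partial>lborel) = 0" unfolding 0 by simp
qed

section \<open>Bumps as an approximate identity and the mean value property\<close>

lemma bmp_integral_step:
  assumes "0 < r" "r < 1"
  shows "(real k + 3) * (\<integral>z. bmp (k + 2) r w z \<partial>lborel) = 3 * bmp_mass r"
proof -
  \<comment> \<open>The constant 1 is weakly holomorphic, so the recursion relates all bump
    integrals to \<open>bmp_mass r\<close> without evaluating any of them.\<close>
  have 1: "weak_hol (\<lambda>_. 1)" by (rule weak_hol_holomorphic) auto
  have e: "indicator (cball 0 r) z *\<^sub>R 1 * of_real (bmp (j + 2) r 0 z) = complex_of_real (bmp (j + 2) r 0 z)" for j z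
    using bmp_eq_0[OF assms(1), of z 0 "Suc j"] by (auto simp: indicator_def)
  have "complex_of_real ((real k + 3) * (\<integral>z. bmp (k + 2) r 0 z \<partial>lborel)) = of_real (3 * bmp_mass r)"
    using weak_hol_bmp_step[OF 1 assms(1) _ assms(2), of 0 k]
    unfolding e e[of _ 0, unfolded add_0] bmp_mass_def integral_complex_of_real
    by (simp only: of_real_mult of_real_numeral norm_zero add_0 order_refl)
  then have "(real k + 3) * (\<integral>z. bmp (k + 2) r 0 z \<partial>lborel) = 3 * bmp_mass r"
    by (simp only: of_real_eq_iff)
  then show ?thesis by (simp only: bmp_integral_center[of "k + 2" r w])
qed

text \<open>The factor \<open>k + 3\<close> keeps the total mass at \<open>3 * bmp_mass r\<close>.
  At distance at least \<open>d\<close> from \<open>w\<close> the bump decays like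
  \<open>q ^ (k + 1)\<close> with \<open>q < 1\<close>, and this beats the linear factor.
  Integrability of \<open>u\<close> controls the tail, so continuity at the single point
  \<open>w\<close> is enough.\<close>

lemma bmp_approximate_identity:
  fixes u :: "complex \<Rightarrow> complex"
  assumes u: "integrable lborel u" "isCont u w" and r: "0 < r" "r < 1"
  shows "(\<lambda>k. (real k + 3) * (\<integral>z. u z * of_real (bmp (k + 2) r w z) \<partial>lborel)) \<longlonglongrightarrow> 3 * bmp_mass r * u w"
proof (rule LIMSEQ_I)
  fix e :: real assume e: "e > 0"
  define m where "m = bmp_mass r"
  have m: "m > 0" using bmp_mass_pos r by (simp add: m_def)
  \<comment> \<open>Against the total mass \<open>3 * m\<close> an oscillation of \<open>e'\<close>
    near \<open>w\<close> contributes exactly \<open>e / 2\<close>.\<close>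
  define e' where "e' = e / (6 * m)"
  have e': "e' > 0" using e m by (simp add: e'_def)
  obtain d where d: "d > 0" "\<And>z. cmod (z - w) < d \<Longrightarrow> cmod (u z - u w) < e'"
    using u(2) e' unfolding continuous_at_eps_delta by (metis dist_norm)
  define q where "q = max 0 (1 - d\<^sup>2 / r\<^sup>2)"
  have q: "0 \<le> q" "q < 1" using d r by (auto simp: q_def max_def)
  have bi: "integrable lborel (bmp (k + 1) r w)" for k using bmp_integrable[OF r(1)] by simp
  have bi2: "integrable lborel (bmp (k + 2) r w)" for k using bmp_integrable[OF r(1), of "Suc k"] by simp
  have bic: "integrable lborel (\<lambda>z. u w * of_real (bmp (k + 2) r w z))" for k using bi2 by simp
  define M where "M = (\<integral>z. cmod (u z) + cmod (u w) * bmp 1 r w z \<partial>lborel)"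
  have Mi: "integrable lborel (\<lambda>z. cmod (u z) + cmod (u w) * bmp 1 r w z)"
    using u(1) bi[of 0] by auto
  have bound: "cmod (u z * of_real (bmp (k + 2) r w z) - u w * of_real (bmp (k + 2) r w z))
      \<le> e' * bmp (k + 2) r w z + q ^ (k + 1) * (cmod (u z) + cmod (u w) * bmp 1 r w z)" for z k
  proof -
    have l: "cmod (u z * of_real (bmp (k + 2) r w z) - u w * of_real (bmp (k + 2) r w z)) = cmod (u z - u w) * bmp (k + 2) r w z"
      by (simp add: norm_mult flip: left_diff_distrib)
    show ?thesis
    proof (cases "cmod (z - w) < d")
      case True
      have "cmod (u z - u w) * bmp (k + 2) r w z \<le> e' * bmp (k + 2) r w z"
        using d(2)[OF True] by (intro mult_right_mono) auto
      moreover have "0 \<le> q ^ (k + 1) * (cmod (u z) + cmod (u w) * bmp 1 r w z)"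
        using q by simp
      ultimately show ?thesis using l by linarith
    next
      case False
      \<comment> \<open>One factor \<open>bmp 1\<close> is set aside, so that the constant
        \<open>u w\<close> stays multiplied by something integrable over the plane.\<close>
      have "bmp (k + 2) r w z = bmp 1 r w z ^ (k + 1) * bmp 1 r w z"
        by (simp add: bmp_def)
      also have "\<dots> \<le> q ^ (k + 1) * bmp 1 r w z"
      proof (intro mult_right_mono power_mono)
        have "d\<^sup>2 / r\<^sup>2 \<le> (cmod (z - w))\<^sup>2 / r\<^sup>2"
          using False d by (intro divide_right_mono power_mono) auto
        then show "bmp 1 r w z \<le> q" by (simp add: bmp_def q_def)
      qed auto
      finally have b: "bmp (k + 2) r w z \<le> q ^ (k + 1) * bmp 1 r w z" .
      have "cmod (u z - u w) * bmp (k + 2) r w z \<le> (cmod (u z) + cmod (u w)) * (q ^ (k + 1) * bmp 1 r w z)"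
        using b by (intro mult_mono norm_triangle_ineq4) auto
      also have "\<dots> = q ^ (k + 1) * (cmod (u z) * bmp 1 r w z + cmod (u w) * bmp 1 r w z)"
        by (simp add: algebra_simps)
      also have "\<dots> \<le> q ^ (k + 1) * (cmod (u z) + cmod (u w) * bmp 1 r w z)"
        using q bmp_le_1[of 1 r w z] by (intro mult_left_mono add_right_mono mult_left_le) auto
      moreover have "0 \<le> e' * bmp (k + 2) r w z" using e' by simp
      ultimately show ?thesis using l by linarith
    qed
  qed
  have est: "cmod ((real k + 3) * (\<integral>z. u z * of_real (bmp (k + 2) r w z) \<partial>lborel) - 3 * m * u w)
     \<le> e / 2 + (real k + 3) * q ^ (k + 1) * M" for k
  proof -
    have "3 * m * u w = u w * complex_of_real ((real k + 3) * (\<integral>z. bmp (k + 2) r w z \<partial>lborel))"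
      unfolding bmp_integral_step[OF r] m_def by simp
    also have "\<dots> = (real k + 3) * (\<integral>z. u w * of_real (bmp (k + 2) r w z) \<partial>lborel)"
      by simp
    finally have "(real k + 3) * (\<integral>z. u z * of_real (bmp (k + 2) r w z) \<partial>lborel) - 3 * m * u w
       = (real k + 3) * (\<integral>z. u z * of_real (bmp (k + 2) r w z) - u w * of_real (bmp (k + 2) r w z) \<partial>lborel)"
      by (subst Bochner_Integration.integral_diff[OF bmp_mult_integrable[OF u(1)] bic]) (simp add: right_diff_distrib)
    also have "cmod \<dots> \<le> (real k + 3) * (\<integral>z. cmod (u z * of_real (bmp (k + 2) r w z) - u w * of_real (bmp (k + 2) r w z)) \<partial>lborel)"
      unfolding norm_mult norm_of_real by (intro mult_mono integral_norm_bound) auto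
    also have "\<dots> \<le> (real k + 3) * (\<integral>z. e' * bmp (k + 2) r w z + q ^ (k + 1) * (cmod (u z) + cmod (u w) * bmp 1 r w z) \<partial>lborel)"
    proof (intro mult_left_mono integral_mono)
      show "integrable lborel (\<lambda>z. cmod (u z * of_real (bmp (k + 2) r w z) - u w * of_real (bmp (k + 2) r w z)))"
        by (intro integrable_norm Bochner_Integration.integrable_diff bmp_mult_integrable u bic)
      show "integrable lborel (\<lambda>z. e' * bmp (k + 2) r w z + q ^ (k + 1) * (cmod (u z) + cmod (u w) * bmp 1 r w z))"
        by (intro Bochner_Integration.integrable_add integrable_mult_right bi2 Mi)
    qed (use bound in auto)
    also have "\<dots> = e' * ((real k + 3) * (\<integral>z. bmp (k + 2) r w z \<partial>lborel)) + (real k + 3) * q ^ (k + 1) * M"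
      unfolding M_def Bochner_Integration.integral_add[OF integrable_mult_right[OF bi2] integrable_mult_right[OF Mi]]
        integral_mult_right_zero by (simp only: distrib_left distrib_right mult_ac)
    also have "e' * ((real k + 3) * (\<integral>z. bmp (k + 2) r w z \<partial>lborel)) = e / 2"
      unfolding bmp_integral_step[OF r] using m by (simp add: e'_def m_def)
    finally show ?thesis .
  qed
  have "(\<lambda>k. (real (k + 1) * q ^ (k + 1) + 2 * q ^ (k + 1)) * M) \<longlonglongrightarrow> (0 + 2 * 0) * M"
    using q LIMSEQ_ignore_initial_segment[OF powser_times_n_limit_0[of q], of 1]
      LIMSEQ_ignore_initial_segment[OF LIMSEQ_power_zero[of q], of 1]
    by (intro tendsto_intros) auto
  then have "(\<lambda>k. (real k + 3) * q ^ (k + 1) * M) \<longlonglongrightarrow> 0"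
    by (simp add: algebra_simps)
  from LIMSEQ_D[OF this, of "e / 2"] e obtain N where N: "\<And>k. k \<ge> N \<Longrightarrow> \<bar>(real k + 3) * q ^ (k + 1) * M\<bar> < e / 2"
    by (auto simp: real_norm_def)
  show "\<exists>N. \<forall>k\<ge>N. norm ((real k + 3) * (\<integral>z. u z * of_real (bmp (k + 2) r w z) \<partial>lborel) - 3 * bmp_mass r * u w) < e"
  proof (intro exI[of _ N] allI impI)
    fix k assume "k \<ge> N"
    from est[of k] N[OF this] show "norm ((real k + 3) * (\<integral>z. u z * of_real (bmp (k + 2) r w z) \<partial>lborel) - 3 * bmp_mass r * u w) < e"
      unfolding m_def by linarith
  qed
qed

text \<open>The normalised averages do not depend on the exponent and converge to the value at the
  centre, so each of them already equals it.\<close>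

lemma weak_hol_mean_value:
  fixes v :: "complex \<Rightarrow> complex"
  assumes v: "weak_hol v" "isCont v w" and r: "r > 0" "cmod w + r < 1"
  shows "(\<integral>z. indicator disc z *\<^sub>R (v z * of_real (bmp 2 r w z)) \<partial>lborel) = bmp_mass r * v w"
proof -
  define R where "R = cmod w + r"
  have R: "cmod w + r \<le> R" "R < 1" using r by (auto simp: R_def)
  define u where "u = (\<lambda>z. indicator (cball 0 R) z *\<^sub>R v z)"
  have u: "integrable lborel u" using v R by (simp add: weak_hol_def u_def)
  have w: "w \<in> ball 0 R" using r by (simp add: R_def)
  have "\<forall>\<^sub>F z in nhds w. u z = v z"
    unfolding eventually_nhds by (rule exI[of _ "ball 0 R"]) (use w in \<open>auto simp: u_def\<close>)
  then have uc: "isCont u w" "u w = v w"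
    using v(2) isCont_cong[of u v w] w by (auto simp: u_def)
  have r1: "r < 1" using r norm_ge_zero[of w] by linarith
  have st: "(real k + 3) * (\<integral>z. u z * of_real (bmp (k + 2) r w z) \<partial>lborel) = 3 * (\<integral>z. u z * of_real (bmp 2 r w z) \<partial>lborel)" for k
    using weak_hol_bmp_step[OF v(1) r(1) R, of k] by (simp only: u_def)
  have "(\<lambda>k::nat. 3 * (\<integral>z. u z * of_real (bmp 2 r w z) \<partial>lborel)) \<longlonglongrightarrow> 3 * bmp_mass r * u w"
    using bmp_approximate_identity[OF u uc(1) r(1) r1] st by simp
  then have "3 * (\<integral>z. u z * of_real (bmp 2 r w z) \<partial>lborel) = 3 * bmp_mass r * u w"
    using LIMSEQ_unique tendsto_const by blast
  then have "(\<integral>z. u z * of_real (bmp 2 r w z) \<partial>lborel) = bmp_mass r * v w" using uc by simp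
  moreover have "indicator disc z *\<^sub>R (v z * of_real (bmp 2 r w z)) = u z * of_real (bmp 2 r w z)" for z
    using disc_integral_bmp[OF r(1) R, of z v 1] by (simp add: u_def numeral_2_eq_2)
  ultimately show ?thesis by simp
qed

section \<open>Holomorphic dependence of bump averages on the centre\<close>

lemma cube_taylor:
  fixes x y :: real assumes "x \<le> 1" "y \<le> 1"
  shows "\<bar>max 0 y ^ 3 - max 0 x ^ 3 - 3 * max 0 x ^ 2 * (y - x)\<bar> \<le> 5 * (y - x)\<^sup>2"
proof -
  consider "x < 0" "y < 0" | "x < 0" "0 \<le> y" | "0 \<le> x" "0 \<le> y" | "0 \<le> x" "y < 0" by linarith
  then show ?thesis
  proof cases
    case 1 then show ?thesis by simp
  next
    case 2
    have "y ^ 3 \<le> y ^ 2" using 2 assms by (intro power_decreasing) auto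
    also have "y ^ 2 \<le> (y - x)\<^sup>2" using 2 by (intro power_mono) auto
    finally have "y ^ 3 \<le> 5 * (y - x)\<^sup>2" using zero_le_power2[of "y - x"] by linarith
    then show ?thesis using 2 by (simp add: max_def)
  next
    case 3
    have "y ^ 3 - x ^ 3 - 3 * x ^ 2 * (y - x) = (y - x)\<^sup>2 * (y + 2 * x)"
      by (simp add: power2_eq_square power3_eq_cube algebra_simps)
    then have "\<bar>max 0 y ^ 3 - max 0 x ^ 3 - 3 * max 0 x ^ 2 * (y - x)\<bar> = (y - x)\<^sup>2 * (y + 2 * x)"
      using 3 by (simp add: max_def abs_mult)
    also have "\<dots> \<le> (y - x)\<^sup>2 * 5" using 3 assms by (intro mult_left_mono) auto
    finally show ?thesis by simp
  next
    case 4
    have "max 0 y ^ 3 - max 0 x ^ 3 - 3 * max 0 x ^ 2 * (y - x) = 2 * x ^ 3 + 3 * x\<^sup>2 * (- y)"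
      using 4 by (simp add: max_def power2_eq_square power3_eq_cube algebra_simps)
    moreover have "0 \<le> 2 * x ^ 3 + 3 * x\<^sup>2 * (- y)" using 4 by (intro add_nonneg_nonneg mult_nonneg_nonneg) auto
    moreover have "x ^ 3 \<le> x ^ 2" using 4 assms by (intro power_decreasing) auto
    moreover have "x ^ 2 \<le> (y - x)\<^sup>2" using 4 by (subst power2_commute) (intro power_mono, auto)
    moreover have "x\<^sup>2 * (- y) \<le> (y - x)\<^sup>2"
    proof -
      have "x\<^sup>2 * (- y) = x * (x * (- y))" by (simp add: power2_eq_square)
      also have "\<dots> \<le> 1 * (x * (- y))" using 4 assms by (intro mult_right_mono) (auto intro: mult_nonneg_nonpos)
      also have "\<dots> \<le> (x - y) * (x - y)" unfolding mult_1 using 4 by (intro mult_mono) auto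
      finally show ?thesis by (simp add: power2_eq_square algebra_simps)
    qed
    ultimately show ?thesis by linarith
  qed
qed

text \<open>The remainder is uniform in \<open>z\<close>, so the expansion can be integrated against
  a merely integrable function. In \<open>125 / r^4\<close> the factor 5 of the cubic remainder
  multiplies the square of the bound \<open>5 * cmod h / r\<^sup>2\<close> for the increment;
  \<open>3 / r\<^sup>2\<close> comes from the quadratic part of
  \<open>|z - w - h|^2\<close>.\<close>

lemma bmp_taylor:
  assumes r: "r > 0" and zw: "cmod (z - w) \<le> 2" and h: "cmod h \<le> 1"
  shows "\<bar>bmp 3 r (w + h) z - bmp 3 r w z - 3 * bmp 2 r w z * (2 * Re (cnj (z - w) * h) / r\<^sup>2)\<bar> \<le> (125 / r^4 + 3 / r\<^sup>2) * (cmod h)\<^sup>2"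
proof -
  define x y where "x = 1 - (cmod (z - w))\<^sup>2 / r\<^sup>2" and "y = 1 - (cmod (z - (w + h)))\<^sup>2 / r\<^sup>2"
  have le: "x \<le> 1" "y \<le> 1" by (auto simp: x_def y_def)
  have "(cmod (z - (w + h)))\<^sup>2 = (cmod (z - w))\<^sup>2 - 2 * Re (cnj (z - w) * h) + (cmod h)\<^sup>2"
    by (simp only: cmod_power2) (simp add: power2_eq_square algebra_simps)
  then have yx: "y - x = 2 * Re (cnj (z - w) * h) / r\<^sup>2 - (cmod h)\<^sup>2 / r\<^sup>2"
    unfolding x_def y_def by (simp only: diff_divide_distrib add_divide_distrib)
  have "\<bar>Re (cnj (z - w) * h)\<bar> \<le> cmod (cnj (z - w) * h)" by (rule abs_Re_le_cmod)
  also have "\<dots> \<le> 2 * cmod h" unfolding norm_mult complex_mod_cnj using zw by (intro mult_right_mono) auto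
  finally have re: "\<bar>Re (cnj (z - w) * h)\<bar> \<le> 2 * cmod h" .
  have "(cmod h)\<^sup>2 \<le> cmod h" using h by (simp add: power2_eq_square mult_left_le)
  then have "\<bar>2 * Re (cnj (z - w) * h) - (cmod h)\<^sup>2\<bar> \<le> 5 * cmod h"
    using re zero_le_power2[of "cmod h"] norm_ge_zero[of h] by linarith
  then have "\<bar>y - x\<bar> \<le> 5 * cmod h / r\<^sup>2"
    unfolding yx diff_divide_distrib[symmetric] abs_divide by (simp add: divide_right_mono)
  then have "\<bar>y - x\<bar>\<^sup>2 \<le> (5 * cmod h / r\<^sup>2)\<^sup>2" by (rule power_mono) simp
  then have sq: "(y - x)\<^sup>2 \<le> 25 / r^4 * (cmod h)\<^sup>2" by (simp add: power_divide power_mult_distrib)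
  have e: "bmp 3 r (w + h) z - bmp 3 r w z - 3 * bmp 2 r w z * (2 * Re (cnj (z - w) * h) / r\<^sup>2)
     = (max 0 y ^ 3 - max 0 x ^ 3 - 3 * max 0 x ^ 2 * (y - x)) - 3 * bmp 2 r w z * ((cmod h)\<^sup>2 / r\<^sup>2)"
  proof -
    have t: "2 * Re (cnj (z - w) * h) / r\<^sup>2 = (y - x) + (cmod h)\<^sup>2 / r\<^sup>2" using yx by simp
    have "bmp 3 r (w + h) z = max 0 y ^ 3" "bmp 3 r w z = max 0 x ^ 3" "bmp 2 r w z = max 0 x ^ 2"
      by (simp_all add: bmp_def x_def y_def)
    then show ?thesis unfolding t by (simp add: algebra_simps)
  qed
  have "bmp 2 r w z * ((cmod h)\<^sup>2 / r\<^sup>2) \<le> 1 * ((cmod h)\<^sup>2 / r\<^sup>2)"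
    by (intro mult_right_mono bmp_le_1) auto
  moreover have "0 \<le> bmp 2 r w z * ((cmod h)\<^sup>2 / r\<^sup>2)" by simp
  moreover have "(125 / r^4 + 3 / r\<^sup>2) * (cmod h)\<^sup>2 = 5 * (25 / r^4 * (cmod h)\<^sup>2) + 3 * ((cmod h)\<^sup>2 / r\<^sup>2)"
    by (simp add: algebra_simps)
  ultimately show ?thesis unfolding e using cube_taylor[OF le] sq by linarith
qed

lemma has_field_derivative_quadratic:
  fixes f :: "complex \<Rightarrow> complex"
  assumes d: "d > 0" and "\<And>h. cmod h < d \<Longrightarrow> cmod (f (w + h) - f w - h * D) \<le> M * (cmod h)\<^sup>2"
  shows "(f has_field_derivative D) (at w)"
  unfolding DERIV_def
proof (rule LIM_zero_cancel, rule Lim_null_comparison)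
  show "\<forall>\<^sub>F h in at 0. norm ((f (w + h) - f w) / h - D) \<le> M * cmod h"
    unfolding eventually_at
  proof (intro exI[of _ d] conjI ballI impI d)
    fix h :: complex assume h: "h \<noteq> 0 \<and> dist h 0 < d"
    have "(f (w + h) - f w) / h - D = (f (w + h) - f w - h * D) / h" using h by (simp add: field_simps)
    then have "norm ((f (w + h) - f w) / h - D) \<le> M * (cmod h)\<^sup>2 / cmod h"
      using assms(2)[of h] h by (simp add: norm_divide divide_right_mono)
    then show "norm ((f (w + h) - f w) / h - D) \<le> M * cmod h" using h by (simp add: power2_eq_square)
  qed
  show "((\<lambda>h. M * cmod h) \<longlongrightarrow> 0) (at 0)"
    by (intro tendsto_mult_right_zero tendsto_norm_zero tendsto_ident_at)
qed

text \<open>A shift of the centre by \<open>h\<close> changes the bump to first order by a multiple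
  of \<open>h\<close> plus a multiple of \<open>cnj h\<close>. The coefficient of
  \<open>cnj h\<close> is proportional to the integral of \<open>v\<close> against the
  \<open>dbar\<close> derivative of \<open>bmp 3\<close>, and vanishes since \<open>v\<close> is
  weakly holomorphic. What is left is complex linear in \<open>h\<close>.\<close>

lemma weak_hol_average_holomorphic:
  fixes v :: "complex \<Rightarrow> complex"
  assumes v: "weak_hol v" and r: "r > 0"
  shows "(\<lambda>w. \<integral>z. indicator disc z *\<^sub>R (v z * of_real (bmp 3 r w z)) \<partial>lborel) holomorphic_on ball 0 (1 - r)"
proof (rule holomorphic_onI)
  fix w :: complex assume "w \<in> ball 0 (1 - r)"
  then have w: "cmod w + r < 1" by simp
  \<comment> \<open>Half of the gap to the circle: for \<open>cmod h < d\<close> the bumps about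
    \<open>w + h\<close> all live in the fixed disc \<open>cball 0 R\<close> with
    \<open>R < 1\<close>.\<close>
  define d where "d = (1 - r - cmod w) / 2"
  define R where "R = cmod w + r + d"
  have d: "0 < d" unfolding d_def using w by simp
  have d1: "d \<le> 1"
  proof -
    have "1 - r - cmod w \<le> 1 - 0 - 0" using r by (intro diff_mono) auto
    then show ?thesis by (simp add: d_def)
  qed
  have R: "R < 1" using w by (simp add: R_def d_def field_simps)
  define u where "u = (\<lambda>z. indicator (cball 0 R) z *\<^sub>R v z)"
  have u: "integrable lborel u" using v R by (simp add: weak_hol_def u_def)
  define G where "G w' = (\<integral>z. indicator disc z *\<^sub>R (v z * of_real (bmp 3 r w' z)) \<partial>lborel)" for w'
  have G: "G (w + h) = (\<integral>z. u z * of_real (bmp 3 r (w + h) z) \<partial>lborel)" if "cmod h < d" for h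
  proof -
    have "cmod (w + h) + r \<le> R" using norm_triangle_ineq[of w h] that by (simp add: R_def)
    from disc_integral_bmp[OF r this R, of _ v 2] show ?thesis unfolding G_def u_def by (simp only: eval_nat_numeral)
  qed
  define D where "D = (\<integral>z. u z * of_real (3 / r\<^sup>2 * bmp 2 r w z) * cnj (z - w) \<partial>lborel)"
  have bz: "integrable lborel (\<lambda>z. u z * of_real (3 / r\<^sup>2 * bmp 2 r w z) * f z)"
    if "f \<in> borel_measurable lborel" "\<And>z. cmod (f z) = cmod (z - w)" for f
  proof (rule Bochner_Integration.integrable_bound[OF integrable_mult_right[OF u, of "of_real (6 / r\<^sup>2)"]])
    show "(\<lambda>z. u z * of_real (3 / r\<^sup>2 * bmp 2 r w z) * f z) \<in> borel_measurable lborel"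
      using u that by measurable
    show "AE z in lborel. norm (u z * of_real (3 / r\<^sup>2 * bmp 2 r w z) * f z) \<le> norm (of_real (6 / r\<^sup>2) * u z)"
    proof (rule AE_I2)
      fix z
      show "norm (u z * of_real (3 / r\<^sup>2 * bmp 2 r w z) * f z) \<le> norm (of_real (6 / r\<^sup>2) * u z)"
      proof (cases "z \<in> cball 0 R")
        case True
        then have "cmod (z - w) \<le> 2" using norm_triangle_ineq4[of z w] w R r by simp
        then have "bmp 2 r w z * cmod (f z) \<le> 1 * 2"
          unfolding that(2) by (intro mult_mono bmp_le_1) auto
        then have "3 / r\<^sup>2 * cmod (u z) * (bmp 2 r w z * cmod (f z)) \<le> 3 / r\<^sup>2 * cmod (u z) * 2"
          by (intro mult_left_mono) auto
        then show ?thesis by (simp add: norm_mult mult_ac norm_divide norm_power)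
      qed (simp add: u_def)
    qed
  qed
  have b1: "integrable lborel (\<lambda>z. u z * of_real (3 / r\<^sup>2 * bmp 2 r w z) * cnj (z - w))"
    by (rule bz) (auto simp del: complex_cnj_diff)
  have b2: "integrable lborel (\<lambda>z. u z * of_real (3 / r\<^sup>2 * bmp 2 r w z) * (z - w))"
    by (rule bz) auto
  have zero: "(\<integral>z. u z * of_real (3 / r\<^sup>2 * bmp 2 r w z) * (z - w) \<partial>lborel) = 0"
  proof -
    obtain gx gy where g: "test_fun (\<lambda>z. of_real (bmp (0 + 3) r w z)) gx gy"
      and eq: "\<And>z. gx z + \<i> * gy z = - of_real (2 * (real 0 + 3) / r\<^sup>2 * bmp (0 + 2) r w z) * (z - w)"
      using test_fun_bmp[OF r w] by blast
    have "cmod w + r \<le> R" using d by (simp add: R_def)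
    from disc_integral_bmp[OF r this R, of _ v 1]
    have *: "indicator disc z *\<^sub>R (v z * (gx z + \<i> * gy z)) = - 2 * (u z * of_real (3 / r\<^sup>2 * bmp 2 r w z) * (z - w))" for z
    proof -
      have e: "indicator disc z *\<^sub>R (v z * of_real (bmp 2 r w z)) = u z * of_real (bmp 2 r w z)"
        using disc_integral_bmp[OF r \<open>cmod w + r \<le> R\<close> R, of z v 1] by (simp add: u_def numeral_2_eq_2)
      have "indicator disc z *\<^sub>R (v z * (gx z + \<i> * gy z)) = of_real (- 6 / r\<^sup>2) * (indicator disc z *\<^sub>R (v z * of_real (bmp 2 r w z))) * (z - w)"
        unfolding eq by (simp add: numeral_2_eq_2)
      then show ?thesis unfolding e by simp
    qed
    have "0 = (\<integral>z. indicator disc z *\<^sub>R (v z * (gx z + \<i> * gy z)) \<partial>lborel)"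
      using v g by (simp add: weak_hol_def)
    then show ?thesis unfolding * by (simp only: integral_mult_right_zero) simp
  qed
  have "(G has_field_derivative D) (at w)"
  proof (rule has_field_derivative_quadratic[OF d, where M = "(125 / r^4 + 3 / r\<^sup>2) * (\<integral>z. cmod (u z) \<partial>lborel)"])
    fix h assume h: "cmod h < d"
    let ?E = "\<lambda>z. bmp 3 r (w + h) z - bmp 3 r w z - 3 * bmp 2 r w z * (2 * Re (cnj (z - w) * h) / r\<^sup>2)"
    have re: "of_real (2 * Re (cnj (z - w) * h)) = cnj (z - w) * h + (z - w) * cnj h" for z
      by (metis complex_add_cnj complex_cnj_cnj complex_cnj_mult)
    have pt: "u z * of_real (bmp 3 r (w + h) z) - u z * of_real (bmp 3 r w z) - h * (u z * of_real (3 / r\<^sup>2 * bmp 2 r w z) * cnj (z - w))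
       - cnj h * (u z * of_real (3 / r\<^sup>2 * bmp 2 r w z) * (z - w)) = u z * of_real (?E z)" for z
    proof -
      have "of_real (3 * bmp 2 r w z * (2 * Re (cnj (z - w) * h) / r\<^sup>2)) =
        complex_of_real (3 / r\<^sup>2 * bmp 2 r w z) * (cnj (z - w) * h + (z - w) * cnj h)"
        unfolding re[symmetric] of_real_mult[symmetric] by (simp add: field_simps)
      then have "complex_of_real (?E z) = of_real (bmp 3 r (w + h) z) - of_real (bmp 3 r w z)
          - of_real (3 / r\<^sup>2 * bmp 2 r w z) * (cnj (z - w) * h + (z - w) * cnj h)"
        by (simp only: of_real_diff)
      then show ?thesis by algebra
    qed
    have wd: "G w = (\<integral>z. u z * of_real (bmp 3 r w z) \<partial>lborel)" using G[of 0] d by simp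
    note i = bmp_mult_integrable[OF u, of 3 r]
    have int_E: "integrable lborel (\<lambda>z. u z * of_real (?E z))"
      using Bochner_Integration.integrable_diff[OF Bochner_Integration.integrable_diff[OF
        Bochner_Integration.integrable_diff[OF i[of "w + h"] i[of w]] integrable_mult_right[OF b1, of h]] integrable_mult_right[OF b2, of "cnj h"]]
      unfolding pt .
    have "G (w + h) - G w - h * D = (\<integral>z. u z * of_real (bmp 3 r (w + h) z) \<partial>lborel) - (\<integral>z. u z * of_real (bmp 3 r w z) \<partial>lborel)
       - (\<integral>z. h * (u z * of_real (3 / r\<^sup>2 * bmp 2 r w z) * cnj (z - w)) \<partial>lborel) - (\<integral>z. cnj h * (u z * of_real (3 / r\<^sup>2 * bmp 2 r w z) * (z - w)) \<partial>lborel)"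
      unfolding G[OF h] wd D_def integral_mult_right_zero zero by simp
    also have "\<dots> = (\<integral>z. u z * of_real (?E z) \<partial>lborel)"
      unfolding pt[symmetric] Bochner_Integration.integral_diff[OF Bochner_Integration.integrable_diff[OF
        Bochner_Integration.integrable_diff[OF i i] integrable_mult_right[OF b1]] integrable_mult_right[OF b2]]
        Bochner_Integration.integral_diff[OF Bochner_Integration.integrable_diff[OF i i] integrable_mult_right[OF b1]]
        Bochner_Integration.integral_diff[OF i i] ..
    finally have "cmod (G (w + h) - G w - h * D) = cmod (\<integral>z. u z * of_real (?E z) \<partial>lborel)"
      by (rule arg_cong)
    also have "\<dots> \<le> (\<integral>z. cmod (u z * of_real (?E z)) \<partial>lborel)" by (rule integral_norm_bound)
    also have "\<dots> \<le> (\<integral>z. cmod (u z) * ((125 / r^4 + 3 / r\<^sup>2) * (cmod h)\<^sup>2) \<partial>lborel)"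
    proof (rule integral_mono)
      show "integrable lborel (\<lambda>z. cmod (u z * of_real (?E z)))"
        by (rule integrable_norm[OF int_E])
      show "integrable lborel (\<lambda>z. cmod (u z) * ((125 / r^4 + 3 / r\<^sup>2) * (cmod h)\<^sup>2))"
        using u by (intro integrable_mult_left integrable_norm)
      fix z
      show "cmod (u z * of_real (?E z)) \<le> cmod (u z) * ((125 / r^4 + 3 / r\<^sup>2) * (cmod h)\<^sup>2)"
      proof (cases "z \<in> cball 0 R")
        case True
        then have "cmod (z - w) \<le> 2" using norm_triangle_ineq4[of z w] w R r by simp
        then have "\<bar>?E z\<bar> \<le> (125 / r^4 + 3 / r\<^sup>2) * (cmod h)\<^sup>2" using h d1 by (intro bmp_taylor r) auto
        then show ?thesis unfolding norm_mult norm_of_real by (intro mult_left_mono) auto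
      qed (simp add: u_def)
    qed
    also have "\<dots> = (125 / r^4 + 3 / r\<^sup>2) * (\<integral>z. cmod (u z) \<partial>lborel) * (cmod h)\<^sup>2"
      by (simp only: integral_mult_left_zero mult_ac)
    finally show "cmod (G (w + h) - G w - h * D) \<le> (125 / r^4 + 3 / r\<^sup>2) * (\<integral>z. cmod (u z) \<partial>lborel) * (cmod h)\<^sup>2" .
  qed
  then show "(\<lambda>w. \<integral>z. indicator disc z *\<^sub>R (v z * of_real (bmp 3 r w z)) \<partial>lborel) field_differentiable at w within ball 0 (1 - r)"
    unfolding G_def[abs_def] using field_differentiable_at_within field_differentiable_def by blast
qed

text \<open>The tests yield vanishing integrals over boxes, so the Lebesgue differentiation theorem applies.\<close>

lemma AE_zero_of_continuous_tests:
  fixes e :: "complex \<Rightarrow> complex"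
  assumes e: "integrable lborel e" and U: "open U"
    and test: "\<And>\<theta>::complex \<Rightarrow> real. continuous_on UNIV \<theta> \<Longrightarrow> (\<And>z. z \<notin> U \<Longrightarrow> \<theta> z = 0) \<Longrightarrow>
       (\<And>z. 0 \<le> \<theta> z \<and> \<theta> z \<le> 1) \<Longrightarrow> (\<integral>z. of_real (\<theta> z) * e z \<partial>lborel) = 0"
  shows "AE z in lborel. z \<in> U \<longrightarrow> e z = 0"
proof -
  have set_int: "set_integrable lborel (cbox a b) e" for a b
    unfolding set_integrable_def using e by (intro integrable_mult_indicator) auto
  have box0: "integral (cbox a b) e = 0" if sub: "cbox a b \<subseteq> U" and ne: "cbox a b \<noteq> {}" for a b
  proof -
    let ?B = "cbox a b"
    obtain d where d: "d > 0" "(\<Union>x\<in>?B. ball x d) \<subseteq> U"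
      using compact_subset_open_imp_ball_epsilon_subset[OF compact_cbox U sub] by blast
    \<comment> \<open>The slope is at least \<open>1 / d\<close>, so the function vanishes at
      distance \<open>d\<close> from the box and hence off \<open>U\<close>; as \<open>n\<close>
      grows it decreases to the indicator of the box.\<close>
    define \<theta> where "\<theta> n z = max 0 (1 - (1 / d + real n) * infdist z ?B)" for n z
    have \<theta>0: "\<theta> n z = 0" if "z \<notin> U" for n z
    proof -
      obtain x where x: "x \<in> ?B" "infdist z ?B = dist z x"
        using infdist_attains_inf[OF closed_cbox ne] by metis
      have "d \<le> infdist z ?B"
      proof (rule ccontr)
        assume "\<not> d \<le> infdist z ?B"
        then have "z \<in> ball x d" using x by (simp add: dist_commute)
        then show False using d x that by blast
      qed
      then have "1 / d * d \<le> (1 / d + real n) * infdist z ?B"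
        using d by (intro mult_mono) auto
      then show ?thesis using d by (simp add: \<theta>_def max_def)
    qed
    have \<theta>1: "0 \<le> \<theta> n z \<and> \<theta> n z \<le> 1" for n z
      using d infdist_nonneg[of z ?B] by (simp add: \<theta>_def)
    have \<theta>c: "continuous_on UNIV (\<theta> n)" for n
      unfolding \<theta>_def[abs_def] by (intro continuous_intros)
    have "(\<lambda>n. \<integral>z. of_real (\<theta> n z) * e z \<partial>lborel) \<longlonglongrightarrow> (\<integral>z. indicator ?B z *\<^sub>R e z \<partial>lborel)"
    proof (rule integral_dominated_convergence[where w="\<lambda>z. cmod (e z)"])
      show "AE z in lborel. (\<lambda>n. of_real (\<theta> n z) * e z) \<longlonglongrightarrow> indicator ?B z *\<^sub>R e z"
      proof (rule AE_I2)
        fix z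
        have "(\<lambda>n. \<theta> n z) \<longlonglongrightarrow> indicator ?B z"
        proof (cases "z \<in> ?B")
          case True then show ?thesis by (simp add: \<theta>_def)
        next
          case False
          then have p: "infdist z ?B > 0"
            using in_closed_iff_infdist_zero[OF closed_cbox ne] infdist_nonneg[of z ?B] by (metis less_eq_real_def)
          obtain N where N: "real N > 1 / infdist z ?B" using reals_Archimedean2 by blast
          have "\<theta> n z = 0" if "n \<ge> N" for n
          proof -
            have "1 \<le> real N * infdist z ?B" using N p by (simp add: field_simps)
            also have "\<dots> \<le> (1 / d + real n) * infdist z ?B" using that p d by (intro mult_right_mono) (auto intro: add_increasing)
            finally show ?thesis by (simp add: \<theta>_def)
          qed
          then have "\<forall>\<^sub>F n in sequentially. \<theta> n z = 0" by (auto simp: eventually_sequentially)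
          then show ?thesis using False by (simp add: tendsto_eventually)
        qed
        from tendsto_mult[OF tendsto_of_real[OF this] tendsto_const]
        show "(\<lambda>n. of_real (\<theta> n z) * e z) \<longlonglongrightarrow> indicator ?B z *\<^sub>R e z"
          by (simp add: scaleR_conv_of_real)
      qed
      show "AE z in lborel. norm (of_real (\<theta> n z) * e z) \<le> cmod (e z)" for n
        using \<theta>1 by (intro AE_I2) (simp add: norm_mult mult_left_le_one_le)
      show "integrable lborel (\<lambda>z. cmod (e z))" using e by (rule integrable_norm)
      show "(\<lambda>z. indicator ?B z *\<^sub>R e z) \<in> borel_measurable lborel" using e by measurable
      show "(\<lambda>z. of_real (\<theta> n z) * e z) \<in> borel_measurable lborel" for n
        using e borel_measurable_continuous_onI[OF \<theta>c[of n]] by measurable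
    qed
    then have "(\<integral>z. indicator ?B z *\<^sub>R e z \<partial>lborel) = 0"
      using test[OF \<theta>c \<theta>0 \<theta>1] LIMSEQ_unique[OF _ tendsto_const] by simp
    then show ?thesis
      using set_borel_integral_eq_integral(2)[OF set_int] by (simp add: set_lebesgue_integral_def)
  qed
  obtain N where N: "negligible N"
    "\<And>x \<epsilon>. \<lbrakk>x \<notin> N; 0 < \<epsilon>\<rbrakk> \<Longrightarrow> \<exists>d>0. \<forall>h. 0 < h \<and> h < d \<longrightarrow>
        norm (integral (cbox x (x + h *\<^sub>R One)) e /\<^sub>R h ^ DIM(complex) - e x) < \<epsilon>"
    using integrable_ccontinuous_explicit[OF set_borel_integral_eq_integral(1)[OF set_int]] by blast
  have "e z = 0" if z: "z \<notin> N" "z \<in> U" for z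
  proof (rule ccontr)
    assume "e z \<noteq> 0"
    then have "norm (e z) > 0" by simp
    from N(2)[OF z(1) this] obtain d where d: "d > 0"
      "\<And>h. 0 < h \<Longrightarrow> h < d \<Longrightarrow> norm (integral (cbox z (z + h *\<^sub>R One)) e /\<^sub>R h ^ DIM(complex) - e z) < norm (e z)"
      by blast
    obtain \<rho> where \<rho>: "\<rho> > 0" "ball z \<rho> \<subseteq> U" using U z(2) openE by blast
    \<comment> \<open>A point of the box differs from its corner by at most \<open>h\<close> in each
      coordinate, so \<open>2 * h < \<rho>\<close> keeps the box inside \<open>U\<close>.\<close>
    define h where "h = min d \<rho> / 3"
    have h: "0 < h" "h < d" "2 * h < \<rho>" using d(1) \<rho>(1) by (auto simp: h_def min_def)
    have One: "(One :: complex) = 1 + \<i>" by (simp add: Basis_complex_def)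
    have "cbox z (z + h *\<^sub>R One) \<subseteq> ball z \<rho>"
    proof
      fix y assume "y \<in> cbox z (z + h *\<^sub>R One)"
      then have "Re z \<le> Re y" "Re y \<le> Re z + h" "Im z \<le> Im y" "Im y \<le> Im z + h"
        unfolding One by (auto simp: in_cbox_complex_iff)
      then have "\<bar>Re (y - z)\<bar> + \<bar>Im (y - z)\<bar> \<le> 2 * h" by simp
      then show "y \<in> ball z \<rho>" using cmod_le[of "y - z"] h by (simp add: dist_norm norm_minus_commute)
    qed
    moreover have "z \<in> cbox z (z + h *\<^sub>R One)"
      unfolding One using h by (auto simp: in_cbox_complex_iff)
    ultimately have "integral (cbox z (z + h *\<^sub>R One)) e = 0"
      using \<rho>(2) by (intro box0) auto
    then show False using d(2)[OF h(1,2)] by simp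
  qed
  moreover have "AE z in lborel. z \<notin> N"
    using N(1) unfolding negligible_iff_null_sets using AE_not_in AE_completion_iff by blast
  ultimately show ?thesis by (auto elim!: eventually_mono)
qed

text \<open>The averages are independent of the exponent \<open>k\<close>. Paired with a continuous
  \<open>\<theta>\<close>, the average of \<open>v\<close> can be moved onto \<open>\<theta>\<close>
  by Fubini, since the bump is symmetric in its two points; letting \<open>k\<close> grow then
  recovers \<open>\<theta>\<close> and shows that \<open>v\<close> and \<open>g\<close> have the
  same pairings. The factor \<open>4 / (3 * bmp_mass r)\<close> normalises the bump of exponent 3.
  The radius \<open>1 - 2 * r\<close> leaves room for two enlargements by \<open>r\<close>.\<close>

lemma weak_hol_AE_local:
  fixes v g :: "complex \<Rightarrow> complex"
  assumes v: "weak_hol v" and r: "0 < r" "r < 1"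
    and g: "\<And>w. g w = 4 / (3 * bmp_mass r) * (\<integral>z. indicator disc z *\<^sub>R (v z * of_real (bmp 3 r w z)) \<partial>lborel)"
  shows "AE z in lborel. z \<in> ball 0 (1 - 2 * r) \<longrightarrow> v z = g z"
proof -
  define m where "m = bmp_mass r"
  have m: "m > 0" using bmp_mass_pos r by (simp add: m_def)
  define u where "u = (\<lambda>z. indicator (cball 0 (1 - r)) z *\<^sub>R v z)"
  have u: "integrable lborel u" using v r by (simp add: weak_hol_def u_def)
  let ?U = "ball (0::complex) (1 - 2 * r)"
  have gc: "continuous_on (ball 0 (1 - r)) g"
    unfolding g using holomorphic_on_imp_continuous_on[OF weak_hol_average_holomorphic[OF v r(1)]]
    by (intro continuous_intros)
  define g0 where "g0 z = indicator (cball 0 (1 - 2 * r)) z *\<^sub>R g z" for z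
  have g0: "integrable lborel g0"
    unfolding g0_def using r by (intro borel_integrable_compact continuous_on_subset[OF gc]) auto
  have avg: "complex_of_real (real k + 3) * (\<integral>z. u z * of_real (bmp (k + 2) r w z) \<partial>lborel) = 3 * m * g w"
    if "cmod w \<le> 1 - 2 * r" for w k
  proof -
    have R: "cmod w + r \<le> 1 - r" "1 - r < 1" using that r by auto
    have st: "complex_of_real (real k + 3) * (\<integral>z. u z * of_real (bmp (k + 2) r w z) \<partial>lborel) = 3 * (\<integral>z. u z * of_real (bmp 2 r w z) \<partial>lborel)" for k
      using weak_hol_bmp_step[OF v r(1) R, of k] by (simp only: u_def)
    have "(\<integral>z. indicator disc z *\<^sub>R (v z * of_real (bmp 3 r w z)) \<partial>lborel) = (\<integral>z. u z * of_real (bmp 3 r w z) \<partial>lborel)"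
      using disc_integral_bmp[OF r(1) R, of _ v 2] unfolding u_def by (simp only: eval_nat_numeral)
    then have "3 * m * g w = complex_of_real (real 1 + 3) * (\<integral>z. u z * of_real (bmp (1 + 2) r w z) \<partial>lborel)"
      using m by (simp add: g m_def numeral_3_eq_3)
    then show ?thesis using st[of k] st[of 1] by simp
  qed
  have "AE z in lborel. z \<in> ?U \<longrightarrow> u z - g0 z = 0"
  proof (rule AE_zero_of_continuous_tests)
    show "integrable lborel (\<lambda>z. u z - g0 z)" using u g0 by simp
    fix \<theta> :: "complex \<Rightarrow> real" assume \<theta>: "continuous_on UNIV \<theta>" "\<And>z. z \<notin> ?U \<Longrightarrow> \<theta> z = 0" "\<And>z. 0 \<le> \<theta> z \<and> \<theta> z \<le> 1"
    have \<theta>m [measurable]: "\<theta> \<in> borel_measurable borel"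
      using borel_measurable_continuous_onI[OF \<theta>(1)] by simp
    have um [measurable]: "u \<in> borel_measurable borel" using u by auto
    have \<theta>i: "integrable lborel (\<lambda>z. complex_of_real (\<theta> z))"
    proof -
      have "integrable lborel (\<lambda>z. indicator (cball 0 (1 - 2 * r)) z *\<^sub>R complex_of_real (\<theta> z))"
        by (intro borel_integrable_compact continuous_intros continuous_on_subset[OF \<theta>(1)]) auto
      moreover have "indicator (cball 0 (1 - 2 * r)) z *\<^sub>R complex_of_real (\<theta> z) = complex_of_real (\<theta> z)" for z
        using \<theta>(2)[of z] by (auto simp: indicator_def)
      ultimately show ?thesis by (simp only:)
    qed
    have iu: "integrable lborel (\<lambda>z. of_real (\<theta> z) * u z)" and ig: "integrable lborel (\<lambda>z. of_real (\<theta> z) * g0 z)"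
    proof -
      show "integrable lborel (\<lambda>z. of_real (\<theta> z) * u z)"
        by (rule Bochner_Integration.integrable_bound[OF u])
          (use \<theta>(3) in \<open>auto simp: norm_mult mult_left_le_one_le\<close>)
      show "integrable lborel (\<lambda>z. of_real (\<theta> z) * g0 z)"
        by (rule Bochner_Integration.integrable_bound[OF g0])
          (use \<theta>(3) g0 in \<open>auto simp: norm_mult mult_left_le_one_le\<close>)
    qed
    have bi: "integrable lborel (bmp (k + 2) r z)" for k z using bmp_integrable[OF r(1), of "Suc k"] by simp
    have bnd: "(real k + 3) * (\<integral>w. cmod (of_real (\<theta> w) * of_real (bmp (k + 2) r z w)) \<partial>lborel) \<le> 3 * m" for k z
    proof -
      have "(real k + 3) * (\<integral>w. cmod (of_real (\<theta> w) * of_real (bmp (k + 2) r z w)) \<partial>lborel) \<le> (real k + 3) * (\<integral>w. bmp (k + 2) r z w \<partial>lborel)"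
        by (intro mult_left_mono integral_mono integrable_norm bmp_mult_integrable \<theta>i bi)
          (use \<theta>(3) in \<open>auto simp: norm_mult mult_left_le_one_le\<close>)
      then show ?thesis unfolding bmp_integral_step[OF r] m_def .
    qed
    define F where "F k w z = complex_of_real (real k + 3) * of_real (\<theta> w) * (u z * of_real (bmp (k + 2) r w z))" for k w z
    \<comment> \<open>The left side does not involve \<open>k\<close>, while on the right
      \<open>k\<close> occurs only in averages of the continuous function
      \<open>\<theta>\<close>.\<close>
    have F: "(\<integral>w. 3 * m * (of_real (\<theta> w) * g0 w) \<partial>lborel) = (\<integral>z. u z * (complex_of_real (real k + 3) * (\<integral>w. of_real (\<theta> w) * of_real (bmp (k + 2) r z w) \<partial>lborel)) \<partial>lborel)" for k
    proof -
      have "(\<integral>w. 3 * m * (of_real (\<theta> w) * g0 w) \<partial>lborel) = (\<integral>w. (\<integral>z. F k w z \<partial>lborel) \<partial>lborel)"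
      proof (rule Bochner_Integration.integral_cong)
        fix w
        show "3 * m * (of_real (\<theta> w) * g0 w) = (\<integral>z. F k w z \<partial>lborel)"
        proof (cases "w \<in> ?U")
          case True
          then show ?thesis unfolding F_def integral_mult_right_zero g0_def using avg[of w k] by simp
        qed (simp add: F_def \<theta>(2))
      qed simp
      also have "\<dots> = (\<integral>z. (\<integral>w. F k w z \<partial>lborel) \<partial>lborel)"
      proof (rule lborel_pair.Fubini_integral)
        have meas: "case_prod (\<lambda>z w. F k w z) \<in> borel_measurable (lborel \<Otimes>\<^sub>M lborel)"
          unfolding F_def[abs_def] by measurable
        have "integrable (lborel \<Otimes>\<^sub>M lborel) (\<lambda>(z, w). F k w z)"
        proof (rule lborel_pair.Fubini_integrable)
          have F_eq: "F k w z = complex_of_real (real k + 3) * u z * (of_real (\<theta> w) * of_real (bmp (k + 2) r z w))" for w z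
            unfolding F_def bmp_commute[of _ r w z] by (simp add: mult_ac)
          show "AE z in lborel. integrable lborel (\<lambda>w. case (z, w) of (z, w) \<Rightarrow> F k w z)"
            unfolding F_eq prod.case by (intro AE_I2 integrable_mult_right bmp_mult_integrable \<theta>i)
          have nF: "(\<integral>w. norm (F k w z) \<partial>lborel) = cmod (u z) * ((real k + 3) * (\<integral>w. cmod (of_real (\<theta> w) * of_real (bmp (k + 2) r z w)) \<partial>lborel))" for z
            unfolding F_eq norm_mult[of "complex_of_real (real k + 3) * u z"] integral_mult_right_zero
            by (simp add: norm_mult del: of_real_add)
          show "integrable lborel (\<lambda>z. \<integral>w. norm (case (z, w) of (z, w) \<Rightarrow> F k w z) \<partial>lborel)"
            unfolding prod.case
          proof (rule Bochner_Integration.integrable_bound)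
            show "integrable lborel (\<lambda>z. cmod (u z) * (3 * m))"
              using u by (intro integrable_mult_left integrable_norm)
            show "(\<lambda>z. \<integral>w. norm (F k w z) \<partial>lborel) \<in> borel_measurable lborel"
              using meas by measurable
            show "AE z in lborel. norm (\<integral>w. norm (F k w z) \<partial>lborel) \<le> norm (cmod (u z) * (3 * m))"
            proof (rule AE_I2)
              fix z
              have "0 \<le> (\<integral>w. norm (F k w z) \<partial>lborel)" by (rule integral_nonneg_AE) auto
              moreover have "(\<integral>w. norm (F k w z) \<partial>lborel) \<le> cmod (u z) * (3 * m)"
                unfolding nF using bnd by (intro mult_left_mono) auto
              ultimately show "norm (\<integral>w. norm (F k w z) \<partial>lborel) \<le> norm (cmod (u z) * (3 * m))" by simp
            qed
          qed
        qed (rule meas)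
        then show "integrable (lborel \<Otimes>\<^sub>M lborel) (\<lambda>(z, w). F k w z)" .
      qed
      also have "\<dots> = (\<integral>z. u z * (complex_of_real (real k + 3) * (\<integral>w. of_real (\<theta> w) * of_real (bmp (k + 2) r z w) \<partial>lborel)) \<partial>lborel)"
      proof (rule Bochner_Integration.integral_cong)
        fix z
        have "F k w z = u z * (complex_of_real (real k + 3) * (of_real (\<theta> w) * of_real (bmp (k + 2) r z w)))" for w
          unfolding F_def bmp_commute[of _ r w z] by (simp add: mult_ac)
        then show "(\<integral>w. F k w z \<partial>lborel) = u z * (complex_of_real (real k + 3) * (\<integral>w. of_real (\<theta> w) * of_real (bmp (k + 2) r z w) \<partial>lborel))"
          by (simp only: integral_mult_right_zero)
      qed simp
      finally show ?thesis .
    qed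
    have "(\<lambda>k. \<integral>z. u z * (complex_of_real (real k + 3) * (\<integral>w. of_real (\<theta> w) * of_real (bmp (k + 2) r z w) \<partial>lborel)) \<partial>lborel)
       \<longlonglongrightarrow> (\<integral>z. u z * (3 * m * of_real (\<theta> z)) \<partial>lborel)"
    proof (rule integral_dominated_convergence[where w="\<lambda>z. cmod (u z) * (3 * m)"])
      show "integrable lborel (\<lambda>z. cmod (u z) * (3 * m))"
        using u by (intro integrable_mult_left integrable_norm)
      show "AE z in lborel. (\<lambda>k. u z * (complex_of_real (real k + 3) * (\<integral>w. of_real (\<theta> w) * of_real (bmp (k + 2) r z w) \<partial>lborel)))
         \<longlonglongrightarrow> u z * (3 * m * of_real (\<theta> z))"
      proof (rule AE_I2)
        fix z
        have "isCont (\<lambda>z. complex_of_real (\<theta> z)) z"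
          using \<theta>(1) by (simp add: continuous_on_eq_continuous_at)
        from tendsto_mult[OF tendsto_const bmp_approximate_identity[OF \<theta>i this r]]
        show "(\<lambda>k. u z * (complex_of_real (real k + 3) * (\<integral>w. of_real (\<theta> w) * of_real (bmp (k + 2) r z w) \<partial>lborel)))
         \<longlonglongrightarrow> u z * (3 * m * of_real (\<theta> z))" by (simp add: m_def)
      qed
      show "AE z in lborel. norm (u z * (complex_of_real (real k + 3) * (\<integral>w. of_real (\<theta> w) * of_real (bmp (k + 2) r z w) \<partial>lborel))) \<le> cmod (u z) * (3 * m)" for k
      proof (rule AE_I2)
        fix z
        have "(real k + 3) * cmod (\<integral>w. of_real (\<theta> w) * of_real (bmp (k + 2) r z w) \<partial>lborel)
          \<le> (real k + 3) * (\<integral>w. cmod (of_real (\<theta> w) * of_real (bmp (k + 2) r z w)) \<partial>lborel)"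
          by (intro mult_left_mono integral_norm_bound) auto
        also have "\<dots> \<le> 3 * m" by (rule bnd)
        finally have "(real k + 3) * cmod (\<integral>w. of_real (\<theta> w) * of_real (bmp (k + 2) r z w) \<partial>lborel) \<le> 3 * m" .
        from mult_left_mono[OF this norm_ge_zero[of "u z"]]
        show "norm (u z * (complex_of_real (real k + 3) * (\<integral>w. of_real (\<theta> w) * of_real (bmp (k + 2) r z w) \<partial>lborel))) \<le> cmod (u z) * (3 * m)"
          unfolding norm_mult norm_of_real by simp
      qed
      show "(\<lambda>z. u z * (3 * m * of_real (\<theta> z))) \<in> borel_measurable lborel" by measurable
      show "(\<lambda>z. u z * (complex_of_real (real k + 3) * (\<integral>w. of_real (\<theta> w) * of_real (bmp (k + 2) r z w) \<partial>lborel))) \<in> borel_measurable lborel" for k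
        by measurable
    qed
    then have "(\<integral>w. 3 * m * (of_real (\<theta> w) * g0 w) \<partial>lborel) = (\<integral>z. u z * (3 * m * of_real (\<theta> z)) \<partial>lborel)"
      unfolding F[symmetric] using LIMSEQ_unique[OF tendsto_const] by blast
    also have "(\<lambda>z. u z * (3 * m * of_real (\<theta> z))) = (\<lambda>z. 3 * m * (of_real (\<theta> z) * u z))" by (simp add: mult_ac)
    finally have "(\<integral>w. of_real (\<theta> w) * g0 w \<partial>lborel) = (\<integral>z. of_real (\<theta> z) * u z \<partial>lborel)"
      using m unfolding integral_mult_right_zero by simp
    then show "(\<integral>z. of_real (\<theta> z) * (u z - g0 z) \<partial>lborel) = 0"
      using iu ig by (simp add: right_diff_distrib)
  qed simp
  then show ?thesis
  proof eventually_elim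
    case (elim z)
    then show ?case using r by (auto simp: u_def g0_def)
  qed
qed

section \<open>Gluing the local representatives\<close>

lemma AE_eq_imp_eq_on_open:
  fixes f g :: "complex \<Rightarrow> complex"
  assumes "open S" "continuous_on S f" "continuous_on S g" "AE z in lborel. z \<in> S \<longrightarrow> f z = g z" "z \<in> S"
  shows "f z = g z"
proof (rule ccontr)
  assume ne: "f z \<noteq> g z"
  let ?D = "S \<inter> (\<lambda>z. f z - g z) -` (- {0})"
  have D: "open ?D"
    using assms(1-3) by (intro continuous_open_preimage continuous_intros) auto
  have "AE z in lborel. z \<notin> ?D" using assms(4) by eventually_elim auto
  then have "?D \<in> null_sets lborel" using D by (subst AE_iff_null_sets) auto
  then have "negligible ?D" unfolding negligible_iff_null_sets by (rule null_sets_completionI)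
  moreover have "?D \<noteq> {}" using ne assms(5) by auto
  ultimately show False using open_not_negligible[OF D] by blast
qed

text \<open>On the discs of radius \<open>1 - 2 * r n\<close>, which increase to the unit disc,
  \<open>v\<close> agrees almost everywhere with a holomorphic average. Two such averages are
  continuous and hence coincide on the smaller disc. The offset 3 makes the first disc
  nonempty.\<close>

lemma weyl_lemma:
  fixes v :: "complex \<Rightarrow> complex"
  assumes v: "weak_hol v"
  obtains g where "g holomorphic_on disc" "AE z in lborel. z \<in> disc \<longrightarrow> v z = g z"
proof -
  define r where "r n = 1 / (real n + 3)" for n :: nat
  have r: "0 < r n" "r n < 1" for n by (auto simp: r_def)
  define G where "G n w = 4 / (3 * bmp_mass (r n)) * (\<integral>z. indicator disc z *\<^sub>R (v z * of_real (bmp 3 (r n) w z)) \<partial>lborel)" for n w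
  define A where "A n = ball (0::complex) (1 - 2 * r n)" for n
  have AE: "AE z in lborel. z \<in> A n \<longrightarrow> v z = G n z" for n
    unfolding A_def by (rule weak_hol_AE_local[OF v r[of n] G_def])
  have hol: "G n holomorphic_on A n" for n
  proof (rule holomorphic_on_subset)
    show "G n holomorphic_on ball 0 (1 - r n)"
      unfolding G_def by (intro holomorphic_intros weak_hol_average_holomorphic[OF v r(1)])
    show "A n \<subseteq> ball 0 (1 - r n)" using r[of n] unfolding A_def by (intro subset_ball) auto
  qed
  have mono: "A m \<subseteq> A n" if "m \<le> n" for m n
    unfolding A_def r_def using that by (intro subset_ball) (simp add: frac_le)
  have eq: "G m z = G n z" if "m \<le> n" "z \<in> A m" for m n z
  proof (rule AE_eq_imp_eq_on_open[where S="A m" and f="G m" and g="G n"])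
    show "AE z in lborel. z \<in> A m \<longrightarrow> G m z = G n z"
      using AE[of m] AE[of n] by eventually_elim (use mono[OF that(1)] in auto)
    show "continuous_on (A m) (G n)"
      using holomorphic_on_imp_continuous_on[OF hol[of n]] continuous_on_subset mono[OF that(1)] by blast
  qed (use that hol holomorphic_on_imp_continuous_on in \<open>auto simp: A_def\<close>)
  have un: "(\<Union>n. A n) = disc"
  proof
    show "(\<Union>n. A n) \<subseteq> disc" unfolding A_def disc_def using r(1) by (intro UN_least subset_ball) (simp add: less_imp_le)
    show "disc \<subseteq> (\<Union>n. A n)"
    proof
      fix z :: complex assume "z \<in> disc"
      then have p: "1 - cmod z > 0" by (simp add: disc_iff)
      obtain n where n: "real n > 2 / (1 - cmod z)" using reals_Archimedean2 by blast
      have "2 * r n = 2 / (real n + 3)" by (simp add: r_def)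
      also have "\<dots> < 1 - cmod z" using n p by (simp add: field_simps)
      finally show "z \<in> (\<Union>n. A n)" by (auto simp: A_def intro!: exI[of _ n])
    qed
  qed
  \<comment> \<open>The least index is a mere choice; by \<open>eq\<close> any other admissible
    index gives the same value.\<close>
  define g where "g z = G (LEAST n. z \<in> A n) z" for z
  have g: "g z = G n z" if "z \<in> A n" for z n
    unfolding g_def by (rule eq[OF Least_le[of "\<lambda>n. z \<in> A n", OF that] LeastI[of "\<lambda>n. z \<in> A n", OF that]])
  have "g holomorphic_on (\<Union>n. A n)"
    by (rule holomorphic_on_UN_open) (auto simp: A_def intro: holomorphic_transform[OF hol[unfolded A_def]] g[unfolded A_def, symmetric])
  moreover have "AE z in lborel. \<forall>n. z \<in> A n \<longrightarrow> v z = G n z"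
    using AE by (simp add: AE_all_countable)
  then have "AE z in lborel. z \<in> disc \<longrightarrow> v z = g z"
  proof eventually_elim
    case (elim z)
    then show ?case using g[of z] un by fastforce
  qed
  ultimately show ?thesis using that un by simp
qed

section \<open>The Bergman projection and the minimal solution\<close>

lemma sqi_mono_AE:
  assumes f: "f \<in> borel_measurable M" and g: "sqi M g" and le: "AE x in M. cmod (f x) \<le> cmod (g x)"
  shows "sqi M f" "nrm M f \<le> nrm M g"
proof -
  have le2: "AE x in M. (cmod (f x))\<^sup>2 \<le> (cmod (g x))\<^sup>2"
    using le by eventually_elim (intro power_mono, auto)
  show s: "sqi M f"
    unfolding sqi_def
  proof
    show "integrable M (\<lambda>x. (cmod (f x))\<^sup>2)"
      by (rule Bochner_Integration.integrable_bound[OF sqi_integrable[OF g]]) (use f le2 in auto)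
  qed (rule f)
  show "nrm M f \<le> nrm M g"
    unfolding nrm_def by (intro real_sqrt_le_mono integral_mono_AE sqi_integrable s g le2)
qed

text \<open>The projection theory uses \<open>p\<close> through its continuity; second derivatives
  enter through the dual estimate, which is passed in as a hypothesis.\<close>

locale disc_weight =
  fixes \<omega> :: "complex \<Rightarrow> real" and p :: "complex \<Rightarrow> real"
  assumes weight: "is_weight \<omega>"
    and p_cont: "continuous_on disc p"
    and \<omega>_exp: "\<And>z. z \<in> disc \<Longrightarrow> \<omega> z = exp (- p z)"
begin

text \<open>Isometry of the weighted space on the disc into the unweighted space on the plane, so
  that the general facts on square integrable functions apply with \<open>lborel\<close>.\<close>

definition wt :: "(complex \<Rightarrow> complex) \<Rightarrow> complex \<Rightarrow> complex" where
  "wt f z = indicator disc z *\<^sub>R (of_real (sqrt (\<omega> z)) * f z)"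

text \<open>With \<open>\<alpha> = exp p * cnj g\<close>, \<open>dstar gx gy\<close> is \<open>sqrt \<omega>\<close> times \<open>-2\<close> times the formal adjoint of
  \<open>\<bar>\<partial>\<close> applied to \<open>\<alpha>\<close>.\<close>

definition dstar :: "(complex \<Rightarrow> complex) \<Rightarrow> (complex \<Rightarrow> complex) \<Rightarrow> complex \<Rightarrow> complex" where
  "dstar gx gy z = indicator disc z *\<^sub>R (cnj (gx z + \<i> * gy z) / of_real (sqrt (\<omega> z)))"

lemma \<omega>_pos: "z \<in> disc \<Longrightarrow> \<omega> z > 0"
  by (simp add: \<omega>_exp)

lemma \<omega>_cont: "continuous_on disc \<omega>"
  by (subst continuous_on_cong[OF refl \<omega>_exp]) (auto intro!: continuous_intros p_cont)

lemma sqrt_\<omega>_cont: "continuous_on disc (\<lambda>z. complex_of_real (sqrt (\<omega> z)))"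
  by (intro continuous_intros \<omega>_cont)

lemma set_borel_measurable_continuous:
  fixes f :: "complex \<Rightarrow> complex"
  shows "continuous_on disc f \<Longrightarrow> set_borel_measurable lborel disc f"
  by (simp add: set_borel_measurable_def borel_measurable_continuous_on_indicator)

lemma wt_sq: "(cmod (wt f z))\<^sup>2 = indicator disc z *\<^sub>R (\<omega> z * (cmod (f z))\<^sup>2)"
  using \<omega>_pos[of z] by (auto simp: wt_def norm_mult power_mult_distrib indicator_def)

lemma wt_measurable:
  assumes "set_borel_measurable lborel disc f" shows "wt f \<in> borel_measurable lborel"
proof -
  have "(\<lambda>z. indicator disc z *\<^sub>R complex_of_real (sqrt (\<omega> z))) \<in> borel_measurable lborel"
    using set_borel_measurable_continuous[OF sqrt_\<omega>_cont] by (simp add: set_borel_measurable_def)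
  moreover have "(\<lambda>z. indicator disc z *\<^sub>R f z) \<in> borel_measurable lborel"
    using assms by (simp add: set_borel_measurable_def)
  ultimately have "(\<lambda>z. (indicator disc z *\<^sub>R complex_of_real (sqrt (\<omega> z))) * (indicator disc z *\<^sub>R f z)) \<in> borel_measurable lborel"
    by (rule borel_measurable_times)
  moreover have "(\<lambda>z. (indicator disc z *\<^sub>R complex_of_real (sqrt (\<omega> z))) * (indicator disc z *\<^sub>R f z)) = wt f"
    by (auto simp: fun_eq_iff wt_def indicator_def)
  ultimately show ?thesis by simp
qed

lemma L2w_iff: "f \<in> L2w \<omega> \<longleftrightarrow> set_borel_measurable lborel disc f \<and> sqi lborel (wt f)"
  using wt_measurable by (auto simp: L2w_def sqi_def wt_sq set_integrable_def)

lemma L2w_sqi: "f \<in> L2w \<omega> \<Longrightarrow> sqi lborel (wt f)"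
  by (simp add: L2w_iff)

lemma A2w_iff: "f \<in> A2w \<omega> \<longleftrightarrow> f holomorphic_on disc \<and> sqi lborel (wt f)"
  using set_borel_measurable_continuous[OF holomorphic_on_imp_continuous_on] by (auto simp: A2w_def L2w_iff)

lemma A2w_sqi: "f \<in> A2w \<omega> \<Longrightarrow> sqi lborel (wt f)" and A2w_hol: "f \<in> A2w \<omega> \<Longrightarrow> f holomorphic_on disc"
  by (auto simp: A2w_iff)

lemma A2w_L2w: "f \<in> A2w \<omega> \<Longrightarrow> f \<in> L2w \<omega>"
  by (simp add: A2w_def)

lemma wt_diff: "wt (\<lambda>z. f z - g z) = (\<lambda>z. wt f z - wt g z)"
  by (simp add: wt_def fun_eq_iff algebra_simps)

lemma wt_add: "wt (\<lambda>z. f z + g z) = (\<lambda>z. wt f z + wt g z)"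
  by (simp add: wt_def fun_eq_iff algebra_simps)

lemma wt_cmult: "wt (\<lambda>z. c * f z) = (\<lambda>z. c * wt f z)"
  by (simp add: wt_def fun_eq_iff)

lemma wnorm_eq: "wnorm \<omega> f = nrm lborel (wt f)"
  by (simp add: wnorm_def nrm_def wt_sq set_lebesgue_integral_def)

lemma wip_eq: "wip \<omega> f g = ip lborel (wt f) (wt g)"
proof -
  have "indicator disc z *\<^sub>R (f z * cnj (g z) * of_real (\<omega> z)) = wt f z * cnj (wt g z)" for z
  proof (cases "z \<in> disc")
    case True
    have "complex_of_real (sqrt (\<omega> z)) * of_real (sqrt (\<omega> z)) = of_real (\<omega> z)"
      using \<omega>_pos[OF True] by (simp flip: of_real_mult)
    then show ?thesis using True by (simp add: wt_def mult_ac)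
  qed (simp add: wt_def)
  then show ?thesis by (simp add: wip_def ip_def set_lebesgue_integral_def)
qed

lemma L2w_add: "f \<in> L2w \<omega> \<Longrightarrow> g \<in> L2w \<omega> \<Longrightarrow> (\<lambda>z. f z + g z) \<in> L2w \<omega>"
  by (auto simp: L2w_iff wt_add sqi_add set_borel_measurable_def scaleR_add_right)

lemma L2w_cmult: "f \<in> L2w \<omega> \<Longrightarrow> (\<lambda>z. c * f z) \<in> L2w \<omega>"
  using borel_measurable_times[OF borel_measurable_const[of c]]
  by (auto simp: L2w_iff wt_cmult sqi_cmult set_borel_measurable_def simp flip: mult_scaleR_right)

lemma A2w_diff: "f \<in> A2w \<omega> \<Longrightarrow> g \<in> A2w \<omega> \<Longrightarrow> (\<lambda>z. f z - g z) \<in> A2w \<omega>"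
  by (auto simp: A2w_iff wt_diff sqi_diff intro: holomorphic_intros)

lemma dstar_sqi:
  assumes "test_fun g gx gy" shows "sqi lborel (dstar gx gy)"
proof -
  obtain r where r: "r < 1" "\<And>z. r < cmod z \<Longrightarrow> g z = 0" "\<And>z. r < cmod z \<Longrightarrow> gx z = 0" "\<And>z. r < cmod z \<Longrightarrow> gy z = 0"
    and gc: "continuous_on UNIV g" "continuous_on UNIV gx" "continuous_on UNIV gy"
    using assms by (rule test_funE) blast
  note gc' = gc[THEN continuous_on_subset, OF subset_UNIV, of disc]
  have nz: "\<And>z. z \<in> disc \<Longrightarrow> complex_of_real (sqrt (\<omega> z)) \<noteq> 0" using \<omega>_pos by force
  have c: "continuous_on disc (\<lambda>z. cnj (gx z + \<i> * gy z) / of_real (sqrt (\<omega> z)))"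
    using nz by (intro continuous_intros gc' \<omega>_cont) auto
  have "integrable lborel (\<lambda>z. indicator disc z *\<^sub>R (cmod (cnj (gx z + \<i> * gy z) / of_real (sqrt (\<omega> z))))\<^sup>2)"
    by (rule integrable_disc_compact_support[OF _ r(1)]) (intro continuous_intros c, simp add: r)
  moreover have "(cmod (dstar gx gy z))\<^sup>2 = indicator disc z *\<^sub>R (cmod (cnj (gx z + \<i> * gy z) / of_real (sqrt (\<omega> z))))\<^sup>2" for z
    by (simp add: dstar_def indicator_def)
  moreover have "dstar gx gy \<in> borel_measurable lborel"
    using set_borel_measurable_continuous[OF c] by (simp add: set_borel_measurable_def dstar_def[abs_def])
  ultimately show ?thesis by (simp add: sqi_def)
qed

lemma norm_div_sqrt_\<omega>:
  assumes "z \<in> disc" shows "(cmod (a / of_real (sqrt (\<omega> z))))\<^sup>2 = exp (p z) * (cmod a)\<^sup>2"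
proof -
  have "(cmod (a / of_real (sqrt (\<omega> z))))\<^sup>2 = (cmod a)\<^sup>2 / \<omega> z"
    using \<omega>_pos[OF assms] by (simp add: norm_divide power_divide)
  then show ?thesis by (simp add: \<omega>_exp[OF assms] exp_minus divide_inverse mult.commute)
qed

lemma dstar_sq: "(cmod (dstar gx gy z))\<^sup>2 = indicator disc z *\<^sub>R (exp (p z) * (cmod (gx z + \<i> * gy z))\<^sup>2)"
proof (cases "z \<in> disc")
  case True
  then show ?thesis unfolding dstar_def using norm_div_sqrt_\<omega>[OF True, of "cnj (gx z + \<i> * gy z)"]
    by (simp only: complex_mod_cnj indicator_simps scaleR_one)
qed (simp add: dstar_def)

text \<open>The two square roots of the weight cancel: being orthogonal to every
  \<open>dstar gx gy\<close> means being weakly holomorphic.\<close>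

lemma ip_wt_dstar: "ip lborel (wt f) (dstar gx gy) = (\<integral>z. indicator disc z *\<^sub>R (f z * (gx z + \<i> * gy z)) \<partial>lborel)"
  unfolding ip_def
proof (rule Bochner_Integration.integral_cong)
  fix z
  show "wt f z * cnj (dstar gx gy z) = indicator disc z *\<^sub>R (f z * (gx z + \<i> * gy z))"
    using \<omega>_pos[of z] by (cases "z \<in> disc") (auto simp: wt_def dstar_def field_simps)
qed simp

lemma ip_A2w_dstar:
  assumes "h \<in> A2w \<omega>" "test_fun g gx gy" shows "ip lborel (wt h) (dstar gx gy) = 0"
  unfolding ip_wt_dstar using weak_hol_holomorphic[OF A2w_hol[OF assms(1)]] assms(2) by (simp add: weak_hol_def)

definition dstar_space :: "(complex \<Rightarrow> complex) set" where
  "dstar_space = {dstar gx gy | g gx gy. test_fun g gx gy}"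

text \<open>Pairing with this function turns a weighted L2 bound into an unweighted integral over a
  compact disc.\<close>

lemma inverse_weight_sqi:
  assumes "R < 1" shows "sqi lborel (\<lambda>z. indicator (cball 0 R) z *\<^sub>R complex_of_real (1 / sqrt (\<omega> z)))"
proof -
  have sub: "cball 0 R \<subseteq> disc" using assms by (auto simp: disc_iff)
  have c: "continuous_on (cball 0 R) (\<lambda>z. complex_of_real (1 / sqrt (\<omega> z)))"
    using \<omega>_pos sub by (intro continuous_intros continuous_on_subset[OF \<omega>_cont]) force+
  have "integrable lborel (\<lambda>z. indicator (cball 0 R) z *\<^sub>R (cmod (complex_of_real (1 / sqrt (\<omega> z))))\<^sup>2)"
    by (intro borel_integrable_compact continuous_intros c) auto
  moreover have "(cmod (indicator (cball 0 R) z *\<^sub>R complex_of_real (1 / sqrt (\<omega> z))))\<^sup>2 =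
     indicator (cball 0 R) z *\<^sub>R (cmod (complex_of_real (1 / sqrt (\<omega> z))))\<^sup>2" for z :: complex
    by (simp add: indicator_def)
  moreover have "(\<lambda>z. indicator (cball 0 R) z *\<^sub>R complex_of_real (1 / sqrt (\<omega> z))) \<in> borel_measurable lborel"
    using borel_integrable_compact[OF compact_cball c] by auto
  ultimately show ?thesis unfolding sqi_def by (simp only:)
qed

text \<open>The roles are reversed: the distance to \<open>dstar_space\<close> is minimised instead
  of the distance to the Bergman space. The remainder is orthogonal to all
  \<open>dstar gx gy\<close>, hence by Weyl's lemma it represents a Bergman function, and this
  function is the projection. The minimising sequence gives the approximation of
  \<open>F - g\<close> by \<open>dstar_space\<close> at the same time.\<close>

lemma projection_exists:
  assumes F: "F \<in> L2w \<omega>"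
  obtains g s where "g \<in> A2w \<omega>" "\<And>h. h \<in> A2w \<omega> \<Longrightarrow> wip \<omega> (\<lambda>z. F z - g z) h = 0"
    "\<And>n::nat. s n \<in> dstar_space" "(\<lambda>n. nrm lborel (\<lambda>z. (wt F z - wt g z) - s n z)) \<longlonglongrightarrow> 0"
proof -
  have add: "(\<lambda>z. s z + t z) \<in> dstar_space" if st: "s \<in> dstar_space" "t \<in> dstar_space" for s t
  proof -
    obtain g gx gy h hx hy where e: "s = dstar gx gy" "t = dstar hx hy" "test_fun g gx gy" "test_fun h hx hy"
      using st unfolding dstar_space_def by blast
    have "(\<lambda>z. s z + t z) = dstar (\<lambda>z. gx z + hx z) (\<lambda>z. gy z + hy z)"
    proof
      fix z show "s z + t z = dstar (\<lambda>z. gx z + hx z) (\<lambda>z. gy z + hy z) z"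
        by (cases "z \<in> disc") (simp_all add: e dstar_def add_divide_distrib diff_divide_distrib algebra_simps)
    qed
    then show ?thesis using test_fun_add[OF e(3,4)] unfolding dstar_space_def by blast
  qed
  have scale: "(\<lambda>z. c * s z) \<in> dstar_space" if s: "s \<in> dstar_space" for s c
  proof -
    obtain g gx gy where e: "s = dstar gx gy" "test_fun g gx gy"
      using s unfolding dstar_space_def by blast
    \<comment> \<open>\<open>dstar\<close> is conjugate linear in the test function, hence the
      factor \<open>cnj c\<close>.\<close>
    have "(\<lambda>z. c * s z) = dstar (\<lambda>z. cnj c * gx z) (\<lambda>z. cnj c * gy z)"
    proof
      fix z show "c * s z = dstar (\<lambda>z. cnj c * gx z) (\<lambda>z. cnj c * gy z) z"
        by (cases "z \<in> disc") (simp_all add: e dstar_def add_divide_distrib diff_divide_distrib algebra_simps)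
    qed
    then show ?thesis using test_fun_cmult[OF e(2), of "cnj c"] unfolding dstar_space_def by blast
  qed
  have sq: "\<And>s. s \<in> dstar_space \<Longrightarrow> sqi lborel s"
    using dstar_sqi by (auto simp: dstar_space_def)
  have ne: "dstar_space \<noteq> {}" using test_fun_0 by (auto simp: dstar_space_def)
  obtain v s where v: "sqi lborel v" and s: "\<And>n. s n \<in> dstar_space"
    and lim: "(\<lambda>n::nat. nrm lborel (\<lambda>z. (wt F z - v z) - s n z)) \<longlonglongrightarrow> 0"
    and orth: "\<And>t. t \<in> dstar_space \<Longrightarrow> ip lborel v t = 0"
    using L2_projection[OF L2w_sqi[OF F] sq ne add scale] by blast
  \<comment> \<open>Undoes \<open>wt\<close> on the disc, the only place where the tests look at
    \<open>V\<close>.\<close>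
  define V where "V z = v z / of_real (sqrt (\<omega> z))" for z
  have "weak_hol V"
    unfolding weak_hol_def
  proof (intro conjI allI impI)
    fix R :: real assume "R < 1"
    from sqi_mult_integrable[OF v inverse_weight_sqi[OF this]]
    show "integrable lborel (\<lambda>z. indicator (cball 0 R) z *\<^sub>R V z)"
      by (simp add: V_def field_simps)
  next
    fix g gx gy assume g: "test_fun g gx gy"
    have "ip lborel v (dstar gx gy) = 0" using orth g by (auto simp: dstar_space_def)
    also have "ip lborel v (dstar gx gy) = (\<integral>z. indicator disc z *\<^sub>R (V z * (gx z + \<i> * gy z)) \<partial>lborel)"
      unfolding ip_def by (rule Bochner_Integration.integral_cong) (auto simp: dstar_def V_def)
    finally show "(\<integral>z. indicator disc z *\<^sub>R (V z * (gx z + \<i> * gy z)) \<partial>lborel) = 0" .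
  qed
  then obtain g where g: "g holomorphic_on disc" and ae: "AE z in lborel. z \<in> disc \<longrightarrow> V z = g z"
    by (rule weyl_lemma)
  have ae': "AE z in lborel. z \<in> disc \<longrightarrow> wt g z = v z"
    using ae
  proof eventually_elim
    case (elim z)
    show ?case
    proof
      assume z: "z \<in> disc"
      then have "complex_of_real (sqrt (\<omega> z)) \<noteq> 0" using \<omega>_pos[of z] by simp
      moreover have "g z = v z / of_real (sqrt (\<omega> z))" using elim z by (simp add: V_def)
      ultimately show "wt g z = v z" using z by (simp add: wt_def)
    qed
  qed
  have wtg: "wt g \<in> borel_measurable lborel"
    using wt_measurable[OF set_borel_measurable_continuous[OF holomorphic_on_imp_continuous_on[OF g]]] .
  have "sqi lborel (wt g)"
    by (rule sqi_mono_AE(1)[OF wtg v]) (use ae' in \<open>eventually_elim, auto simp: wt_def indicator_def\<close>)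
  then have gA: "g \<in> A2w \<omega>" using g by (simp add: A2w_iff)
  have lim': "(\<lambda>n. nrm lborel (\<lambda>z. (wt F z - wt g z) - s n z)) \<longlonglongrightarrow> 0"
  proof (rule tendsto_sandwich[OF _ _ tendsto_const lim])
    have "nrm lborel (\<lambda>z. (wt F z - wt g z) - s n z) \<le> nrm lborel (\<lambda>z. (wt F z - v z) - s n z)" for n
    proof (rule sqi_mono_AE(2))
      show "(\<lambda>z. (wt F z - wt g z) - s n z) \<in> borel_measurable lborel"
        by (intro borel_measurable_diff wtg sqi_measurable[OF L2w_sqi[OF F]] sqi_measurable[OF sq[OF s]])
      show "sqi lborel (\<lambda>z. (wt F z - v z) - s n z)"
        by (intro sqi_diff L2w_sqi F v sq s)
      obtain gx gy where sn: "s n = dstar gx gy" using s[of n] unfolding dstar_space_def by blast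
      show "AE z in lborel. cmod ((wt F z - wt g z) - s n z) \<le> cmod ((wt F z - v z) - s n z)"
        using ae' by eventually_elim (auto simp: wt_def sn dstar_def indicator_def)
    qed
    then show "\<forall>\<^sub>F n in sequentially. nrm lborel (\<lambda>z. (wt F z - wt g z) - s n z) \<le> nrm lborel (\<lambda>z. (wt F z - v z) - s n z)"
      by simp
  qed simp
  have "wip \<omega> (\<lambda>z. F z - g z) h = 0" if h: "h \<in> A2w \<omega>" for h
  proof -
    have FG: "sqi lborel (\<lambda>z. wt F z - wt g z)" by (intro sqi_diff L2w_sqi F A2w_L2w gA)
    have "cmod (wip \<omega> (\<lambda>z. F z - g z) h) \<le> nrm lborel (\<lambda>z. (wt F z - wt g z) - s n z) * nrm lborel (wt h)" for n
    proof -
      obtain k gx gy where sn: "s n = dstar gx gy" "test_fun k gx gy" using s[of n] unfolding dstar_space_def by blast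
      have "ip lborel (s n) (wt h) = 0"
        using ip_A2w_dstar[OF h sn(2)] ip_cnj[of lborel "wt h" "s n"] by (simp add: sn)
      then have "wip \<omega> (\<lambda>z. F z - g z) h = ip lborel (\<lambda>z. (wt F z - wt g z) - s n z) (wt h)"
        unfolding wip_eq wt_diff using ip_diff_left[OF FG sq[OF s] A2w_sqi[OF h]] by simp
      then show ?thesis using cauchy_schwarz[OF sqi_diff[OF FG sq[OF s]] A2w_sqi[OF h]] by simp
    qed
    moreover have "(\<lambda>n. nrm lborel (\<lambda>z. (wt F z - wt g z) - s n z) * nrm lborel (wt h)) \<longlonglongrightarrow> 0 * nrm lborel (wt h)"
      by (intro tendsto_intros lim')
    ultimately have "cmod (wip \<omega> (\<lambda>z. F z - g z) h) \<le> 0 * nrm lborel (wt h)"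
      by (intro LIMSEQ_le_const) auto
    then show ?thesis by simp
  qed
  then show ?thesis using that gA s lim' by blast
qed

lemma Pw_projection:
  assumes F: "F \<in> L2w \<omega>"
  shows "Pw \<omega> F \<in> A2w \<omega>" "\<And>h. h \<in> A2w \<omega> \<Longrightarrow> wip \<omega> (\<lambda>z. F z - Pw \<omega> F z) h = 0"
proof -
  have "\<exists>g. g \<in> A2w \<omega> \<and> (\<forall>h\<in>A2w \<omega>. wip \<omega> (\<lambda>z. F z - g z) h = 0)"
    using projection_exists[OF F] by metis
  from someI_ex[OF this]
  show "Pw \<omega> F \<in> A2w \<omega>" "\<And>h. h \<in> A2w \<omega> \<Longrightarrow> wip \<omega> (\<lambda>z. F z - Pw \<omega> F z) h = 0"
    unfolding Pw_def by auto
qed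

text \<open>\<open>Pw\<close> is fixed by a choice operator, while the approximants belong to a
  particular projection. The two projections differ by a Bergman function orthogonal to itself,
  hence of norm zero.\<close>

lemma Pw_approx:
  assumes F: "F \<in> L2w \<omega>"
  obtains s where "\<And>n::nat. s n \<in> dstar_space"
    "(\<lambda>n. nrm lborel (\<lambda>z. wt (\<lambda>z. F z - Pw \<omega> F z) z - s n z)) \<longlonglongrightarrow> 0"
proof -
  obtain g s where g: "g \<in> A2w \<omega>" and orth: "\<And>h. h \<in> A2w \<omega> \<Longrightarrow> wip \<omega> (\<lambda>z. F z - g z) h = 0"
    and s: "\<And>n::nat. s n \<in> dstar_space" and lim: "(\<lambda>n. nrm lborel (\<lambda>z. (wt F z - wt g z) - s n z)) \<longlonglongrightarrow> 0"
    by (fact projection_exists[OF F])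
  note P = Pw_projection[OF F]
  define d where "d z = g z - Pw \<omega> F z" for z
  have d: "d \<in> A2w \<omega>" unfolding d_def[abs_def] using g P by (intro A2w_diff)
  have sF: "sqi lborel (wt F)" and sg: "sqi lborel (wt g)" and sP: "sqi lborel (wt (Pw \<omega> F))" and sd: "sqi lborel (wt d)"
    using F g P(1) d by (auto intro: L2w_sqi A2w_sqi)
  have "ip lborel (wt d) (wt d) = wip \<omega> (\<lambda>z. F z - Pw \<omega> F z) d - wip \<omega> (\<lambda>z. F z - g z) d"
  proof -
    have "wt d = (\<lambda>z. (wt F z - wt (Pw \<omega> F) z) - (wt F z - wt g z))"
      by (auto simp: d_def[abs_def] wt_diff)
    then show ?thesis unfolding wip_eq wt_diff
      using ip_diff_left[OF sqi_diff[OF sF sP] sqi_diff[OF sF sg] sd] by simp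
  qed
  then have "nrm lborel (wt d) = 0" using orth[OF d] P(2)[OF d] by (simp add: ip_self)
  have "(\<lambda>n. nrm lborel (\<lambda>z. wt (\<lambda>z. F z - Pw \<omega> F z) z - s n z)) \<longlonglongrightarrow> 0"
  proof (rule tendsto_sandwich[OF _ _ tendsto_const lim])
    have sn: "sqi lborel (s n)" for n using s[of n] dstar_sqi by (auto simp: dstar_space_def)
    have "nrm lborel (\<lambda>z. wt (\<lambda>z. F z - Pw \<omega> F z) z - s n z) = nrm lborel (\<lambda>z. ((wt F z - wt g z) - s n z) + wt d z)" for n
      by (rule nrm_cong_cmod) (simp add: wt_diff d_def[abs_def] algebra_simps)
    also have "\<dots> n \<le> nrm lborel (\<lambda>z. (wt F z - wt g z) - s n z) + nrm lborel (wt d)" for n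
      by (intro nrm_triangle sqi_diff sF sg sn sd)
    finally have "nrm lborel (\<lambda>z. wt (\<lambda>z. F z - Pw \<omega> F z) z - s n z) \<le> nrm lborel (\<lambda>z. (wt F z - wt g z) - s n z)" for n
      using \<open>nrm lborel (wt d) = 0\<close> by simp
    then show "\<forall>\<^sub>F n in sequentially. nrm lborel (\<lambda>z. wt (\<lambda>z. F z - Pw \<omega> F z) z - s n z) \<le> nrm lborel (\<lambda>z. (wt F z - wt g z) - s n z)"
      by simp
  qed simp
  then show ?thesis using that s by blast
qed

text \<open>The minimal solution \<open>u\<close> is a limit of elements \<open>dstar gx gy\<close>, so \<open>\<parallel>u\<parallel>\<^sup>2\<close> can be computed by
  integrating by parts against \<open>\<bar>\<partial> u = f \<bar>\<partial> b\<close>.\<close>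

lemma minimal_solution_bound:
  assumes est: "\<And>g gx gy. test_fun g gx gy \<Longrightarrow>
       (\<integral>z. indicator disc z *\<^sub>R (exp (p z) * (cmod (g z))\<^sup>2 * \<rho> z) \<partial>lborel)
       \<le> C * (\<integral>z. indicator disc z *\<^sub>R (exp (p z) * (cmod (gx z + \<i> * gy z))\<^sup>2) \<partial>lborel)"
    and C: "C \<ge> 0" and \<rho>: "continuous_on disc \<rho>"
    and f: "f \<in> A2w \<omega>" and bf: "(\<lambda>z. b z * f z) \<in> L2w \<omega>"
    and b: "has_pd 1 b bx disc" "has_pd \<i> b b_y disc" "continuous_on disc b" "continuous_on disc bx" "continuous_on disc b_y"
    and M: "M \<ge> 0" "\<And>z. z \<in> disc \<Longrightarrow> (cmod (bx z + \<i> * b_y z))\<^sup>2 \<le> M\<^sup>2 * \<rho> z"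
  shows "wnorm \<omega> (\<lambda>z. b z * f z - Pw \<omega> (\<lambda>z. b z * f z) z) \<le> M * sqrt C * wnorm \<omega> f"
proof -
  define F where "F = (\<lambda>z. b z * f z)"
  have F: "F \<in> L2w \<omega>" using bf by (simp add: F_def)
  note P = Pw_projection[OF F]
  define u where "u = wt (\<lambda>z. F z - Pw \<omega> F z)"
  define B where "B = M * sqrt C * nrm lborel (wt f)"
  have B: "B \<ge> 0" using M C by (simp add: B_def)
  have sF: "sqi lborel (wt F)" and sP: "sqi lborel (wt (Pw \<omega> F))" using F P(1) by (auto intro: L2w_sqi A2w_sqi)
  have u: "sqi lborel u" unfolding u_def wt_diff using sF sP by (rule sqi_diff)
  have hol: "f holomorphic_on disc" and sf: "sqi lborel (wt f)" using f by (auto simp: A2w_iff)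
  have fc: "continuous_on disc f" "continuous_on disc (deriv f)"
    using hol holomorphic_deriv[OF hol open_disc] by (auto intro: holomorphic_on_imp_continuous_on)
  \<comment> \<open>The projection drops out against \<open>dstar\<close>, an integration by parts
    moves \<open>dbar\<close> to \<open>b\<close>, and the factor \<open>g\<close> is left to the
    dual estimate.\<close>
  have key: "cmod (ip lborel u (dstar gx gy)) \<le> B * nrm lborel (dstar gx gy)" if g: "test_fun g gx gy" for g gx gy
  proof -
    obtain r where r: "r < 1" "\<And>z. r < cmod z \<Longrightarrow> g z = 0" and gc: "continuous_on UNIV g"
      using g by (rule test_funE) blast
    have gc': "continuous_on disc g" using gc by (rule continuous_on_subset) simp
    have "ip lborel u (dstar gx gy) = ip lborel (wt F) (dstar gx gy) - ip lborel (wt (Pw \<omega> F)) (dstar gx gy)"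
      unfolding u_def wt_diff using sF sP dstar_sqi[OF g] by (rule ip_diff_left)
    also have "\<dots> = (\<integral>z. indicator disc z *\<^sub>R (F z * (gx z + \<i> * gy z)) \<partial>lborel)"
      using ip_A2w_dstar[OF P(1) g] by (simp add: ip_wt_dstar)
    also have "\<dots> = - (\<integral>z. indicator disc z *\<^sub>R (((b z * (deriv f z * 1) + bx z * f z) + \<i> * (b z * (deriv f z * \<i>) + b_y z * f z)) * g z) \<partial>lborel)"
      unfolding F_def
      by (rule integral_test_fun_parts(3)[OF g has_pd_mult[OF b(1) has_pd_holomorphic[OF hol open_disc]] has_pd_mult[OF b(2) has_pd_holomorphic[OF hol open_disc]]])
        (intro continuous_intros b fc)+
    also have "\<dots> = - (\<integral>z. indicator disc z *\<^sub>R ((bx z + \<i> * b_y z) * f z * g z) \<partial>lborel)"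
    proof -
      have "((b z * (deriv f z * 1) + bx z * f z) + \<i> * (b z * (deriv f z * \<i>) + b_y z * f z)) * g z = (bx z + \<i> * b_y z) * f z * g z" for z
        by (simp add: algebra_simps)
      then show ?thesis by (simp only:)
    qed
    finally have e1: "ip lborel u (dstar gx gy) = - (\<integral>z. indicator disc z *\<^sub>R ((bx z + \<i> * b_y z) * f z * g z) \<partial>lborel)" .
    \<comment> \<open>The integrand has the modulus of \<open>wt f\<close> times \<open>Y\<close>;
      Cauchy-Schwarz then separates the norm of \<open>f\<close> from the quantity controlled by the
      dual estimate.\<close>
    define Y where "Y z = indicator disc z *\<^sub>R ((bx z + \<i> * b_y z) * g z / of_real (sqrt (\<omega> z)))" for z
    have nz: "\<And>z. z \<in> disc \<Longrightarrow> complex_of_real (sqrt (\<omega> z)) \<noteq> 0" using \<omega>_pos by force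
    have Yc: "continuous_on disc (\<lambda>z. (bx z + \<i> * b_y z) * g z / of_real (sqrt (\<omega> z)))"
      using nz by (intro continuous_intros gc' b \<omega>_cont) auto
    have Ysq: "(cmod (Y z))\<^sup>2 = indicator disc z *\<^sub>R (exp (p z) * (cmod (g z))\<^sup>2 * (cmod (bx z + \<i> * b_y z))\<^sup>2)" for z
    proof (cases "z \<in> disc")
      case True
      then show ?thesis unfolding Y_def using norm_div_sqrt_\<omega>[OF True, of "(bx z + \<i> * b_y z) * g z"]
        by (simp add: norm_mult power_mult_distrib mult_ac)
    qed (simp add: Y_def)
    have Yi: "integrable lborel (\<lambda>z. (cmod (Y z))\<^sup>2)"
      unfolding Ysq by (rule integrable_disc_compact_support[OF _ r(1)]) (intro continuous_intros p_cont gc' b, simp add: r)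
    have Y: "sqi lborel Y"
      using Yi set_borel_measurable_continuous[OF Yc] by (simp add: sqi_def set_borel_measurable_def Y_def[abs_def])
    have "(\<integral>z. (cmod (Y z))\<^sup>2 \<partial>lborel) \<le> (\<integral>z. M\<^sup>2 * (indicator disc z *\<^sub>R (exp (p z) * (cmod (g z))\<^sup>2 * \<rho> z)) \<partial>lborel)"
    proof (rule integral_mono[OF Yi])
      show "integrable lborel (\<lambda>z. M\<^sup>2 * (indicator disc z *\<^sub>R (exp (p z) * (cmod (g z))\<^sup>2 * \<rho> z)))"
        by (intro integrable_mult_right integrable_disc_compact_support[OF _ r(1)]) (intro continuous_intros p_cont gc' \<rho>, simp add: r)
      fix z
      show "(cmod (Y z))\<^sup>2 \<le> M\<^sup>2 * (indicator disc z *\<^sub>R (exp (p z) * (cmod (g z))\<^sup>2 * \<rho> z))"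
      proof (cases "z \<in> disc")
        case True
        have "exp (p z) * (cmod (g z))\<^sup>2 * (cmod (bx z + \<i> * b_y z))\<^sup>2 \<le> exp (p z) * (cmod (g z))\<^sup>2 * (M\<^sup>2 * \<rho> z)"
          using M(2)[OF True] by (intro mult_left_mono) auto
        then show ?thesis unfolding Ysq using True by (simp add: mult_ac)
      qed (simp add: Ysq)
    qed
    also have "\<dots> = M\<^sup>2 * (\<integral>z. indicator disc z *\<^sub>R (exp (p z) * (cmod (g z))\<^sup>2 * \<rho> z) \<partial>lborel)"
      by (rule integral_mult_right_zero)
    also have "\<dots> \<le> M\<^sup>2 * (C * (\<integral>z. indicator disc z *\<^sub>R (exp (p z) * (cmod (gx z + \<i> * gy z))\<^sup>2) \<partial>lborel))"
      by (intro mult_left_mono est[OF g]) auto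
    also have "\<dots> = (M * sqrt C * nrm lborel (dstar gx gy))\<^sup>2"
      using C by (simp add: power_mult_distrib nrm_power2 dstar_sq)
    finally have "(nrm lborel Y)\<^sup>2 \<le> (M * sqrt C * nrm lborel (dstar gx gy))\<^sup>2"
      unfolding nrm_power2[of lborel Y] .
    then have "nrm lborel Y \<le> M * sqrt C * nrm lborel (dstar gx gy)"
      by (rule power2_le_imp_le) (use M C in auto)
    have "cmod (ip lborel u (dstar gx gy)) \<le> (\<integral>z. cmod (indicator disc z *\<^sub>R ((bx z + \<i> * b_y z) * f z * g z)) \<partial>lborel)"
      unfolding e1 norm_minus_cancel by (rule integral_norm_bound)
    also have "\<dots> = (\<integral>z. cmod (wt f z) * cmod (Y z) \<partial>lborel)"
    proof (rule Bochner_Integration.integral_cong)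
      fix z
      show "cmod (indicator disc z *\<^sub>R ((bx z + \<i> * b_y z) * f z * g z)) = cmod (wt f z) * cmod (Y z)"
        using \<omega>_pos[of z] by (cases "z \<in> disc") (auto simp: wt_def Y_def norm_mult norm_divide)
    qed simp
    also have "\<dots> \<le> nrm lborel (wt f) * nrm lborel Y" by (rule cauchy_schwarz_abs[OF sf Y])
    also have "\<dots> \<le> nrm lborel (wt f) * (M * sqrt C * nrm lborel (dstar gx gy))"
      by (intro mult_left_mono \<open>nrm lborel Y \<le> _\<close>) auto
    finally show ?thesis by (simp add: B_def mult_ac)
  qed
  obtain s where s: "\<And>n::nat. s n \<in> dstar_space"
    and lim: "(\<lambda>n. nrm lborel (\<lambda>z. u z - s n z)) \<longlonglongrightarrow> 0"
    using Pw_approx[OF F] unfolding u_def by blast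
  have "(nrm lborel u)\<^sup>2 \<le> nrm lborel u * nrm lborel (\<lambda>z. u z - s n z) + B * (nrm lborel u + nrm lborel (\<lambda>z. u z - s n z))" for n
  proof -
    obtain g gx gy where sn: "s n = dstar gx gy" "test_fun g gx gy" using s[of n] unfolding dstar_space_def by blast
    have ss: "sqi lborel (s n)" using dstar_sqi[OF sn(2)] by (simp add: sn)
    have "ip lborel u u = ip lborel u (\<lambda>z. u z - s n z) + ip lborel u (s n)"
      using ip_diff_right[OF u ss u] by simp
    then have "(nrm lborel u)\<^sup>2 = cmod (ip lborel u (\<lambda>z. u z - s n z) + ip lborel u (s n))"
      unfolding ip_self by (metis norm_of_real abs_of_nonneg zero_le_power2)
    also have "\<dots> \<le> cmod (ip lborel u (\<lambda>z. u z - s n z)) + cmod (ip lborel u (s n))" by (rule norm_triangle_ineq)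
    also have "cmod (ip lborel u (\<lambda>z. u z - s n z)) \<le> nrm lborel u * nrm lborel (\<lambda>z. u z - s n z)"
      by (rule cauchy_schwarz[OF u sqi_diff[OF u ss]])
    also have "cmod (ip lborel u (s n)) \<le> B * nrm lborel (s n)" using key[OF sn(2)] by (simp add: sn)
    also have "B * nrm lborel (s n) \<le> B * (nrm lborel u + nrm lborel (\<lambda>z. u z - s n z))"
    proof (intro mult_left_mono B)
      have "nrm lborel (s n) = nrm lborel (\<lambda>z. u z - (u z - s n z))" by (rule nrm_cong_cmod) simp
      also have "\<dots> \<le> nrm lborel u + nrm lborel (\<lambda>z. u z - s n z)" by (rule nrm_triangle_diff[OF u sqi_diff[OF u ss]])
      finally show "nrm lborel (s n) \<le> nrm lborel u + nrm lborel (\<lambda>z. u z - s n z)" .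
    qed
    finally show ?thesis by simp
  qed
  moreover have "(\<lambda>n. nrm lborel u * nrm lborel (\<lambda>z. u z - s n z) + B * (nrm lborel u + nrm lborel (\<lambda>z. u z - s n z)))
     \<longlonglongrightarrow> nrm lborel u * 0 + B * (nrm lborel u + 0)"
    by (intro tendsto_intros lim)
  ultimately have "(nrm lborel u)\<^sup>2 \<le> nrm lborel u * 0 + B * (nrm lborel u + 0)"
    by (intro LIMSEQ_le_const) auto
  then have "nrm lborel u * nrm lborel u \<le> B * nrm lborel u" by (simp add: power2_eq_square)
  then have "nrm lborel u \<le> B" using B nrm_nonneg[of lborel u] by (cases "nrm lborel u = 0") auto
  then show ?thesis by (simp add: wnorm_eq u_def F_def B_def)
qed

end

section \<open>Regularised symbols\<close>

text \<open>With \<open>N\<close> the cutoff factor, \<open>dbar (cnj f * N) = cnj f' * N^2\<close>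
  and \<open>dbar (f * N) = - e * f^2 * cnj f' * N^2\<close>. Both have modulus at most
  \<open>|f'|\<close>, since \<open>N\<close> and \<open>e * |f|^2 * N\<close> are at most 1, and
  this holds uniformly in \<open>e\<close>. The second symbol is the conjugate of the first; it
  appears when multiplication by the symbol is moved across an inner product.\<close>

lemma cutoff_symbol:
  assumes f: "f holomorphic_on disc" and e: "e > 0"
  defines "N \<equiv> \<lambda>z. inverse (1 + e * (cmod (f z))\<^sup>2)"
  obtains bx b_y cx cy where
    "has_pd 1 (\<lambda>z. cnj (f z) * of_real (N z)) bx disc" "has_pd \<i> (\<lambda>z. cnj (f z) * of_real (N z)) b_y disc"
    "continuous_on disc bx" "continuous_on disc b_y"
    "\<And>z. z \<in> disc \<Longrightarrow> cmod (bx z + \<i> * b_y z) \<le> 2 * cmod (deriv f z)"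
    "has_pd 1 (\<lambda>z. f z * of_real (N z)) cx disc" "has_pd \<i> (\<lambda>z. f z * of_real (N z)) cy disc"
    "continuous_on disc cx" "continuous_on disc cy"
    "\<And>z. z \<in> disc \<Longrightarrow> cmod (cx z + \<i> * cy z) \<le> 2 * cmod (deriv f z)"
proof -
  have fc: "continuous_on disc f" "continuous_on disc (deriv f)"
    using f holomorphic_deriv[OF f open_disc] by (auto intro: holomorphic_on_imp_continuous_on)
  note fd = has_pd_holomorphic[OF f open_disc]
  have pos: "1 + e * (cmod (f z))\<^sup>2 > 0" for z using e by (simp add: add_pos_nonneg)
  have nz: "1 + e * (cmod (f z))\<^sup>2 \<noteq> 0" for z using pos[of z] by simp
  have Nc: "continuous_on disc N" unfolding N_def using nz by (intro continuous_intros fc) auto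
  define D where "D v z = - ((N z)\<^sup>2) * (e * (2 * Re (cnj (f z) * (deriv f z * v))))" for v z
  have Nd: "has_pd v N (D v) disc" for v
  proof -
    have "has_pd v (\<lambda>z. Re (f z) * Re (f z) + Im (f z) * Im (f z))
       (\<lambda>z. (Re (f z) * Re (deriv f z * v) + Re (deriv f z * v) * Re (f z)) + (Im (f z) * Im (deriv f z * v) + Im (deriv f z * v) * Im (f z))) disc"
      by (intro has_pd_add has_pd_mult has_pd_Re[OF fd] has_pd_Im[OF fd])
    moreover have "(\<lambda>z. Re (f z) * Re (f z) + Im (f z) * Im (f z)) = (\<lambda>z. (cmod (f z))\<^sup>2)"
      unfolding cmod_power2 by (simp add: power2_eq_square)
    ultimately have "has_pd v (\<lambda>z. (cmod (f z))\<^sup>2)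
       (\<lambda>z. (Re (f z) * Re (deriv f z * v) + Re (deriv f z * v) * Re (f z)) + (Im (f z) * Im (deriv f z * v) + Im (deriv f z * v) * Im (f z))) disc"
      by simp
    from has_pd_cong[OF this, of "\<lambda>z. 2 * Re (cnj (f z) * (deriv f z * v))"]
    have sq: "has_pd v (\<lambda>z. (cmod (f z))\<^sup>2) (\<lambda>z. 2 * Re (cnj (f z) * (deriv f z * v))) disc"
      by (simp add: algebra_simps)
    have "((\<lambda>x. inverse (1 + e * x)) has_real_derivative - ((inverse (1 + e * x))\<^sup>2) * e) (at x)" if "x \<in> (\<lambda>z. (cmod (f z))\<^sup>2) ` disc" for x
      using that nz by (auto intro!: derivative_eq_intros simp: power2_eq_square)
    from has_pd_real_chain[OF sq this] show ?thesis
      unfolding N_def D_def by (rule has_pd_cong) (simp_all add: mult.assoc)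
  qed
  have Dc: "continuous_on disc (D v)" for v
    unfolding D_def by (intro continuous_intros Nc fc)
  have DD: "of_real (D 1 z) + \<i> * of_real (D \<i> z) = - of_real ((N z)\<^sup>2 * e) * (2 * f z * cnj (deriv f z))" for z
    by (simp add: D_def complex_eq_iff algebra_simps)
  have N1: "0 < N z" "N z \<le> 1" "N z * (1 + e * (cmod (f z))\<^sup>2) = 1" for z
    using pos[of z] e left_inverse[OF nz[of z]] by (auto simp: N_def inverse_le_1_iff)
  have eN: "0 \<le> e * (cmod (f z))\<^sup>2 * N z" "e * (cmod (f z))\<^sup>2 * N z \<le> 1" for z
    using N1(1,3)[of z] e by (auto simp: algebra_simps)
  define bx b_y where "bx z = cnj (f z) * of_real (D 1 z) + cnj (deriv f z * 1) * of_real (N z)"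
    and "b_y z = cnj (f z) * of_real (D \<i> z) + cnj (deriv f z * \<i>) * of_real (N z)" for z
  define cx cy where "cx z = f z * of_real (D 1 z) + (deriv f z * 1) * of_real (N z)"
    and "cy z = f z * of_real (D \<i> z) + (deriv f z * \<i>) * of_real (N z)" for z
  show ?thesis
  proof (rule that)
    show "has_pd 1 (\<lambda>z. cnj (f z) * of_real (N z)) bx disc" "has_pd \<i> (\<lambda>z. cnj (f z) * of_real (N z)) b_y disc"
      unfolding bx_def[abs_def] b_y_def[abs_def] by (intro has_pd_mult has_pd_cnj fd has_pd_of_real Nd)+
    show "has_pd 1 (\<lambda>z. f z * of_real (N z)) cx disc" "has_pd \<i> (\<lambda>z. f z * of_real (N z)) cy disc"
      unfolding cx_def[abs_def] cy_def[abs_def] by (intro has_pd_mult fd has_pd_of_real Nd)+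
    show "continuous_on disc bx" "continuous_on disc b_y" "continuous_on disc cx" "continuous_on disc cy"
      unfolding bx_def[abs_def] b_y_def[abs_def] cx_def[abs_def] cy_def[abs_def]
      by (intro continuous_intros fc Dc Nc)+
    fix z
    have ff: "cnj (f z) * f z = of_real ((cmod (f z))\<^sup>2)"
      by (metis complex_norm_square mult.commute)
    have "bx z + \<i> * b_y z = cnj (f z) * (of_real (D 1 z) + \<i> * of_real (D \<i> z)) + 2 * cnj (deriv f z) * of_real (N z)"
      by (simp add: bx_def b_y_def algebra_simps)
    also have "\<dots> = 2 * cnj (deriv f z) * of_real (N z) * (1 - of_real (N z * e) * (cnj (f z) * f z))"
      unfolding DD by (simp add: algebra_simps power2_eq_square)
    also have "\<dots> = 2 * cnj (deriv f z) * of_real (N z * (1 - e * (cmod (f z))\<^sup>2 * N z))"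
      unfolding ff by (simp add: algebra_simps)
    finally have "cmod (bx z + \<i> * b_y z) = 2 * cmod (deriv f z) * \<bar>N z * (1 - e * (cmod (f z))\<^sup>2 * N z)\<bar>"
      by (simp add: norm_mult del: of_real_mult)
    also have "\<dots> \<le> 2 * cmod (deriv f z) * 1"
      using N1[of z] eN[of z] by (intro mult_left_mono) (auto simp: abs_mult intro!: mult_le_one)
    finally show "cmod (bx z + \<i> * b_y z) \<le> 2 * cmod (deriv f z)" by simp
    have "cx z + \<i> * cy z = f z * (of_real (D 1 z) + \<i> * of_real (D \<i> z))"
      by (simp add: cx_def cy_def algebra_simps)
    also have "\<dots> = - (2 * cnj (deriv f z) * (f z * f z) * of_real ((N z)\<^sup>2 * e))"
      unfolding DD by (simp add: algebra_simps)
    finally have "cmod (cx z + \<i> * cy z) = 2 * cmod (deriv f z) * (N z * (e * (cmod (f z))\<^sup>2 * N z))"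
      using e by (simp add: norm_mult power2_eq_square abs_mult)
    also have "\<dots> \<le> 2 * cmod (deriv f z) * 1"
      by (intro mult_left_mono mult_le_one[OF N1(2) eN]) auto
    finally show "cmod (cx z + \<i> * cy z) \<le> 2 * cmod (deriv f z)" by simp
  qed
qed

text \<open>\<open>3/4\<close> is the ratio of the total masses of \<open>bmp 3\<close> and
  \<open>bmp 2\<close>, read off from the recursion.\<close>

lemma weak_hol_mean_value_cube:
  fixes v :: "complex \<Rightarrow> complex"
  assumes v: "weak_hol v" "isCont v w" and r: "r > 0" "cmod w + r < 1"
  shows "(\<integral>z. indicator disc z *\<^sub>R (v z * of_real (bmp 3 r w z)) \<partial>lborel) = 3/4 * bmp_mass r * v w"
proof -
  define R where "R = cmod w + r"
  have R: "cmod w + r \<le> R" "R < 1" using r by (auto simp: R_def)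
  have 2: "indicator disc z *\<^sub>R (v z * of_real (bmp 2 r w z)) = (indicator (cball 0 R) z *\<^sub>R v z) * of_real (bmp 2 r w z)" for z
    using disc_integral_bmp[OF r(1) R, of z v 1] by (simp only: Suc_1)
  have 3: "indicator disc z *\<^sub>R (v z * of_real (bmp 3 r w z)) = (indicator (cball 0 R) z *\<^sub>R v z) * of_real (bmp 3 r w z)" for z
    using disc_integral_bmp[OF r(1) R, of z v 2] by (simp only: eval_nat_numeral)
  have "4 * (\<integral>z. indicator disc z *\<^sub>R (v z * of_real (bmp 3 r w z)) \<partial>lborel) = 3 * (\<integral>z. indicator disc z *\<^sub>R (v z * of_real (bmp 2 r w z)) \<partial>lborel)"
    unfolding 2 3 using weak_hol_bmp_step[OF v(1) r(1) R, of 1] by (simp add: numeral_3_eq_3)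
  then show ?thesis using weak_hol_mean_value[OF v r] by (simp add: mult_ac)
qed

lemma integral_holomorphic_dbar_bmp:
  assumes U: "open U" "cball w r \<subseteq> U" "U \<subseteq> disc" and q: "q holomorphic_on U" and r: "r > 0" "cmod w + r < 1"
  shows "integrable lborel (\<lambda>z. indicator U z *\<^sub>R (q z * (of_real (bmp 2 r w z) * (z - w))))"
    "(\<integral>z. indicator U z *\<^sub>R (q z * (of_real (bmp 2 r w z) * (z - w))) \<partial>lborel) = 0"
proof -
  have qc: "continuous_on U q" "continuous_on U (deriv q)"
    using q holomorphic_deriv[OF q U(1)] by (auto intro: holomorphic_on_imp_continuous_on)
  have b0: "bmp 3 r w z = 0" "bmp 2 r w z = 0" if "z \<notin> cball w r" for z
    using bmp_eq_0[OF r(1), of z w 2] bmp_eq_0[OF r(1), of z w 1] that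
    by (auto simp: dist_norm norm_minus_commute eval_nat_numeral)
  let ?W = "disc - cball w r"
  have W: "open ?W" by (intro open_Diff) auto
  have UW: "disc = U \<union> ?W" using U(2,3) by auto
  define V where "V z = (indicator U z *\<^sub>R q z) * of_real (bmp 3 r w z)" for z
  define sx sy where "sx z = (3 * bmp 2 r w z) * (- 2 / r\<^sup>2 * (Re z - Re w))" and "sy z = (3 * bmp 2 r w z) * (- 2 / r\<^sup>2 * (Im z - Im w))" for z
  define Vx Vy where "Vx z = (indicator U z *\<^sub>R q z) * of_real (sx z) + (indicator U z *\<^sub>R (deriv q z * 1)) * of_real (bmp 3 r w z)"
    and "Vy z = (indicator U z *\<^sub>R q z) * of_real (sy z) + (indicator U z *\<^sub>R (deriv q z * \<i>)) * of_real (bmp 3 r w z)" for z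
  have sd: "has_pd 1 (bmp 3 r w) sx UNIV" "has_pd \<i> (bmp 3 r w) sy UNIV"
    using has_pd_bmp[of 1 r w] unfolding sx_def[abs_def] sy_def[abs_def] by (simp_all add: eval_nat_numeral)
  have iq: "has_pd v (\<lambda>z. indicator U z *\<^sub>R q z) (\<lambda>z. indicator U z *\<^sub>R (deriv q z * v)) U" for v
    by (rule has_pd_cong[OF has_pd_transform[OF has_pd_holomorphic[OF q U(1)] U(1)]]) auto
  have z0: "has_pd v V (\<lambda>_. 0) ?W" for v
    by (rule has_pd_transform[OF has_pd_const[of v 0] W]) (simp add: V_def b0)
  have V1: "has_pd 1 V Vx disc" and V2: "has_pd \<i> V Vy disc"
  proof -
    have "has_pd 1 V Vx U" unfolding V_def[abs_def] Vx_def[abs_def]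
      by (intro has_pd_mult iq has_pd_of_real has_pd_subset[OF sd(1)]) auto
    moreover have "has_pd 1 V Vx ?W" by (rule has_pd_cong[OF z0]) (simp add: Vx_def sx_def b0)
    ultimately show "has_pd 1 V Vx disc" using UW unfolding has_pd_def by (metis UnE)
    have "has_pd \<i> V Vy U" unfolding V_def[abs_def] Vy_def[abs_def]
      by (intro has_pd_mult iq has_pd_of_real has_pd_subset[OF sd(2)]) auto
    moreover have "has_pd \<i> V Vy ?W" by (rule has_pd_cong[OF z0]) (simp add: Vy_def sy_def b0)
    ultimately show "has_pd \<i> V Vy disc" using UW unfolding has_pd_def by (metis UnE)
  qed
  have c: "continuous_on disc F" if "continuous_on U G" "\<And>z. z \<in> U \<Longrightarrow> F z = G z" "\<And>z. z \<in> ?W \<Longrightarrow> F z = 0" for F G :: "complex \<Rightarrow> complex"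
  proof -
    have "continuous_on U F" using that(1,2) by (subst continuous_on_cong[OF refl that(2)]) auto
    moreover have "continuous_on ?W F" by (subst continuous_on_cong[OF refl that(3)]) auto
    ultimately show ?thesis using continuous_on_open_Un[OF U(1) W] UW by simp
  qed
  have Vc: "continuous_on disc V"
    by (rule c[of "\<lambda>z. q z * of_real (bmp 3 r w z)"]) (auto intro!: continuous_intros qc continuous_bmp simp: V_def b0)
  have Vxc: "continuous_on disc Vx"
    by (rule c[of "\<lambda>z. q z * of_real (sx z) + deriv q z * of_real (bmp 3 r w z)"])
      (use r in \<open>auto intro!: continuous_intros qc continuous_bmp simp: Vx_def sx_def b0\<close>)
  have Vyc: "continuous_on disc Vy"
    by (rule c[of "\<lambda>z. q z * of_real (sy z) + deriv q z * \<i> * of_real (bmp 3 r w z)"])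
      (use r in \<open>auto intro!: continuous_intros qc continuous_bmp simp: Vy_def sy_def b0\<close>)
  have V0: "V z = 0" if "cmod w + r < cmod z" for z
    using that norm_triangle_ineq2[of z w] by (auto simp: V_def b0 dist_norm norm_minus_commute)
  have I: "integrable lborel (\<lambda>z. indicator disc z *\<^sub>R Vx z)" "(\<integral>z. indicator disc z *\<^sub>R Vx z \<partial>lborel) = 0"
    "integrable lborel (\<lambda>z. indicator disc z *\<^sub>R Vy z)" "(\<integral>z. indicator disc z *\<^sub>R Vy z \<partial>lborel) = 0"
    using integral_pd_eq_0[OF V1 Vc Vxc _ r(2) V0] integral_pd_eq_0[OF V2 Vc Vyc _ r(2) V0] by auto
  have e: "indicator U z *\<^sub>R (q z * (of_real (bmp 2 r w z) * (z - w))) =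
     of_real (- (r\<^sup>2) / 6) * (indicator disc z *\<^sub>R Vx z + \<i> * (indicator disc z *\<^sub>R Vy z))" for z
  proof (cases "z \<in> U")
    case True
    have "Vx z + \<i> * Vy z = q z * (of_real (sx z) + \<i> * of_real (sy z))"
      using True by (simp add: Vx_def Vy_def algebra_simps)
    also have "of_real (sx z) + \<i> * of_real (sy z) = of_real (3 * bmp 2 r w z * (- 2 / r\<^sup>2)) * (z - w)"
      by (simp only: sx_def sy_def complex_eq_iff) (simp add: mult.assoc)
    finally have "of_real (- (r\<^sup>2) / 6) * (Vx z + \<i> * Vy z) = (of_real (- (r\<^sup>2) / 6) * of_real (3 * bmp 2 r w z * (- 2 / r\<^sup>2))) * (q z * (z - w))"
      by (simp only: mult_ac)
    also have "of_real (- (r\<^sup>2) / 6) * of_real (3 * bmp 2 r w z * (- 2 / r\<^sup>2)) = complex_of_real (bmp 2 r w z)"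
      unfolding of_real_mult[symmetric] using r by (simp add: field_simps)
    finally show ?thesis using True U(3) by (auto simp: mult_ac)
  next
    case False
    then have "bmp 2 r w z = 0" "bmp 3 r w z = 0" using b0 U(2) by blast+
    then show ?thesis using False by (simp add: Vx_def Vy_def)
  qed
  show "integrable lborel (\<lambda>z. indicator U z *\<^sub>R (q z * (of_real (bmp 2 r w z) * (z - w))))"
    unfolding e using I by (intro integrable_mult_right Bochner_Integration.integrable_add) auto
  show "(\<integral>z. indicator U z *\<^sub>R (q z * (of_real (bmp 2 r w z) * (z - w))) \<partial>lborel) = 0"
    unfolding e integral_mult_right_zero
    using Bochner_Integration.integral_add[OF I(1) integrable_mult_right[OF I(3), of \<i>]] I
    by (simp only: integral_mult_right_zero) simp
qed

section \<open>Hankel operators\<close>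

lemma (in disc_weight) L2w_mult_bounded:
  assumes b: "continuous_on disc b" "\<And>z. z \<in> disc \<Longrightarrow> cmod (b z) \<le> B" and f: "f \<in> A2w \<omega>"
  shows "(\<lambda>z. b z * f z) \<in> L2w \<omega>"
  unfolding L2w_iff
proof
  show m: "set_borel_measurable lborel disc (\<lambda>z. b z * f z)"
    using b holomorphic_on_imp_continuous_on[OF A2w_hol[OF f]] by (intro set_borel_measurable_continuous continuous_intros)
  show "sqi lborel (wt (\<lambda>z. b z * f z))"
  proof (rule sqi_mono_AE(1)[OF wt_measurable[OF m] sqi_cmult[OF A2w_sqi[OF f], of "of_real B"]])
    have "cmod (wt (\<lambda>z. b z * f z) z) \<le> cmod (of_real B * wt f z)" for z
    proof (cases "z \<in> disc")
      case True
      then have "cmod (b z) \<le> \<bar>B\<bar>" using b(2)[OF True] by linarith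
      then have "cmod (b z) * cmod (wt f z) \<le> \<bar>B\<bar> * cmod (wt f z)" by (rule mult_right_mono) simp
      then show ?thesis using True by (simp add: wt_def norm_mult mult_ac)
    qed (simp add: wt_def)
    then show "AE z in lborel. cmod (wt (\<lambda>z. b z * f z) z) \<le> cmod (of_real B * wt f z)" by simp
  qed
qed

text \<open>Both alternatives of \<open>class_W_star\<close> enter through the same data: a density
  \<open>\<rho>\<close> comparable from below with \<open>1 / tau^2\<close>, and the dual estimate
  for it. From here on they need not be distinguished.\<close>

locale hankel_weight = disc_weight +
  fixes K :: "complex \<Rightarrow> complex \<Rightarrow> complex" and \<rho> :: "complex \<Rightarrow> real" and \<delta> C :: real
  assumes repr: "is_repr_kernel \<omega> K"
    and \<delta>_pos: "\<delta> > 0" and C_pos: "C > 0"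
    and \<rho>_cont: "continuous_on disc \<rho>"
    and \<rho>_tau: "\<And>z. z \<in> disc \<Longrightarrow> \<delta> \<le> (tau \<omega> K z)\<^sup>2 * \<rho> z"
    and dbar_estimate: "\<And>g gx gy. test_fun g gx gy \<Longrightarrow>
       (\<integral>z. indicator disc z *\<^sub>R (exp (p z) * (cmod (g z))\<^sup>2 * \<rho> z) \<partial>lborel)
       \<le> C * (\<integral>z. indicator disc z *\<^sub>R (exp (p z) * (cmod (gx z + \<i> * gy z))\<^sup>2) \<partial>lborel)"
begin

lemma kernel_A2w: "a \<in> disc \<Longrightarrow> (\<lambda>z. K z a) \<in> A2w \<omega>"
  using repr by (simp add: is_repr_kernel_def)

lemma reproducing: "f \<in> A2w \<omega> \<Longrightarrow> a \<in> disc \<Longrightarrow> f a = wip \<omega> f (\<lambda>z. K z a)"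
  using repr by (simp add: is_repr_kernel_def)

text \<open>Integrability of the weight puts the constant 1 into the Bergman space, and reproducing
  it at \<open>a\<close> forces the kernel to be nonzero.\<close>

lemma knorm_pos:
  assumes a: "a \<in> disc" shows "knorm \<omega> K a > 0"
proof -
  have "integrable lborel (\<lambda>z. (cmod (wt (\<lambda>_. 1) z))\<^sup>2)"
    using weight by (simp add: wt_sq is_weight_def set_integrable_def)
  moreover have "wt (\<lambda>_. 1) \<in> borel_measurable lborel"
    by (intro wt_measurable set_borel_measurable_continuous continuous_intros)
  ultimately have one: "(\<lambda>_. 1) \<in> A2w \<omega>" by (simp add: A2w_iff sqi_def)
  have "1 = cmod (wip \<omega> (\<lambda>_. 1) (\<lambda>z. K z a))" using reproducing[OF one a] by (metis norm_one)
  also have "\<dots> \<le> nrm lborel (wt (\<lambda>_. 1)) * knorm \<omega> K a"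
    unfolding wip_eq knorm_def wnorm_eq by (rule cauchy_schwarz[OF A2w_sqi[OF one] A2w_sqi[OF kernel_A2w[OF a]]])
  finally have "knorm \<omega> K a \<noteq> 0" by auto
  moreover have "knorm \<omega> K a \<ge> 0" by (simp add: knorm_def wnorm_eq)
  ultimately show ?thesis by simp
qed

lemma tau_pos: "a \<in> disc \<Longrightarrow> tau \<omega> K a > 0"
  using knorm_pos \<omega>_pos by (simp add: tau_def)

text \<open>The hypothesis bounds \<open>bx + \<i> * b_y\<close> by \<open>2 * S / tau\<close>, and
  \<open>1 / tau^2\<close> is at most \<open>\<rho> / \<delta>\<close>; this yields the factor
  \<open>2 / sqrt \<delta>\<close>, while \<open>sqrt C\<close> comes from the dual
  estimate.\<close>

lemma hankel_estimate:
  assumes f: "f \<in> A2w \<omega>" and bf: "(\<lambda>z. b z * f z) \<in> L2w \<omega>"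
    and b: "has_pd 1 b bx disc" "has_pd \<i> b b_y disc" "continuous_on disc b" "continuous_on disc bx" "continuous_on disc b_y"
    and S: "S \<ge> 0" "\<And>z. z \<in> disc \<Longrightarrow> tau \<omega> K z * cmod (bx z + \<i> * b_y z) \<le> 2 * S"
  shows "wnorm \<omega> (\<lambda>z. b z * f z - Pw \<omega> (\<lambda>z. b z * f z) z) \<le> 2 / sqrt \<delta> * sqrt C * S * wnorm \<omega> f"
proof -
  have "wnorm \<omega> (\<lambda>z. b z * f z - Pw \<omega> (\<lambda>z. b z * f z) z) \<le> (2 / sqrt \<delta> * S) * sqrt C * wnorm \<omega> f"
  proof (rule minimal_solution_bound[OF dbar_estimate less_imp_le[OF C_pos] \<rho>_cont f bf b])
    show "0 \<le> 2 / sqrt \<delta> * S" using S \<delta>_pos by simp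
    fix z assume z: "z \<in> disc"
    have "(tau \<omega> K z * cmod (bx z + \<i> * b_y z))\<^sup>2 \<le> (2 * S)\<^sup>2"
      using S(2)[OF z] tau_pos[OF z] by (intro power_mono) auto
    also have "\<dots> = (2 / sqrt \<delta> * S)\<^sup>2 * \<delta>" using \<delta>_pos by (simp add: power_mult_distrib power_divide)
    also have "\<dots> \<le> (2 / sqrt \<delta> * S)\<^sup>2 * ((tau \<omega> K z)\<^sup>2 * \<rho> z)" by (intro mult_left_mono \<rho>_tau z) auto
    finally have "(tau \<omega> K z)\<^sup>2 * (cmod (bx z + \<i> * b_y z))\<^sup>2 \<le> (tau \<omega> K z)\<^sup>2 * ((2 / sqrt \<delta> * S)\<^sup>2 * \<rho> z)"
      by (simp add: power_mult_distrib mult_ac)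
    then show "(cmod (bx z + \<i> * b_y z))\<^sup>2 \<le> (2 / sqrt \<delta> * S)\<^sup>2 * \<rho> z"
      using tau_pos[OF z] by (simp only: mult_le_cancel_left_pos zero_less_power)
  qed
  then show ?thesis by (simp add: mult_ac)
qed

text \<open>Membership in \<open>L\<^sup>2\<close> uses bounded symbols \<open>b = cnj \<phi> / (1 + e |\<phi>|\<^sup>2)\<close>. For \<open>h = P(b K\<^sub>a)\<close> one has
  \<open>\<parallel>h\<parallel>\<^sup>2 = |P(cnj b h) (a)|\<close>, and the evaluation at \<open>a\<close> only sees \<open>cnj b h\<close> near \<open>a\<close>, where
  \<open>|b| \<le> |\<phi>|\<close>, and the minimal solution \<open>cnj b h - P(cnj b h)\<close>; all bounds are uniform in \<open>e\<close>.\<close>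

lemma bloch_kernel_L2w:
  assumes \<phi>: "\<phi> holomorphic_on disc" and S: "S \<ge> 0" "\<And>z. z \<in> disc \<Longrightarrow> tau \<omega> K z * cmod (deriv \<phi> z) \<le> S"
    and a: "a \<in> disc"
  shows "(\<lambda>z. cnj (\<phi> z) * K z a) \<in> L2w \<omega>"
proof -
  define Q where "Q = 2 / sqrt \<delta> * sqrt C * S"
  have Q: "Q \<ge> 0" using S \<delta>_pos C_pos by (simp add: Q_def)
  define k where "k = (\<lambda>z. K z a)"
  have k: "k \<in> A2w \<omega>" using kernel_A2w[OF a] by (simp add: k_def)
  note sk = A2w_sqi[OF k]
  have \<phi>c: "continuous_on disc \<phi>" using \<phi> by (rule holomorphic_on_imp_continuous_on)
  define r where "r = (1 - cmod a) / 2"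
  have r: "r > 0" "cmod a + r < 1" using a by (auto simp: r_def disc_iff field_simps)
  define R where "R = cmod a + r"
  have R: "cmod a + r \<le> R" "R < 1" using r by (auto simp: R_def)
  define J where "J z = indicator (cball 0 R) z *\<^sub>R complex_of_real (1 / sqrt (\<omega> z))" for z
  have J: "sqi lborel J" unfolding J_def[abs_def] by (rule inverse_weight_sqi[OF R(2)])
  obtain A where A: "A \<ge> 0" "\<And>z. z \<in> cball 0 R \<Longrightarrow> cmod (\<phi> z) \<le> A"
  proof -
    have "compact (\<phi> ` cball 0 R)"
      using R by (intro compact_continuous_image continuous_on_subset[OF \<phi>c]) (auto simp: disc_iff)
    then obtain A where "\<And>z. z \<in> cball 0 R \<Longrightarrow> cmod (\<phi> z) \<le> A"
      by (meson compact_imp_bounded bounded_iff image_eqI)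
    then show ?thesis using that[of "max A 0"] by (meson max.cobounded1 max.cobounded2 order_trans)
  qed
  define m where "m = bmp_mass r"
  have m: "m > 0" using bmp_mass_pos[OF r(1)] by (simp add: m_def)
  \<comment> \<open>The bound for the projection of the regularised product: \<open>A\<close>
    accounts for the symbol near \<open>a\<close>, \<open>Q\<close> for the minimal solution, and
    \<open>nrm lborel J / m\<close> for point evaluation at \<open>a\<close>.\<close>
  define D where "D = (A + Q) * nrm lborel J / m"
  have D: "D \<ge> 0" using A Q m by (simp add: D_def)
  define b where "b n z = cnj (\<phi> z) * of_real (inverse (1 + inverse (real (Suc n)) * (cmod (\<phi> z))\<^sup>2))" for n z
  have bound: "(\<lambda>z. b n z * k z) \<in> L2w \<omega> \<and> nrm lborel (wt (\<lambda>z. b n z * k z)) \<le> D + Q * nrm lborel (wt k)" for n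
  proof -
    define e where "e = inverse (real (Suc n))"
    have e: "e > 0" by (simp add: e_def)
    define N where "N z = inverse (1 + e * (cmod (\<phi> z))\<^sup>2)" for z
    have N: "0 < N z" "N z \<le> 1" for z using e by (auto simp: N_def inverse_le_1_iff add_pos_nonneg)
    have bN: "b n = (\<lambda>z. cnj (\<phi> z) * of_real (N z))" by (simp add: b_def N_def e_def fun_eq_iff)
    obtain bx b_y cx cy where
      bd: "has_pd 1 (b n) bx disc" "has_pd \<i> (b n) b_y disc" "continuous_on disc bx" "continuous_on disc b_y"
        "\<And>z. z \<in> disc \<Longrightarrow> cmod (bx z + \<i> * b_y z) \<le> 2 * cmod (deriv \<phi> z)" and
      cd: "has_pd 1 (\<lambda>z. \<phi> z * of_real (N z)) cx disc" "has_pd \<i> (\<lambda>z. \<phi> z * of_real (N z)) cy disc"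
        "continuous_on disc cx" "continuous_on disc cy"
        "\<And>z. z \<in> disc \<Longrightarrow> cmod (cx z + \<i> * cy z) \<le> 2 * cmod (deriv \<phi> z)"
      using cutoff_symbol[OF \<phi> e] unfolding bN N_def by blast
    have S2: "tau \<omega> K z * cmod w \<le> 2 * S" if "cmod w \<le> 2 * cmod (deriv \<phi> z)" "z \<in> disc" for w z
    proof -
      have "tau \<omega> K z * cmod w \<le> tau \<omega> K z * (2 * cmod (deriv \<phi> z))"
        using that tau_pos[OF that(2)] by (intro mult_left_mono) auto
      then show ?thesis using S(2)[OF that(2)] by linarith
    qed
    define c where "c z = \<phi> z * of_real (N z)" for z
    have nz: "1 + e * (cmod (\<phi> z))\<^sup>2 \<noteq> 0" for z using e by (smt (verit) mult_nonneg_nonneg zero_le_power2)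
    have cc: "continuous_on disc c" unfolding c_def[abs_def] N_def using nz by (intro continuous_intros \<phi>c) auto
    have bc: "continuous_on disc (b n)" unfolding bN N_def using nz by (intro continuous_intros \<phi>c) auto
    have cb: "cmod (c z) = cmod (b n z)" "c z = cnj (b n z)" for z by (auto simp: c_def bN norm_mult)
    \<comment> \<open>A crude bound that depends on \<open>e\<close>; it only puts the regularised
      products into L2 and does not enter the uniform estimate.\<close>
    have c_le: "cmod (c z) \<le> 1 + 1 / e" for z
    proof (cases "cmod (\<phi> z) \<le> 1")
      case True
      then have "cmod (\<phi> z) * N z \<le> 1 * 1" using N[of z] by (intro mult_mono) auto
      then show ?thesis using N[of z] e by (simp add: c_def norm_mult add_increasing2)
    next
      case False
      then have le: "cmod (\<phi> z) * 1 \<le> cmod (\<phi> z) * cmod (\<phi> z)" by (intro mult_left_mono) auto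
      have "cmod (\<phi> z) * N z \<le> (cmod (\<phi> z))\<^sup>2 * N z" using mult_right_mono[OF le less_imp_le[OF N(1)[of z]]] by (simp add: power2_eq_square)
      also have "\<dots> \<le> 1 / e" using e nz[of z] N(1)[of z] by (simp add: N_def field_simps add_pos_nonneg)
      finally show ?thesis using N[of z] by (simp add: c_def norm_mult)
    qed
    have bk: "(\<lambda>z. b n z * k z) \<in> L2w \<omega>"
      using L2w_mult_bounded[OF bc _ k, of "1 + 1 / e"] c_le by (simp add: cb)
    define h where "h = Pw \<omega> (\<lambda>z. b n z * k z)"
    have h: "h \<in> A2w \<omega>" unfolding h_def by (rule Pw_projection(1)[OF bk])
    note sh = A2w_sqi[OF h]
    have ch: "(\<lambda>z. c z * h z) \<in> L2w \<omega>" by (rule L2w_mult_bounded[OF cc c_le h])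
    define q where "q = Pw \<omega> (\<lambda>z. c z * h z)"
    have q: "q \<in> A2w \<omega>" unfolding q_def by (rule Pw_projection(1)[OF ch])
    define u where "u z = c z * h z - q z" for z
    have su: "sqi lborel (wt u)" unfolding u_def[abs_def] wt_diff by (intro sqi_diff L2w_sqi[OF ch] A2w_sqi[OF q])
    have u_le: "nrm lborel (wt u) \<le> Q * nrm lborel (wt h)"
      using hankel_estimate[OF h ch[unfolded c_def] cd(1,2) cc[unfolded c_def] cd(3,4) S(1) S2[OF cd(5)]]
      by (simp add: wnorm_eq u_def[abs_def] q_def c_def Q_def)
    have v_le: "nrm lborel (wt (\<lambda>z. b n z * k z - h z)) \<le> Q * nrm lborel (wt k)"
      using hankel_estimate[OF k bk bd(1,2) bc bd(3,4) S(1) S2[OF bd(5)]]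
      by (simp add: wnorm_eq h_def Q_def)
    have sbk: "sqi lborel (wt (\<lambda>z. b n z * k z))" by (rule L2w_sqi[OF bk])
    have sch: "sqi lborel (wt (\<lambda>z. c z * h z))" by (rule L2w_sqi[OF ch])
    have norm_h: "of_real ((nrm lborel (wt h))\<^sup>2) = cnj (q a)"
    proof -
      have "0 = wip \<omega> (\<lambda>z. b n z * k z - h z) h" unfolding h_def using Pw_projection(2)[OF bk h] by (simp add: h_def)
      also have "\<dots> = wip \<omega> (\<lambda>z. b n z * k z) h - wip \<omega> h h"
        unfolding wip_eq wt_diff by (rule ip_diff_left[OF sbk sh sh])
      finally have "of_real ((nrm lborel (wt h))\<^sup>2) = wip \<omega> (\<lambda>z. b n z * k z) h" by (simp add: wip_eq ip_self)
      also have "\<dots> = wip \<omega> k (\<lambda>z. c z * h z)"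
        unfolding wip_def set_lebesgue_integral_def by (rule Bochner_Integration.integral_cong) (simp_all add: cb(2))
      also have "\<dots> = cnj (wip \<omega> (\<lambda>z. c z * h z) k)" unfolding wip_eq by (rule ip_cnj[symmetric])
      also have "wip \<omega> (\<lambda>z. c z * h z) k = wip \<omega> u k + wip \<omega> q k"
        unfolding wip_eq u_def[abs_def] wt_diff using ip_diff_left[OF sch A2w_sqi[OF q] sk] by simp
      also have "wip \<omega> u k = 0" unfolding u_def[abs_def] q_def by (rule Pw_projection(2)[OF ch k])
      also have "wip \<omega> q k = q a" unfolding k_def by (rule reproducing[OF q a, symmetric])
      finally show ?thesis by simp
    qed
    \<comment> \<open>The mean value property replaces evaluation at \<open>a\<close> by an integral
      over a compact disc. There \<open>q = c * h - u\<close>, where \<open>c\<close> is bounded by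
      \<open>A\<close> and the norm of \<open>u\<close> by \<open>Q\<close> times that of
      \<open>h\<close>; \<open>J\<close> converts both terms to weighted norms. The right side is
      linear in the norm of \<open>h\<close>, while \<open>|q a|\<close> is its square.\<close>
    have qa: "m * cmod (q a) \<le> (A + Q) * nrm lborel J * nrm lborel (wt h)"
    proof -
      have qw: "weak_hol q" "isCont q a"
        using weak_hol_holomorphic[OF A2w_hol[OF q]] holomorphic_on_imp_continuous_on[OF A2w_hol[OF q]] a
          continuous_on_eq_continuous_at[OF open_disc] by auto
      have int1: "integrable lborel (\<lambda>z. A * (cmod (wt h z) * cmod (J z)) + cmod (wt u z) * cmod (J z))"
        by (intro Bochner_Integration.integrable_add integrable_mult_right sqi_abs_mult_integrable sh su J)
      have "integrable lborel (\<lambda>z. indicator (cball 0 R) z *\<^sub>R q z)"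
        using qw(1) R by (simp add: weak_hol_def)
      then have int0: "integrable lborel (\<lambda>z. indicator disc z *\<^sub>R (q z * of_real (bmp 2 r a z)))"
        unfolding disc_integral_bmp[OF r(1) R, of _ _ 1, unfolded Suc_1] by (rule bmp_mult_integrable)
      have pt: "cmod (indicator disc z *\<^sub>R (q z * of_real (bmp 2 r a z))) \<le> A * (cmod (wt h z) * cmod (J z)) + cmod (wt u z) * cmod (J z)" for z
      proof (cases "z \<in> cball 0 R")
        case True
        then have z: "z \<in> disc" using R by (simp add: disc_iff)
        have J1: "cmod (wt f z) * cmod (J z) = cmod (f z)" for f
          using z True \<omega>_pos[OF z] by (simp add: wt_def J_def norm_mult norm_divide)
        have "cmod (q z * of_real (bmp 2 r a z)) \<le> cmod (q z)"
          using bmp_le_1[of 2 r a z] by (simp add: norm_mult mult_left_le)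
        also have "cmod (q z) = cmod (c z * h z - u z)" by (simp add: u_def)
        also have "cmod (c z * h z - u z) \<le> cmod (c z) * cmod (h z) + cmod (u z)"
          by (metis norm_mult norm_triangle_ineq4)
        also have "cmod (c z) * cmod (h z) \<le> A * cmod (h z)"
        proof (rule mult_right_mono)
          have "cmod (c z) \<le> cmod (\<phi> z)" using N[of z] by (simp add: c_def norm_mult mult_left_le)
          then show "cmod (c z) \<le> A" using A(2)[OF True] by linarith
        qed simp
        finally show ?thesis unfolding J1 using z by simp
      next
        case False
        then have "r \<le> cmod (z - a)" using norm_triangle_ineq2[of z a] by (simp add: R_def)
        then have "bmp 2 r a z = 0" using bmp_eq_0[OF r(1), of z a 1] by (simp add: numeral_2_eq_2)
        then show ?thesis using A by simp
      qed
      have "m * cmod (q a) = cmod (\<integral>z. indicator disc z *\<^sub>R (q z * of_real (bmp 2 r a z)) \<partial>lborel)"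
        unfolding weak_hol_mean_value[OF qw r] using m by (simp add: norm_mult m_def)
      also have "\<dots> \<le> (\<integral>z. A * (cmod (wt h z) * cmod (J z)) + cmod (wt u z) * cmod (J z) \<partial>lborel)"
        by (rule Bochner_Integration.integral_norm_bound_integral[OF int0 int1 pt])
      also have "\<dots> = A * (\<integral>z. cmod (wt h z) * cmod (J z) \<partial>lborel) + (\<integral>z. cmod (wt u z) * cmod (J z) \<partial>lborel)"
        using sqi_abs_mult_integrable[OF sh J] sqi_abs_mult_integrable[OF su J] by simp
      also have "\<dots> \<le> A * (nrm lborel (wt h) * nrm lborel J) + nrm lborel (wt u) * nrm lborel J"
        by (intro add_mono mult_left_mono cauchy_schwarz_abs sh su J A)
      also have "\<dots> \<le> A * (nrm lborel (wt h) * nrm lborel J) + (Q * nrm lborel (wt h)) * nrm lborel J"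
        by (intro add_left_mono mult_right_mono u_le) auto
      also have "\<dots> = (A + Q) * nrm lborel J * nrm lborel (wt h)" by (simp add: algebra_simps)
      finally show ?thesis .
    qed
    have "(nrm lborel (wt h))\<^sup>2 = cmod (q a)"
      using arg_cong[OF norm_h, of cmod] by (simp del: of_real_power)
    then have "nrm lborel (wt h) * nrm lborel (wt h) \<le> D * nrm lborel (wt h)"
      using qa m by (simp add: D_def power2_eq_square field_simps)
    then have h_le: "nrm lborel (wt h) \<le> D"
      using D nrm_nonneg[of lborel "wt h"] by (cases "nrm lborel (wt h) = 0") auto
    have "nrm lborel (wt (\<lambda>z. b n z * k z)) = nrm lborel (\<lambda>z. wt h z + wt (\<lambda>z. b n z * k z - h z) z)"
      by (rule nrm_cong_cmod) (simp add: wt_diff)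
    also have "\<dots> \<le> nrm lborel (wt h) + nrm lborel (wt (\<lambda>z. b n z * k z - h z))"
      unfolding wt_diff by (intro nrm_triangle sh sqi_diff sbk)
    finally show ?thesis using bk h_le v_le by linarith
  qed
  have m: "set_borel_measurable lborel disc (\<lambda>z. cnj (\<phi> z) * k z)"
    using \<phi>c holomorphic_on_imp_continuous_on[OF A2w_hol[OF k]] by (intro set_borel_measurable_continuous continuous_intros)
  have "sqi lborel (wt (\<lambda>z. cnj (\<phi> z) * k z))"
  proof (rule sqi_fatou(1))
    show "sqi lborel (wt (\<lambda>z. b n z * k z))" for n using bound[of n] by (intro L2w_sqi) auto
    show "wt (\<lambda>z. cnj (\<phi> z) * k z) \<in> borel_measurable lborel" by (rule wt_measurable[OF m])
    show "\<forall>\<^sub>F n in sequentially. nrm lborel (wt (\<lambda>z. b n z * k z)) \<le> D + Q * nrm lborel (wt k)" using bound by simp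
    show "AE z in lborel. (\<lambda>n. wt (\<lambda>z. b n z * k z) z) \<longlonglongrightarrow> wt (\<lambda>z. cnj (\<phi> z) * k z) z"
    proof (rule AE_I2)
      fix z
      have "(\<lambda>n. b n z) \<longlonglongrightarrow> cnj (\<phi> z) * of_real (inverse (1 + 0 * (cmod (\<phi> z))\<^sup>2))"
        unfolding b_def by (intro tendsto_intros LIMSEQ_inverse_real_of_nat) auto
      then have l: "(\<lambda>n. b n z) \<longlonglongrightarrow> cnj (\<phi> z)" by simp
      show "(\<lambda>n. wt (\<lambda>z. b n z * k z) z) \<longlonglongrightarrow> wt (\<lambda>z. cnj (\<phi> z) * k z) z"
        unfolding wt_def by (intro tendsto_intros l)
    qed
  qed
  then show ?thesis using m by (simp add: L2w_iff k_def)
qed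

section \<open>From kernels to their span: the upper and the lower bound\<close>

lemma kspan_A2w: "f \<in> kspan K \<Longrightarrow> f \<in> A2w \<omega>"
proof -
  assume "f \<in> kspan K"
  then obtain n :: nat and c a where a: "\<And>i. i < n \<Longrightarrow> a i \<in> disc" and f: "f = (\<lambda>z. \<Sum>i<n. c i * K z (a i))"
    unfolding kspan_def by blast
  have "(\<lambda>z. \<Sum>i<n. c i * K z (a i)) \<in> A2w \<omega>" using a
  proof (induction n)
    case 0
    have "wt (\<lambda>_. 0) = (\<lambda>_. 0)" by (simp add: wt_def fun_eq_iff)
    then show ?case by (simp add: A2w_iff)
  next
    case (Suc n)
    then have 1: "(\<lambda>z. \<Sum>i<n. c i * K z (a i)) \<in> A2w \<omega>" and 2: "(\<lambda>z. K z (a n)) \<in> A2w \<omega>"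
      using kernel_A2w by auto
    then show ?case by (auto simp: A2w_iff wt_add wt_cmult intro!: sqi_add sqi_cmult holomorphic_intros)
  qed
  then show ?thesis by (simp add: f)
qed

lemma kspan_mult_L2w:
  assumes k: "\<And>a. a \<in> disc \<Longrightarrow> (\<lambda>z. g z * K z a) \<in> L2w \<omega>" and "f \<in> kspan K"
  shows "(\<lambda>z. g z * f z) \<in> L2w \<omega>"
proof -
  obtain n :: nat and c a where a: "\<And>i. i < n \<Longrightarrow> a i \<in> disc" and f: "f = (\<lambda>z. \<Sum>i<n. c i * K z (a i))"
    using assms(2) unfolding kspan_def by blast
  have "(\<lambda>z. g z * (\<Sum>i<n. c i * K z (a i))) \<in> L2w \<omega>" using a
  proof (induction n)
    case 0
    have "wt (\<lambda>_. 0) = (\<lambda>_. 0)" by (simp add: wt_def fun_eq_iff)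
    then show ?case by (simp add: L2w_iff set_borel_measurable_def)
  next
    case (Suc n)
    have "(\<lambda>z. g z * (\<Sum>i<n. c i * K z (a i)) + c n * (g z * K z (a n))) \<in> L2w \<omega>"
      using Suc by (intro L2w_add L2w_cmult k) auto
    then show ?case by (simp add: distrib_left mult.left_commute)
  qed
  then show ?thesis by (simp add: f)
qed

lemma hankel_upper:
  assumes \<phi>: "\<phi> holomorphic_on disc" and S: "S \<ge> 0" "\<And>z. z \<in> disc \<Longrightarrow> tau \<omega> K z * cmod (deriv \<phi> z) \<le> S"
    and f: "f \<in> kspan K"
  shows "(\<lambda>z. cnj (\<phi> z) * f z) \<in> L2w \<omega>"
    "wnorm \<omega> (hankel \<omega> \<phi> f) \<le> 2 / sqrt \<delta> * sqrt C * S * wnorm \<omega> f"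
proof -
  show L: "(\<lambda>z. cnj (\<phi> z) * f z) \<in> L2w \<omega>"
    by (rule kspan_mult_L2w[OF bloch_kernel_L2w[OF \<phi> S] f])
  have c: "continuous_on disc \<phi>" "continuous_on disc (deriv \<phi>)"
    using \<phi> holomorphic_deriv[OF \<phi> open_disc] by (auto intro: holomorphic_on_imp_continuous_on)
  have e: "cnj (deriv \<phi> z * 1) + \<i> * cnj (deriv \<phi> z * \<i>) = 2 * cnj (deriv \<phi> z)" for z
    by (simp add: algebra_simps)
  show "wnorm \<omega> (hankel \<omega> \<phi> f) \<le> 2 / sqrt \<delta> * sqrt C * S * wnorm \<omega> f"
    unfolding hankel_def
  proof (rule hankel_estimate[OF kspan_A2w[OF f] L has_pd_cnj[OF has_pd_holomorphic[OF \<phi> open_disc]]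
        has_pd_cnj[OF has_pd_holomorphic[OF \<phi> open_disc]] _ _ _ S(1)])
    fix z assume "z \<in> disc"
    then show "tau \<omega> K z * cmod (cnj (deriv \<phi> z * 1) + \<i> * cnj (deriv \<phi> z * \<i>)) \<le> 2 * S"
      unfolding e using S(2) by (simp add: norm_mult)
  qed (intro continuous_intros c)+
qed

text \<open>Dividing by \<open>f\<close> on \<open>U\<close> separates the antiholomorphic part
  \<open>cnj \<phi>\<close> from a holomorphic function, which integrates to zero against
  \<open>X\<close>. The test has support in \<open>cball w r\<close>, and the larger radius
  \<open>2 * r\<close> makes \<open>f\<close> zero-free on an open neighbourhood of it.\<close>

lemma hankel_lower_local:
  assumes \<phi>: "\<phi> holomorphic_on disc" and f: "f \<in> A2w \<omega>" and L: "(\<lambda>z. cnj (\<phi> z) * f z) \<in> L2w \<omega>"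
    and r: "r > 0" "cmod w + 2 * r < 1"
    and B: "B > 0" "\<And>z. cmod (z - w) < 2 * r \<Longrightarrow> 1 \<le> B * (cmod (f z) * sqrt (\<omega> z))"
  shows "r\<^sup>2 * cmod (deriv \<phi> w) \<le> 16 * B * sqrt pi * wnorm \<omega> (hankel \<omega> \<phi> f)"
proof -
  define U where "U = ball w (2 * r)"
  have U: "open U" "cball w r \<subseteq> U" "U \<subseteq> disc"
  proof -
    show "open U" "cball w r \<subseteq> U" using r by (auto simp: U_def)
    show "U \<subseteq> disc"
    proof
      fix z assume "z \<in> U"
      then have "cmod (z - w) < 2 * r" by (simp add: U_def dist_norm norm_minus_commute)
      then show "z \<in> disc" using norm_triangle_ineq2[of z w] r by (simp add: disc_iff)
    qed
  qed
  have f0: "f z \<noteq> 0" "1 \<le> B * (cmod (f z) * sqrt (\<omega> z))" if "z \<in> U" for z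
    using B(2)[of z] that by (auto simp: U_def dist_norm norm_minus_commute)
  define g where "g = Pw \<omega> (\<lambda>z. cnj (\<phi> z) * f z)"
  have g: "g \<in> A2w \<omega>" unfolding g_def by (rule Pw_projection(1)[OF L])
  define H where "H = hankel \<omega> \<phi> f"
  have H_eq: "H z = cnj (\<phi> z) * f z - g z" for z by (simp add: H_def hankel_def g_def)
  have sH: "sqi lborel (wt H)" unfolding H_eq[abs_def] wt_diff by (intro sqi_diff L2w_sqi[OF L] A2w_sqi[OF g])
  have r1: "cmod w + r < 1" using r by simp
  have c: "continuous_on disc \<phi>" "continuous_on disc (deriv \<phi>)" "continuous_on disc f"
    using \<phi> holomorphic_deriv[OF \<phi> open_disc] A2w_hol[OF f] by (auto intro: holomorphic_on_imp_continuous_on)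
  \<comment> \<open>A multiple of the \<open>dbar\<close> derivative of \<open>bmp 3\<close>; it
    annihilates holomorphic functions near \<open>cball w r\<close>.\<close>
  define X where "X z = complex_of_real (bmp 2 r w z) * (z - w)" for z
  have X0: "X z = 0" if "z \<notin> cball w r" for z
    using bmp_eq_0[OF r(1), of z w 1] that by (auto simp: X_def dist_norm norm_minus_commute numeral_2_eq_2)
  have X_le: "cmod (X z) \<le> r" for z
  proof (cases "z \<in> cball w r")
    case True
    then have "bmp 2 r w z * cmod (z - w) \<le> 1 * r"
      by (intro mult_mono bmp_le_1) (auto simp: dist_norm norm_minus_commute)
    then show ?thesis by (simp add: X_def norm_mult)
  qed (use X0 r in simp)
  have \<phi>X: "integrable lborel (\<lambda>z. indicator U z *\<^sub>R (cnj (\<phi> z) * X z))"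
    "(\<integral>z. indicator U z *\<^sub>R (cnj (\<phi> z) * X z) \<partial>lborel) = of_real (r\<^sup>2 / 4 * bmp_mass r) * cnj (deriv \<phi> w)"
  proof -
    obtain gx gy where t: "test_fun (\<lambda>z. of_real (bmp (0 + 3) r w z)) gx gy"
      and eq: "\<And>z. gx z + \<i> * gy z = - of_real (2 * (real 0 + 3) / r\<^sup>2 * bmp (0 + 2) r w z) * (z - w)"
      using test_fun_bmp[OF r(1) r1] by blast
    have eX: "indicator disc z *\<^sub>R (cnj (\<phi> z) * (gx z + \<i> * gy z)) = of_real (- 6 / r\<^sup>2) * (indicator U z *\<^sub>R (cnj (\<phi> z) * X z))" for z
    proof -
      have g: "gx z + \<i> * gy z = of_real (- 6 / r\<^sup>2) * X z" unfolding eq by (simp add: X_def numeral_2_eq_2)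
      show ?thesis
      proof (cases "z \<in> U")
        case True
        then have "z \<in> disc" using U by blast
        then show ?thesis unfolding g using True by simp
      next
        case False
        then have "X z = 0" using X0 U by blast
        then show ?thesis unfolding g by simp
      qed
    qed
    have e2: "cnj (deriv \<phi> z * 1) + \<i> * cnj (deriv \<phi> z * \<i>) = 2 * cnj (deriv \<phi> z)" for z
      by (simp add: algebra_simps)
    have "continuous_on disc (\<lambda>z. cnj (\<phi> z))" "continuous_on disc (\<lambda>z. cnj (deriv \<phi> z * v))" for v
      by (intro continuous_intros c)+
    note ip = integral_test_fun_parts[OF t has_pd_cnj[OF has_pd_holomorphic[OF \<phi> open_disc]] has_pd_cnj[OF has_pd_holomorphic[OF \<phi> open_disc]] this(1) this(2) this(2),
      unfolded e2 eX]
    have r6: "complex_of_real (- 6 / r\<^sup>2) \<noteq> 0" using r by simp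
    have "integrable lborel (\<lambda>z. of_real (- (r\<^sup>2) / 6) * (of_real (- 6 / r\<^sup>2) * (indicator U z *\<^sub>R (cnj (\<phi> z) * X z))))"
      by (rule integrable_mult_right[OF ip(1)])
    moreover have rr: "complex_of_real (- (r\<^sup>2) / 6) * (of_real (- 6 / r\<^sup>2) * x) = x" for x
      using r by (simp flip: mult.assoc of_real_mult)
    ultimately show "integrable lborel (\<lambda>z. indicator U z *\<^sub>R (cnj (\<phi> z) * X z))" by (simp only:)
    have "isCont (deriv \<phi>) w" using c(2) continuous_on_eq_continuous_at[OF open_disc, of "deriv \<phi>"] r r1 by (auto simp: disc_iff)
    note mv = weak_hol_mean_value_cube[OF weak_hol_holomorphic[OF holomorphic_deriv[OF \<phi> open_disc]] this r(1) r1]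
    have "of_real (- 6 / r\<^sup>2) * (\<integral>z. indicator U z *\<^sub>R (cnj (\<phi> z) * X z) \<partial>lborel)
       = - (\<integral>z. indicator disc z *\<^sub>R (2 * cnj (deriv \<phi> z) * of_real (bmp (0 + 3) r w z)) \<partial>lborel)"
      using ip(3) unfolding integral_mult_right_zero .
    also have "(\<integral>z. indicator disc z *\<^sub>R (2 * cnj (deriv \<phi> z) * of_real (bmp (0 + 3) r w z)) \<partial>lborel)
       = (\<integral>z. 2 * cnj (indicator disc z *\<^sub>R (deriv \<phi> z * of_real (bmp 3 r w z))) \<partial>lborel)"
      by (rule Bochner_Integration.integral_cong) simp_all
    also have "\<dots> = 2 * cnj (3/4 * bmp_mass r * deriv \<phi> w)"
      unfolding integral_mult_right_zero Bochner_Integration.integral_cnj mv ..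
    finally have "of_real (- (r\<^sup>2) / 6) * (of_real (- 6 / r\<^sup>2) * (\<integral>z. indicator U z *\<^sub>R (cnj (\<phi> z) * X z) \<partial>lborel))
       = of_real (- (r\<^sup>2) / 6) * - (2 * cnj (3/4 * bmp_mass r * deriv \<phi> w))" by (rule arg_cong)
    then show "(\<integral>z. indicator U z *\<^sub>R (cnj (\<phi> z) * X z) \<partial>lborel) = of_real (r\<^sup>2 / 4 * bmp_mass r) * cnj (deriv \<phi> w)"
      unfolding rr by simp
  qed
  have "(\<lambda>z. g z / f z) holomorphic_on U"
    using f0(1) holomorphic_on_subset[OF A2w_hol[OF g] U(3)] holomorphic_on_subset[OF A2w_hol[OF f] U(3)]
    by (intro holomorphic_on_divide) auto
  note gf = integral_holomorphic_dbar_bmp[OF U this r(1) r1, folded X_def]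
  \<comment> \<open>Chosen so that \<open>wt H * cnj Y\<close> is
    \<open>(cnj \<phi> - g / f) * X\<close>; the lower bound on \<open>|f| * sqrt \<omega>\<close>
    then controls the norm of \<open>Y\<close>.\<close>
  define Y where "Y z = indicator U z *\<^sub>R (cnj (X z) / cnj (f z) / of_real (sqrt (\<omega> z)))" for z
  have Hpt: "wt H z * cnj (Y z) = indicator U z *\<^sub>R (cnj (\<phi> z) * X z) - indicator U z *\<^sub>R (g z / f z * X z)" for z
  proof (cases "z \<in> U")
    case True
    then have zd: "z \<in> disc" using U by blast
    have "complex_of_real (sqrt (\<omega> z)) \<noteq> 0" using \<omega>_pos[OF zd] by simp
    then show ?thesis using True zd f0(1)[OF True] by (simp add: wt_def Y_def H_eq field_simps)
  qed (simp add: Y_def)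
  have ipHY: "ip lborel (wt H) Y = of_real (r\<^sup>2 / 4 * bmp_mass r) * cnj (deriv \<phi> w)"
    unfolding ip_def Hpt using \<phi>X gf by simp
  have Y_le: "cmod (Y z) \<le> cmod (of_real (B * r) * indicator (cball w r) z :: complex)" for z
  proof (cases "z \<in> cball w r")
    case True
    then have zU: "z \<in> U" using U by blast
    have p: "cmod (f z) * sqrt (\<omega> z) > 0" using f0(1)[OF zU] \<omega>_pos[of z] U zU by auto
    have "cmod (Y z) = cmod (X z) / (cmod (f z) * sqrt (\<omega> z))"
      using zU less_imp_le[OF \<omega>_pos[of z]] U by (auto simp: Y_def norm_divide norm_mult)
    also have "\<dots> \<le> r * (B * (cmod (f z) * sqrt (\<omega> z))) / (cmod (f z) * sqrt (\<omega> z))"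
      using p X_le[of z] f0(2)[OF zU] mult_mono[of "cmod (X z)" r 1 "B * (cmod (f z) * sqrt (\<omega> z))"] r
      by (intro divide_right_mono) auto
    also have "\<dots> = B * r" unfolding mult.assoc[symmetric, of r B]
      by (subst nonzero_mult_div_cancel_right) (use p in auto)
    finally show ?thesis using True B r by (simp add: norm_mult)
  qed (use X0 in \<open>simp add: Y_def\<close>)
  have ind: "sqi lborel (\<lambda>z. of_real (B * r) * indicator (cball w r) z :: complex)"
    "nrm lborel (\<lambda>z. of_real (B * r) * indicator (cball w r) z :: complex) = B * r * (sqrt pi * r)"
  proof -
    have sq: "(cmod (of_real (B * r) * indicator (cball w r) z :: complex))\<^sup>2 = (B * r)\<^sup>2 * indicator (cball w r) z" for z
      using B r by (simp add: norm_mult power_mult_distrib indicator_def)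
    have i: "integrable lborel (\<lambda>z. indicat_real (cball w r) z)"
      using borel_integrable_compact[of "cball w r" "\<lambda>_. 1::real"] by simp
    then show "sqi lborel (\<lambda>z. of_real (B * r) * indicator (cball w r) z :: complex)"
      unfolding sqi_def sq
      by (intro conjI borel_measurable_times borel_measurable_const borel_measurable_indicator integrable_mult_right) auto
    have "measure lborel (cball w r) = pi * r\<^sup>2"
      using r emeasure_cball[of r w] by (simp add: measure_def unit_ball_vol_2)
    then show "nrm lborel (\<lambda>z. of_real (B * r) * indicator (cball w r) z :: complex) = B * r * (sqrt pi * r)"
      unfolding nrm_def sq using B r by (simp add: real_sqrt_mult)
  qed
  have Ym: "Y \<in> borel_measurable lborel"
  proof -
    have "continuous_on U (\<lambda>z. cnj (X z) / cnj (f z) / of_real (sqrt (\<omega> z)))"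
      unfolding X_def using f0(1) \<omega>_pos U(3)
      by (intro continuous_intros continuous_bmp continuous_on_subset[OF c(3) U(3)] continuous_on_subset[OF \<omega>_cont U(3)]) force+
    then show ?thesis unfolding Y_def[abs_def] using borel_measurable_continuous_on_indicator[OF _ , of U] U(1) by auto
  qed
  note Y = sqi_mono_AE[OF Ym ind(1) AE_I2[OF Y_le]]
  \<comment> \<open>One factor \<open>1/4\<close> belongs to the pairing, the other to the lower
    bound for \<open>bmp_mass r\<close>; together they produce the constant 16.\<close>
  have "r\<^sup>2 / 4 * (r\<^sup>2 / 4) * cmod (deriv \<phi> w) \<le> r\<^sup>2 / 4 * bmp_mass r * cmod (deriv \<phi> w)"
    using bmp_mass_ge[OF r(1)] by (intro mult_right_mono mult_left_mono) auto
  also have "\<dots> = cmod (ip lborel (wt H) Y)"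
    unfolding ipHY using bmp_mass_pos[OF r(1)] by (simp add: norm_mult norm_power)
  also have "\<dots> \<le> nrm lborel (wt H) * nrm lborel Y" by (rule cauchy_schwarz[OF sH Y(1)])
  also have "\<dots> \<le> nrm lborel (wt H) * (B * r * (sqrt pi * r))"
    using Y(2) unfolding ind(2) by (intro mult_left_mono) auto
  finally have "r\<^sup>2 * (r\<^sup>2 * cmod (deriv \<phi> w)) \<le> r\<^sup>2 * (16 * B * sqrt pi * nrm lborel (wt H))"
    by (simp add: power2_eq_square field_simps)
  then have "r\<^sup>2 * cmod (deriv \<phi> w) \<le> 16 * B * sqrt pi * nrm lborel (wt H)"
    using r by (simp only: mult_le_cancel_left_pos zero_less_power)
  then show ?thesis by (simp add: wnorm_eq H_def)
qed

end

theorem theorem3p3: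
  fixes \<omega> :: "complex \<Rightarrow> real" and K :: "complex \<Rightarrow> complex \<Rightarrow> complex"
  assumes "is_weight \<omega>"
    and "is_repr_kernel \<omega> K"
    and "class_W_star \<omega> K"
  shows "\<exists>c C. 0 < c \<and> 0 < C \<and>
           (\<forall>\<phi>. \<phi> holomorphic_on disc \<longrightarrow>
              (hankel_bounded \<omega> K \<phi> \<longleftrightarrow> \<phi> \<in> bloch_w \<omega> K) \<and>
              (\<phi> \<in> bloch_w \<omega> K \<longrightarrow>
                 c * bloch_seminorm \<omega> K \<phi> \<le> hankel_norm \<omega> K \<phi> \<and>
                 hankel_norm \<omega> K \<phi> \<le> C * bloch_seminorm \<omega> K \<phi>))"
proof -
  obtain p \<rho> \<delta> C where p: "C2_on disc p" "\<And>z. z \<in> disc \<Longrightarrow> \<omega> z = exp (- p z)" and d: "\<delta> > 0" "C > 0"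
    and \<rho>: "continuous_on disc \<rho>" "\<And>z. z \<in> disc \<Longrightarrow> \<delta> \<le> (tau \<omega> K z)\<^sup>2 * \<rho> z"
    and est: "\<And>g gx gy. test_fun g gx gy \<Longrightarrow>
       (\<integral>z. indicator disc z *\<^sub>R (exp (p z) * (cmod (g z))\<^sup>2 * \<rho> z) \<partial>lborel)
       \<le> C * (\<integral>z. indicator disc z *\<^sub>R (exp (p z) * (cmod (gx z + \<i> * gy z))\<^sup>2) \<partial>lborel)"
    by (rule W_star_dbar_estimate[OF assms(3)], rule that)
  interpret hankel_weight \<omega> p K \<rho> \<delta> C
  proof
    show "continuous_on disc p" using p(1) by (simp add: C2_on_def C1_on_def)
  qed (fact assms p d \<rho> est)+
  have W: "class_W \<omega> K" using assms(3) by (simp add: class_W_star_def)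
  obtain C0 where C0: "\<And>z. z \<in> disc \<Longrightarrow> tau \<omega> K z \<le> C0 * (1 - cmod z)"
    using W unfolding class_W_def by blast
  have "\<exists>\<eta>>0. \<exists>C>0. \<forall>z\<in>disc. \<forall>\<zeta>\<in>disc. cmod (z - \<zeta>) \<le> \<eta> * tau \<omega> K z \<longrightarrow>
         tau \<omega> K z \<le> C * tau \<omega> K \<zeta> \<and> tau \<omega> K \<zeta> \<le> C * tau \<omega> K z \<and>
         knorm \<omega> K z * knorm \<omega> K \<zeta> \<le> C * cmod (K \<zeta> z)"
    using W unfolding class_W_def by (elim conjE)
  then obtain \<eta> C1 where \<eta>: "\<eta> > 0" "C1 > 0"
    and W3: "\<And>z \<zeta>. z \<in> disc \<Longrightarrow> \<zeta> \<in> disc \<Longrightarrow> cmod (z - \<zeta>) \<le> \<eta> * tau \<omega> K z \<Longrightarrow>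
         tau \<omega> K \<zeta> \<le> C1 * tau \<omega> K z \<and> knorm \<omega> K z * knorm \<omega> K \<zeta> \<le> C1 * cmod (K \<zeta> z)"
    by blast
  \<comment> \<open>\<open>2 * e \<le> \<eta>\<close> puts the disc of radius
    \<open>2 * e * tau\<close> inside the region of condition (iii), and the second bound gives
    \<open>4 * e * tau \<le> 1 - cmod w\<close>, so that this disc stays in the unit disc. The
    maximum with 1 is there because no sign of \<open>C0\<close> is given.\<close>
  define e where "e = min (\<eta> / 2) (1 / (4 * max C0 1))"
  have e: "e > 0" "2 * e \<le> \<eta>" "e * max C0 1 \<le> 1 / 4"
  proof -
    show "e > 0" "2 * e \<le> \<eta>" using \<eta> by (auto simp: e_def)
    have "e * max C0 1 \<le> 1 / (4 * max C0 1) * max C0 1" unfolding e_def by (intro mult_right_mono) auto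
    then show "e * max C0 1 \<le> 1 / 4" by simp
  qed
  define Q1 where "Q1 = 2 / sqrt \<delta> * sqrt C"
  \<comment> \<open>The local lower bound is applied with radius \<open>e * t\<close> and constant
    \<open>C1\<^sup>2 * t\<close>; dividing by \<open>e\<^sup>2 * t\<close> leaves
    \<open>t * |\<phi>' w|\<close> and this constant.\<close>
  define Q2 where "Q2 = 16 * C1\<^sup>2 * sqrt pi / e\<^sup>2"
  have Q: "Q1 > 0" "Q2 > 0" using d e \<eta> by (auto simp: Q1_def Q2_def)
  have lower: "\<exists>f\<in>kspan K. wnorm \<omega> f = 1 \<and> tau \<omega> K w * cmod (deriv \<phi> w) \<le> Q2 * wnorm \<omega> (hankel \<omega> \<phi> f)"
    if \<phi>: "\<phi> holomorphic_on disc" and L: "\<And>f. f \<in> kspan K \<Longrightarrow> (\<lambda>z. cnj (\<phi> z) * f z) \<in> L2w \<omega>" and w: "w \<in> disc" for \<phi> w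
  proof -
    define \<kappa> where "\<kappa> = knorm \<omega> K w"
    define t where "t = tau \<omega> K w"
    have \<kappa>: "\<kappa> > 0" using knorm_pos[OF w] by (simp add: \<kappa>_def)
    have t: "t > 0" using tau_pos[OF w] by (simp add: t_def)
    define f where "f = (\<lambda>z. of_real (1 / \<kappa>) * K z w)"
    have f: "f \<in> kspan K"
      unfolding kspan_def f_def
      by (rule CollectI, rule exI[of _ 1], rule exI[of _ "\<lambda>_. of_real (1 / \<kappa>)"], rule exI[of _ "\<lambda>_. w"]) (simp add: w)
    have "wnorm \<omega> f = 1"
      unfolding f_def wnorm_eq wt_cmult nrm_cmult using \<kappa> by (simp add: \<kappa>_def knorm_def wnorm_eq norm_divide)
    moreover have "(e * t)\<^sup>2 * cmod (deriv \<phi> w) \<le> 16 * (C1\<^sup>2 * t) * sqrt pi * wnorm \<omega> (hankel \<omega> \<phi> f)"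
    proof (rule hankel_lower_local[OF \<phi> kspan_A2w[OF f] L[OF f]])
      show "0 < e * t" "0 < C1\<^sup>2 * t" using e t \<eta> by auto
      have "e * t \<le> e * (max C0 1 * (1 - cmod w))"
      proof (rule mult_left_mono)
        have "C0 * (1 - cmod w) \<le> max C0 1 * (1 - cmod w)" using w by (intro mult_right_mono) (auto simp: disc_iff)
        then show "t \<le> max C0 1 * (1 - cmod w)" using C0[OF w] by (simp add: t_def)
      qed (use e in simp)
      also have "\<dots> = (e * max C0 1) * (1 - cmod w)" by simp
      also have "\<dots> \<le> 1 / 4 * (1 - cmod w)" using e(3) w by (intro mult_right_mono) (auto simp: disc_iff)
      finally have "4 * (e * t) \<le> 1 - cmod w" by simp
      then show small: "cmod w + 2 * (e * t) < 1" using \<open>0 < e * t\<close> by linarith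
      fix z assume z: "cmod (z - w) < 2 * (e * t)"
      have zd: "z \<in> disc" using z small norm_triangle_ineq2[of z w] by (simp add: disc_iff)
      have "(2 * e) * t \<le> \<eta> * t" using e(2) t by (intro mult_right_mono) auto
      then have near: "cmod (w - z) \<le> \<eta> * tau \<omega> K w" using z by (simp add: t_def norm_minus_commute)
      have s: "sqrt (\<omega> z) > 0" using \<omega>_pos[OF zd] by simp
      have kz: "knorm \<omega> K z > 0" by (rule knorm_pos[OF zd])
      have tz: "tau \<omega> K z * (sqrt (\<omega> z) * knorm \<omega> K z) = 1" using s kz by (simp add: tau_def)
      \<comment> \<open>One factor \<open>C1\<close> compares \<open>tau\<close> at \<open>z\<close>
        and at \<open>w\<close>; the second one, below, comes from the off-diagonal lower bound for
        the kernel.\<close>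
      have "1 \<le> (C1 * t) * (sqrt (\<omega> z) * knorm \<omega> K z)"
        unfolding tz[symmetric] using W3[OF w zd near] s kz by (intro mult_right_mono) (auto simp: t_def)
      also have "knorm \<omega> K z \<le> C1 * cmod (f z)"
      proof -
        have "knorm \<omega> K z = (\<kappa> * knorm \<omega> K z) / \<kappa>" using \<kappa> by simp
        also have "\<dots> \<le> (C1 * cmod (K z w)) / \<kappa>" using W3[OF w zd near] \<kappa> by (intro divide_right_mono) (auto simp: \<kappa>_def)
        also have "\<dots> = C1 * cmod (f z)" using \<kappa> by (simp add: f_def norm_divide)
        finally show ?thesis .
      qed
      finally show "1 \<le> C1\<^sup>2 * t * (cmod (f z) * sqrt (\<omega> z))"
        using \<eta> t s by (simp add: power2_eq_square mult_ac)
    qed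
    then have "(e\<^sup>2 * t) * (t * cmod (deriv \<phi> w)) \<le> (e\<^sup>2 * t) * (Q2 * wnorm \<omega> (hankel \<omega> \<phi> f))"
      using e by (simp add: Q2_def power2_eq_square mult_ac)
    then have "t * cmod (deriv \<phi> w) \<le> Q2 * wnorm \<omega> (hankel \<omega> \<phi> f)"
      by (rule mult_left_le_imp_le) (use e t in auto)
    ultimately show ?thesis using f by (auto simp: t_def)
  qed
  have upper: "hankel_bounded \<omega> K \<phi>" "\<And>f. f \<in> kspan K \<Longrightarrow> wnorm \<omega> (hankel \<omega> \<phi> f) \<le> Q1 * bloch_seminorm \<omega> K \<phi> * wnorm \<omega> f"
    "0 \<le> bloch_seminorm \<omega> K \<phi>" if \<phi>: "\<phi> holomorphic_on disc" "\<phi> \<in> bloch_w \<omega> K" for \<phi>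
  proof -
    let ?S = "bloch_seminorm \<omega> K \<phi>"
    have bd: "bdd_above ((\<lambda>z. tau \<omega> K z * cmod (deriv \<phi> z)) ` disc)" using \<phi> by (simp add: bloch_w_def)
    have S: "tau \<omega> K z * cmod (deriv \<phi> z) \<le> ?S" if "z \<in> disc" for z
      unfolding bloch_seminorm_def using bd that by (rule cSUP_upper2) simp
    have "0 \<le> tau \<omega> K 0 * cmod (deriv \<phi> 0)" using tau_pos[of 0] by (simp add: disc_iff)
    also have "\<dots> \<le> ?S" by (rule S) (simp add: disc_iff)
    finally show S0: "0 \<le> ?S" .
    show u: "wnorm \<omega> (hankel \<omega> \<phi> f) \<le> Q1 * ?S * wnorm \<omega> f" if "f \<in> kspan K" for f
      using hankel_upper(2)[OF \<phi>(1) S0 S that] by (simp add: Q1_def)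
    show "hankel_bounded \<omega> K \<phi>"
      unfolding hankel_bounded_def using hankel_upper(1)[OF \<phi>(1) S0 S] u by blast
  qed
  show ?thesis
  proof (rule exI[of _ "1 / Q2"], rule exI[of _ Q1], intro conjI allI impI)
    show "0 < 1 / Q2" "0 < Q1" using Q by auto
    fix \<phi> assume \<phi>: "\<phi> holomorphic_on disc"
    show "hankel_bounded \<omega> K \<phi> \<longleftrightarrow> \<phi> \<in> bloch_w \<omega> K"
    proof
      assume hb: "hankel_bounded \<omega> K \<phi>"
      then have L: "\<And>f. f \<in> kspan K \<Longrightarrow> (\<lambda>z. cnj (\<phi> z) * f z) \<in> L2w \<omega>" by (simp add: hankel_bounded_def)
      obtain A where A: "\<And>f. f \<in> kspan K \<Longrightarrow> wnorm \<omega> (hankel \<omega> \<phi> f) \<le> A * wnorm \<omega> f"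
        using hb unfolding hankel_bounded_def by blast
      have "tau \<omega> K w * cmod (deriv \<phi> w) \<le> Q2 * A" if w: "w \<in> disc" for w
      proof -
        obtain f where f: "f \<in> kspan K" "wnorm \<omega> f = 1" "tau \<omega> K w * cmod (deriv \<phi> w) \<le> Q2 * wnorm \<omega> (hankel \<omega> \<phi> f)"
          using lower[OF \<phi> L w] by blast
        have "Q2 * wnorm \<omega> (hankel \<omega> \<phi> f) \<le> Q2 * A" using A[OF f(1)] f(2) Q by (intro mult_left_mono) auto
        then show ?thesis using f(3) by linarith
      qed
      then have "bdd_above ((\<lambda>z. tau \<omega> K z * cmod (deriv \<phi> z)) ` disc)" by (rule bdd_aboveI2)
      then show "\<phi> \<in> bloch_w \<omega> K" using \<phi> by (simp add: bloch_w_def)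
    qed (rule upper(1)[OF \<phi>])
    assume b: "\<phi> \<in> bloch_w \<omega> K"
    note u = upper[OF \<phi> b]
    have L: "\<And>f. f \<in> kspan K \<Longrightarrow> (\<lambda>z. cnj (\<phi> z) * f z) \<in> L2w \<omega>" using u(1) by (simp add: hankel_bounded_def)
    let ?N = "{wnorm \<omega> (hankel \<omega> \<phi> f) | f. f \<in> kspan K \<and> wnorm \<omega> f \<le> 1}"
    have le: "x \<le> Q1 * bloch_seminorm \<omega> K \<phi>" if xN: "x \<in> ?N" for x
    proof -
      obtain f where f: "x = wnorm \<omega> (hankel \<omega> \<phi> f)" "f \<in> kspan K" "wnorm \<omega> f \<le> 1" using xN by blast
      have "Q1 * bloch_seminorm \<omega> K \<phi> * wnorm \<omega> f \<le> Q1 * bloch_seminorm \<omega> K \<phi> * 1"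
        using f(3) u(3) Q by (intro mult_left_mono) auto
      then show ?thesis using u(2)[OF f(2)] f(1) by simp
    qed
    have bdd: "bdd_above ?N" using le by (rule bdd_aboveI)
    \<comment> \<open>A normalised kernel shows that the supremum defining
      \<open>hankel_norm\<close> is over a nonempty set.\<close>
    obtain f0 where "f0 \<in> kspan K" "wnorm \<omega> f0 = 1" using lower[OF \<phi> L, of 0] by (auto simp: disc_iff)
    then have ne: "?N \<noteq> {}" by force
    show "hankel_norm \<omega> K \<phi> \<le> Q1 * bloch_seminorm \<omega> K \<phi>"
      unfolding hankel_norm_def by (rule cSup_least[OF ne le])
    have "bloch_seminorm \<omega> K \<phi> \<le> Q2 * hankel_norm \<omega> K \<phi>"
      unfolding bloch_seminorm_def
    proof (rule cSUP_least)
      show "disc \<noteq> {}" by (simp add: disc_def)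
      fix w assume w: "w \<in> disc"
      obtain f where f: "f \<in> kspan K" "wnorm \<omega> f = 1" "tau \<omega> K w * cmod (deriv \<phi> w) \<le> Q2 * wnorm \<omega> (hankel \<omega> \<phi> f)"
        using lower[OF \<phi> L w] by blast
      have "wnorm \<omega> (hankel \<omega> \<phi> f) \<le> hankel_norm \<omega> K \<phi>"
        unfolding hankel_norm_def by (rule cSup_upper[OF _ bdd]) (use f in auto)
      then have "Q2 * wnorm \<omega> (hankel \<omega> \<phi> f) \<le> Q2 * hankel_norm \<omega> K \<phi>" using Q by (intro mult_left_mono) auto
      then show "tau \<omega> K w * cmod (deriv \<phi> w) \<le> Q2 * hankel_norm \<omega> K \<phi>" using f(3) by linarith
    qed
    then show "1 / Q2 * bloch_seminorm \<omega> K \<phi> \<le> hankel_norm \<omega> K \<phi>"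
      using Q by (simp add: field_simps)
  qed
qed

end
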